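(* Let $\alpha>1$, let $f\in\mathcal{A}$ with $|v|^\alpha\widehat f(v)\in L^2(\mathbb{R})\cap C_b(\mathbb{R})$, and let $f_{\rm e}(t)=\frac{f(t)+f(-t)}{2}$ be the even part of $f$. For $t_0>0$ let $\lambda$ be a non-negative, nonincreasing function on $[t_0,\infty)$. Then the following statements are equivalent: (i) $\mathrm{dist}_\infty(D_{\rm s}^{\{\alpha\}}f_{\rm e},B_\sigma^1)=\mathcal{O}(\lambda(\sigma))$ as $\sigma\to\infty$; (ii) $R_\sigma(f)=\mathcal{O}(\sigma^{-\alpha}\lambda(\sigma))$ as $\sigma\to\infty$.
   Context: Fourier transform: $\widehat f(v)=\frac{1}{\sqrt{2\pi}}\int_{\mathbb{R}} f(u)e^{-iuv}\,du$, defined as a Lebesgue integral for $f\in L^1(\mathbb{R})$ and by the usual limiting process for $f\in L^2(\mathbb{R})$. $C_b(\mathbb{R})$ is the class of continuous bounded functions $f:\mathbb{R}\to\mathbb{C}$. $\mathcal{A}=\{f\in L^1(\mathbb{R})\cap C_b(\mathbb{R}) : f\in \mathrm{BV}(\mathbb{R})\text{ or }\widehat f\in \mathrm{BV}(\mathbb{R})\}$, where $\mathrm{BV}(\mathbb{R})$ is the set of functions of bounded variation over $\mathbb{R}$. For $f\in\mathcal{A}$, $\sigma>0$ and $h=2\pi/\sigma$, $R_\sigma(f)$ denotes the remainder in the quadrature formula $\int_{-\infty}^\infty f(t)\,dt=h\sum_{k\in\mathbb{Z}}f(hk)+R_\sigma(f)$; by the Poisson summation formula, $R_\sigma(f)=-\sqrt{2\pi}\sum_{k\in\mathbb{Z}\setminus\{0\}}\widehat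 f(k\sigma)$. Bernstein space: $B_\sigma^1$ is the set of all $f\in L^1(\mathbb{R})$ whose Fourier transform vanishes outside $(-\sigma,\sigma)$. For $f\in L^2(\mathbb{R})$ with $\widehat f\in C_b(\mathbb{R})$, $\mathrm{dist}_\infty(f,B_\sigma^1):=\inf_{g\in B_\sigma^1}\sup_{v\in\mathbb{R}}|\widehat f(v)-\widehat g(v)|$. Strong Riesz derivative: a function $f\in L^2(\mathbb{R})$ has a strong Riesz derivative of order $\alpha$, $0<\alpha<2j$, $j\in\mathbb{N}$, if there is $g\in L^2(\mathbb{R})$ with $$\lim_{\varepsilon\to0+}\Big\|\frac{1}{C_{\alpha,2j}}\int_\varepsilon^\infty\frac{\overline\Delta_u^{2j}f(\cdot)}{u^{1+\alpha}}\,du-g(\cdot)\Big\|_{L^2(\mathbb{R})}=0,$$ where $\overline\Delta_u^{2j}f(x)=\sum_{k=0}^{2j}(-1)^k\binom{2j}{k}f(x+(j-k)u)$ and $C_{\alpha,2j}=(-1)^j2^{2j-\alpha}\int_0^\infty\frac{\sin^{2j}u}{u^{1+\alpha}}\,du$; then $D_{\rm s}^{\{\alpha\}}f:=g$ (independent of $j$). It is known that $f\in L^2(\mathbb{R})$ has a strong Riesz derivative of order $\alpha$ if and only if there is $g\in L^2(\mathbb{R})$ with $\widehat g(v)=|v|^\alpha\widehat f(v)$, and then $\widehat{D_{\rm s}^{\{\alpha\}}f}(v)=|v|^\alpha\widehat f(v)$. *)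

theory Defs
  imports "HOL-Analysis.Analysis" "HOL-Library.Landau_Symbols"
begin

text \<open>
  Elements of \<open>L\<^sup>1\<close> and \<open>L\<^sup>2\<close> are represented by Borel measurable functions; every class of
  Lebesgue measurable functions modulo null sets has such a representative.
  The space of bounded continuous functions is the library's set \<^const>\<open>bcontfun\<close>.
\<close>

definition L1 :: "(real \<Rightarrow> complex) set" where
  "L1 = {f. integrable lborel f}"

definition L2 :: "(real \<Rightarrow> complex) set" where
  "L2 = {f. f \<in> borel_measurable lborel \<and> integrable lborel (\<lambda>x. (norm (f x))\<^sup>2)}"

definition L2_norm :: "(real \<Rightarrow> complex) \<Rightarrow> real" where
  "L2_norm f = sqrt (LINT x|lborel. (norm (f x))\<^sup>2)"

text \<open>
  The membership clause is needed because the Bochner integral of a non-integrable function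
  is \<open>0\<close>.
\<close>

definition tendsto_L2 ::
    "('i \<Rightarrow> real \<Rightarrow> complex) \<Rightarrow> (real \<Rightarrow> complex) \<Rightarrow> 'i filter \<Rightarrow> bool" where
  "tendsto_L2 X g F \<longleftrightarrow>
     (\<forall>\<^sub>F i in F. (\<lambda>x. X i x - g x) \<in> L2) \<and>
     ((\<lambda>i. L2_norm (\<lambda>x. X i x - g x)) \<longlongrightarrow> 0) F"

definition BV :: "(real \<Rightarrow> complex) set" where
  "BV = {f. \<exists>M. \<forall>(n::nat) (x::nat \<Rightarrow> real). mono x \<longrightarrow>
              (\<Sum>i<n. norm (f (x (Suc i)) - f (x i))) \<le> M}"

definition fourier :: "(real \<Rightarrow> complex) \<Rightarrow> real \<Rightarrow> complex" where
  "fourier f v =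
     complex_of_real (1 / sqrt (2 * pi)) *
     (LINT u|lborel. f u * exp (- (\<i> * complex_of_real u * complex_of_real v)))"

definition has_L2_fourier :: "(real \<Rightarrow> complex) \<Rightarrow> (real \<Rightarrow> complex) \<Rightarrow> bool" where
  "has_L2_fourier f F \<longleftrightarrow> f \<in> L2 \<and> F \<in> L2 \<and>
     tendsto_L2 (\<lambda>r::real. fourier (\<lambda>u. indicator {-r..r} u *\<^sub>R f u)) F at_top"

text \<open>
  The \<open>L\<^sup>2\<close> Fourier transform is determined only almost everywhere. Where it is required to be
  in \<^const>\<open>bcontfun\<close>, this selects its (unique) bounded continuous representative.
\<close>

definition fourier_Cb :: "(real \<Rightarrow> complex) \<Rightarrow> real \<Rightarrow> complex" where
  "fourier_Cb f = (THE F. F \<in> bcontfun \<and> has_L2_fourier f F)"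

definition class_A :: "(real \<Rightarrow> complex) set" where
  "class_A = {f. f \<in> L1 \<inter> bcontfun \<and> (f \<in> BV \<or> fourier f \<in> BV)}"

text \<open>
  The bilateral series is summed by symmetric partial sums, the usual convention for the
  Poisson summation formula; if only the Fourier transform of \<open>f\<close> is of bounded variation, the
  series need not converge absolutely. For absolutely convergent series this is the usual sum.
\<close>

definition quad_remainder :: "real \<Rightarrow> (real \<Rightarrow> complex) \<Rightarrow> complex" where
  "quad_remainder \<sigma> f =
     (let h = 2 * pi / \<sigma> in
       (LINT t|lborel. f t) -
       complex_of_real h * lim (\<lambda>N::nat. \<Sum>k = - int N..int N. f (h * real_of_int k)))"

definition Bernstein1 :: "real \<Rightarrow> (real \<Rightarrow> complex) set" where
  "Bernstein1 \<sigma> = {f \<in> L1. \<forall>v. v \<notin> {-\<sigma><..<\<sigma>} \<longrightarrow> fourier f v = 0}"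

definition dist_infty_Bernstein1 :: "(real \<Rightarrow> complex) \<Rightarrow> real \<Rightarrow> real" where
  "dist_infty_Bernstein1 f \<sigma> =
     (INF g \<in> Bernstein1 \<sigma>. SUP v. norm (fourier_Cb f v - fourier g v))"

definition central_diff :: "nat \<Rightarrow> real \<Rightarrow> (real \<Rightarrow> complex) \<Rightarrow> real \<Rightarrow> complex" where
  "central_diff j u f x =
     (\<Sum>k\<le>2 * j. (-1) ^ k * of_nat ((2 * j) choose k) * f (x + (real j - real k) * u))"

definition Riesz_const :: "real \<Rightarrow> nat \<Rightarrow> real" where
  "Riesz_const \<alpha> j =
     (-1) ^ j * 2 powr (2 * real j - \<alpha>) *
     (LINT u:{0<..}|lborel. sin u ^ (2 * j) / u powr (1 + \<alpha>))"

definition has_strong_Riesz_derivative ::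
    "real \<Rightarrow> nat \<Rightarrow> (real \<Rightarrow> complex) \<Rightarrow> (real \<Rightarrow> complex) \<Rightarrow> bool" where
  "has_strong_Riesz_derivative \<alpha> j f g \<longleftrightarrow>
     0 < \<alpha> \<and> \<alpha> < 2 * real j \<and> f \<in> L2 \<and> g \<in> L2 \<and>
     tendsto_L2
       (\<lambda>\<epsilon> x. complex_of_real (1 / Riesz_const \<alpha> j) *
              (LINT u:{\<epsilon>..}|lborel. central_diff j u f x / complex_of_real (u powr (1 + \<alpha>))))
       g (at_right 0)"

text \<open>
  The derivative does not depend on \<open>j\<close> and is unique only up to null sets; the operator
  selects some representative.
\<close>

definition strong_Riesz_derivative :: "real \<Rightarrow> (real \<Rightarrow> complex) \<Rightarrow> real \<Rightarrow> complex" where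
  "strong_Riesz_derivative \<alpha> f = (SOME g. \<exists>j. has_strong_Riesz_derivative \<alpha> j f g)"

definition even_part :: "(real \<Rightarrow> complex) \<Rightarrow> real \<Rightarrow> complex" where
  "even_part f t = (f t + f (- t)) / 2"

end

(*
  The strong Riesz derivative of f_e has the L^2 Fourier transform |v|^alpha f_e^(v), so the distance to
  the Bernstein space equals the supremum of |v|^alpha |f_e^(v)| over |v| >= sigma: a transform
  vanishing outside (-sigma, sigma) cannot do better there, and piecewise linear interpolation,
  a combination of shifted Fejer kernels on the time side, achieves it. The Poisson summation
  formula gives R_sigma(f) = -2 sqrt(2 pi) sum_{k >= 1} f_e^(k sigma). One direction of the
  equivalence estimates this sum termwise by the convergent series sum k^(-alpha); the other
  recovers f_e^(sigma) from the remainders R_{n sigma}(f) by Moebius inversion.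

  For the Poisson formula, the Fejer means of the samples f(hk) converge to the periodization of
  the transform. A Tauberian argument passes to the partial sums: the samples are absolutely
  summable if f is BV, and f(t) = O(1/|t|) if f^ is BV.
*)

theory Submission
  imports Defs "HOL-Probability.Characteristic_Functions" "HOL-Computational_Algebra.Squarefree"
begin

section \<open>The Fourier transform on integrable functions\<close>

text \<open>The remainder sees the transform only through
  \<open>fourier f v + fourier f (- v)\<close>, which is why the even part appears. A bound on
  \<open>|v|^\<alpha> * fourier f v\<close> with \<alpha> > 1 makes the transform integrable; as f
  is continuous, inversion then holds at every point, and the L2 theory reduces to a Plancherel
  inequality for integrable functions plus completeness. Completeness is needed because the
  derivative is selected by a choice operator: its existence as an L2 limit has to be shown before
  anything can be said about it, and its L2 transform is again a limit, over cut-offs to bounded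
  intervals. Partial sums of the samples lead to a kernel without a sign, while their Cesaro means
  lead to a positive kernel of fixed mass, for which cell-by-cell limits and dominated summation are
  available. In the direction from the remainder to the distance, monotonicity of \<open>lam\<close>
  acts twice: it pulls the bounds at the multiples n * v back to \<open>lam v\<close>, and the
  bounds at all v \<ge> \<sigma> back to \<open>lam \<sigma>\<close>.\<close>

lemma norm_exp_neg_i [simp]: "norm (exp (- (\<i> * complex_of_real u * complex_of_real v))) = 1"
  using norm_exp_i_times[of "- (u * v)"] by (simp add: mult.assoc)

lemma integrable_mult_unimodular:
  fixes f w :: "real \<Rightarrow> complex"
  assumes "integrable lborel f" "w \<in> borel_measurable borel" "\<And>x. norm (w x) \<le> 1"
  shows "integrable lborel (\<lambda>x. f x * w x)"
proof (rule Bochner_Integration.integrable_bound[OF assms(1)])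
  show "(\<lambda>x. f x * w x) \<in> borel_measurable lborel"
    using assms(1,2) by measurable
  show "AE x in lborel. norm (f x * w x) \<le> norm (f x)"
    using assms(3) by (auto simp: norm_mult mult_left_le)
qed

lemma integrable_fourier_kernel:
  assumes "integrable lborel f"
  shows "integrable lborel (\<lambda>u. f u * exp (- (\<i> * complex_of_real u * complex_of_real v)))"
  by (rule integrable_mult_unimodular[OF assms]) auto

text \<open>The normalising factor \<open>1 / sqrt (2 * pi)\<close> is below 1 and is dropped; none
  of the later estimates depends on a sharp constant.\<close>

lemma norm_fourier_le:
  assumes "integrable lborel f"
  shows "norm (fourier f v) \<le> (LINT u|lborel. norm (f u))"
proof -
  have "norm (LINT u|lborel. f u * exp (- (\<i> * complex_of_real u * complex_of_real v)))
        \<le> (LINT u|lborel. norm (f u))"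
    using integral_norm_bound[of lborel "\<lambda>u. f u * exp (- (\<i> * complex_of_real u * complex_of_real v))"]
    by (simp add: norm_mult)
  moreover have "norm (complex_of_real (1 / sqrt (2 * pi))) \<le> 1"
    using pi_gt3 by (auto simp: norm_divide real_sqrt_ge_one)
  ultimately show ?thesis
    unfolding fourier_def norm_mult
    using mult_mono[of "norm (complex_of_real (1 / sqrt (2 * pi)))" 1] by fastforce
qed

lemma isCont_fourier:
  assumes "integrable lborel f"
  shows "isCont (fourier f) v"
proof -
  have [measurable]: "f \<in> borel_measurable borel" using assms by auto
  have "((\<lambda>v. LINT u|lborel. f u * exp (- (\<i> * complex_of_real u * complex_of_real v))) \<longlongrightarrow>
         (LINT u|lborel. f u * exp (- (\<i> * complex_of_real u * complex_of_real v)))) (at v)"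
    unfolding tendsto_at_iff_sequentially comp_def
  proof (intro allI impI)
    fix X :: "nat \<Rightarrow> real" assume X: "\<forall>i. X i \<in> UNIV - {v}" "X \<longlonglongrightarrow> v"
    show "(\<lambda>i. LINT u|lborel. f u * exp (- (\<i> * complex_of_real u * complex_of_real (X i))))
        \<longlonglongrightarrow> (LINT u|lborel. f u * exp (- (\<i> * complex_of_real u * complex_of_real v)))"
    proof (rule integral_dominated_convergence[where w="\<lambda>u. norm (f u)"])
      show "AE u in lborel. (\<lambda>i. f u * exp (- (\<i> * complex_of_real u * complex_of_real (X i))))
           \<longlonglongrightarrow> f u * exp (- (\<i> * complex_of_real u * complex_of_real v))"
        by (intro AE_I2 tendsto_intros X(2))
    qed (use assms in \<open>auto simp: norm_mult\<close>)
  qed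
  then show ?thesis
    unfolding isCont_def fourier_def by (intro tendsto_intros)
qed

lemma fourier_bcontfun:
  assumes "integrable lborel f"
  shows "fourier f \<in> bcontfun"
  using isCont_fourier[OF assms] norm_fourier_le[OF assms]
  by (intro bcontfun_normI continuous_at_imp_continuous_on) auto

lemma borel_measurable_fourier:
  "integrable lborel f \<Longrightarrow> fourier f \<in> borel_measurable borel"
  using isCont_fourier by (intro borel_measurable_continuous_onI continuous_at_imp_continuous_on) auto

lemma fourier_add:
  assumes "integrable lborel f" "integrable lborel g"
  shows "fourier (\<lambda>x. f x + g x) v = fourier f v + fourier g v"
  unfolding fourier_def
  by (simp add: distrib_right Bochner_Integration.integral_add[OF assms[THEN integrable_fourier_kernel]]
      distrib_left)

lemma fourier_diff:
  assumes "integrable lborel f" "integrable lborel g"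
  shows "fourier (\<lambda>x. f x - g x) v = fourier f v - fourier g v"
  unfolding fourier_def
  by (simp add: left_diff_distrib Bochner_Integration.integral_diff[OF assms[THEN integrable_fourier_kernel]]
      right_diff_distrib)

lemma fourier_cmult: "fourier (\<lambda>x. c * f x) v = c * fourier f v"
  unfolding fourier_def by (simp add: mult.assoc)

lemma fourier_sum:
  assumes "\<And>i. i \<in> I \<Longrightarrow> integrable lborel (f i)"
  shows "fourier (\<lambda>x. \<Sum>i\<in>I. f i x) v = (\<Sum>i\<in>I. fourier (f i) v)"
  using assms unfolding fourier_def
  by (simp add: sum_distrib_right Bochner_Integration.integral_sum[OF integrable_fourier_kernel] sum_distrib_left)

text \<open>Reflection, translation and dilation are all special cases. The factor
  \<open>\<bar>a\<bar>\<close> comes from substitution in a Lebesgue integral, where the orientation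
  is lost.\<close>

lemma fourier_affine:
  assumes "a \<noteq> 0"
  shows "fourier (\<lambda>x. f (b + a * x)) v =
    exp (\<i> * complex_of_real b * complex_of_real (v / a)) * fourier f (v / a) / complex_of_real \<bar>a\<bar>"
proof -
  have "(LINT u|lborel. f u * exp (- (\<i> * complex_of_real u * complex_of_real (v / a)))) =
     \<bar>a\<bar> *\<^sub>R (LINT u|lborel. f (b + a * u) *
        exp (- (\<i> * complex_of_real (b + a * u) * complex_of_real (v / a))))"
    by (rule lborel_integral_real_affine[OF assms])
  also have "(\<lambda>u. f (b + a * u) * exp (- (\<i> * complex_of_real (b + a * u) * complex_of_real (v / a))))
     = (\<lambda>u. exp (- (\<i> * complex_of_real b * complex_of_real (v / a))) *
          (f (b + a * u) * exp (- (\<i> * complex_of_real u * complex_of_real v))))"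
  proof
    fix u
    have "- (\<i> * complex_of_real (b + a * u) * complex_of_real (v / a)) =
        - (\<i> * complex_of_real b * complex_of_real (v / a)) + - (\<i> * complex_of_real u * complex_of_real v)"
      using assms by (simp add: field_simps)
    then show "f (b + a * u) * exp (- (\<i> * complex_of_real (b + a * u) * complex_of_real (v / a)))
      = exp (- (\<i> * complex_of_real b * complex_of_real (v / a))) *
          (f (b + a * u) * exp (- (\<i> * complex_of_real u * complex_of_real v)))"
      by (simp only: exp_add mult_ac)
  qed
  finally have *: "fourier f (v / a) = complex_of_real \<bar>a\<bar> *
     (exp (- (\<i> * complex_of_real b * complex_of_real (v / a))) * fourier (\<lambda>x. f (b + a * x)) v)"
    unfolding integral_mult_right_zero fourier_def
    by (simp only: scaleR_conv_of_real mult_ac)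
  show ?thesis
    unfolding * using assms by (simp add: exp_minus)
qed

lemma fourier_reflect: "fourier (\<lambda>x. f (- x)) v = fourier f (- v)"
  using fourier_affine[of "-1" f 0 v] by simp

lemma fourier_translate:
  "fourier (\<lambda>x. f (x + b)) v = exp (\<i> * complex_of_real b * complex_of_real v) * fourier f v"
  using fourier_affine[of 1 f b v] by (simp add: add.commute)

lemma fourier_scale:
  "a \<noteq> 0 \<Longrightarrow> fourier (\<lambda>x. f (a * x)) v = fourier f (v / a) / complex_of_real \<bar>a\<bar>"
  using fourier_affine[of a f 0 v] by simp

lemma fourier_modulate:
  "fourier (\<lambda>x. f x * exp (\<i> * complex_of_real x * complex_of_real b)) v = fourier f (v - b)"
  unfolding fourier_def by (simp add: mult.assoc exp_add[symmetric] algebra_simps)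

lemma fourier_cnj: "fourier (\<lambda>x. cnj (f x)) v = cnj (fourier f (- v))"
proof -
  have "fourier (\<lambda>x. cnj (f x)) v = complex_of_real (1 / sqrt (2 * pi)) *
     (LINT u|lborel. cnj (f u * exp (- (\<i> * complex_of_real u * complex_of_real (-v)))))"
    unfolding fourier_def by (simp add: exp_cnj)
  then show ?thesis unfolding fourier_def Bochner_Integration.integral_cnj by simp
qed

section \<open>Gaussian functions and Fourier inversion\<close>

lemma gauss_integrable: "integrable lborel (\<lambda>x. complex_of_real (exp (- x\<^sup>2 / 2)))"
proof -
  have "integrable lborel (\<lambda>x. sqrt (2 * pi) * std_normal_density x)"
    by (intro integrable_mult_right integrable_normal_density) auto
  then show ?thesis by (simp add: std_normal_density_def)
qed

text \<open>Up to normalisation and the sign of v this is the characteristic function of the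
  standard normal distribution.\<close>

lemma fourier_gauss:
  "fourier (\<lambda>x. complex_of_real (exp (- x\<^sup>2 / 2))) v = complex_of_real (exp (- v\<^sup>2 / 2))"
proof -
  have "complex_of_real (exp (- (- v)\<^sup>2 / 2)) = char std_normal_distribution (- v)"
    by (simp add: char_std_normal_distribution)
  also have "\<dots> = (CLINT x|lborel. std_normal_density x *\<^sub>R iexp (- v * x))"
    unfolding char_def by (subst integral_density) auto
  also have "\<dots> = (CLINT x|lborel. complex_of_real (1 / sqrt (2 * pi)) *
     (complex_of_real (exp (- x\<^sup>2 / 2)) * exp (- (\<i> * complex_of_real x * complex_of_real v))))"
    by (intro Bochner_Integration.integral_cong)
       (auto simp: std_normal_density_def scaleR_conv_of_real mult_ac)
  also have "\<dots> = fourier (\<lambda>x. complex_of_real (exp (- x\<^sup>2 / 2))) v"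
    unfolding fourier_def by simp
  finally show ?thesis by simp
qed

lemma scaled_gauss_integrable:
  "s > 0 \<Longrightarrow> integrable lborel (\<lambda>x. complex_of_real (exp (- (s * x)\<^sup>2 / 2)))"
  using lborel_integrable_real_affine[OF gauss_integrable, of s 0] by simp

lemma fourier_scaled_gauss:
  "s > 0 \<Longrightarrow> fourier (\<lambda>x. complex_of_real (exp (- (s * x)\<^sup>2 / 2))) v
     = complex_of_real (exp (- (v / s)\<^sup>2 / 2) / s)"
  using fourier_scale[of s "\<lambda>x. complex_of_real (exp (- x\<^sup>2 / 2))" v] by (simp only: fourier_gauss) simp

text \<open>Both sides are one double integral of \<open>f u * g v\<close> against a kernel
  symmetric in u and v; the kernel has modulus 1, so Fubini applies. With a Gaussian as g, it
  carries damping of the transform over to averaging of the function.\<close>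

lemma fourier_multiplication_formula:
  assumes f: "integrable lborel f" and g: "integrable lborel g"
  shows "(LINT v|lborel. fourier f v * g v) = (LINT u|lborel. f u * fourier g u)"
proof -
  have [measurable]: "f \<in> borel_measurable borel" "g \<in> borel_measurable borel" using f g by auto
  let ?k = "\<lambda>u v. f u * g v * exp (- (\<i> * complex_of_real u * complex_of_real v))"
  have int: "integrable (lborel \<Otimes>\<^sub>M lborel) (case_prod ?k)"
  proof (rule lborel_pair.Fubini_integrable)
    show "integrable lborel (\<lambda>x. LINT y|lborel. norm (case (x, y) of (u, v) \<Rightarrow> ?k u v))"
      using f by (simp add: norm_mult)
    show "AE x in lborel. integrable lborel (\<lambda>y. case (x, y) of (u, v) \<Rightarrow> ?k u v)"
      using integrable_fourier_kernel[OF g]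
      by (auto simp: mult.assoc mult.left_commute mult.commute)
  qed measurable
  have "(LINT v|lborel. fourier f v * g v) =
      complex_of_real (1 / sqrt (2 * pi)) * (LINT v|lborel. LINT u|lborel. ?k u v)"
    unfolding fourier_def integral_mult_right_zero[symmetric] integral_mult_left_zero[symmetric]
    by (simp add: mult_ac)
  also have "\<dots> = complex_of_real (1 / sqrt (2 * pi)) * (LINT u|lborel. LINT v|lborel. ?k u v)"
    by (subst lborel_pair.Fubini_integral[OF int]) simp
  also have "\<dots> = (LINT u|lborel. f u * fourier g u)"
    unfolding fourier_def integral_mult_right_zero[symmetric] integral_mult_left_zero[symmetric]
    by (simp add: mult_ac)
  finally show ?thesis .
qed

lemma bcontfun_bound:
  assumes "f \<in> bcontfun"
  obtains M where "M \<ge> 0" "\<And>x. norm (f x) \<le> M"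
proof -
  obtain M where M: "\<And>x. norm (f x) \<le> M"
    using assms by (auto simp: bcontfun_def bounded_iff)
  then have "M \<ge> 0" using norm_ge_zero order_trans by blast
  with M that show ?thesis by blast
qed

lemma bcontfun_measurable: "(f :: real \<Rightarrow> complex) \<in> bcontfun \<Longrightarrow> f \<in> borel_measurable borel"
  by (intro borel_measurable_continuous_onI) (auto simp: bcontfun_def)

lemma bcontfun_isCont: "(f :: real \<Rightarrow> complex) \<in> bcontfun \<Longrightarrow> isCont f x"
  by (simp add: bcontfun_def continuous_on_eq_continuous_at)

text \<open>The transform is damped by a wide Gaussian. By the multiplication formula the damped
  integral is an average of f against a narrow Gaussian, which tends to a multiple of
  \<open>f 0\<close> as the damping disappears.\<close>

lemma fourier_inversion_at_0:
  assumes f: "integrable lborel f" "f \<in> bcontfun" and F: "integrable lborel (fourier f)"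
  shows "f 0 = fourier (fourier f) 0"
proof -
  define s where "s n = 1 / real (Suc n)" for n
  have s: "s n > 0" "s \<longlonglongrightarrow> 0" for n
    unfolding s_def using LIMSEQ_inverse_real_of_nat by (auto simp: inverse_eq_divide)
  have [measurable]: "f \<in> borel_measurable borel" "fourier f \<in> borel_measurable borel"
    using f F by auto
  obtain M where M: "\<And>x. norm (f x) \<le> M" using bcontfun_bound[OF f(2)] by blast
  \<comment> \<open>Rescaling the integration variable on the right fixes the Gaussian and moves the
    parameter into the argument of f, so that dominated convergence needs only that f is bounded and
    continuous at 0.\<close>
  have eq: "(LINT v|lborel. fourier f v * complex_of_real (exp (- (s n * v)\<^sup>2 / 2)))
      = (LINT u|lborel. f (s n * u) * complex_of_real (exp (- u\<^sup>2 / 2)))" for n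
  proof -
    have "(LINT v|lborel. fourier f v * complex_of_real (exp (- (s n * v)\<^sup>2 / 2)))
       = (LINT u|lborel. f u * complex_of_real (exp (- (u / s n)\<^sup>2 / 2) / s n))"
      using fourier_multiplication_formula[OF f(1) scaled_gauss_integrable[OF s(1)]]
      by (simp only: fourier_scaled_gauss[OF s(1)])
    also have "\<dots> = s n *\<^sub>R (LINT u|lborel. f (s n * u) * complex_of_real (exp (- u\<^sup>2 / 2) / s n))"
      using s(1)[of n]
      by (subst lborel_integral_real_affine[where c="s n" and t=0]) auto
    also have "\<dots> = (LINT u|lborel. f (s n * u) * complex_of_real (exp (- u\<^sup>2 / 2)))"
      using s(1)[of n]
      by (simp add: integral_scaleR_right[symmetric] scaleR_conv_of_real del: integral_scaleR_right)
    finally show ?thesis .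
  qed
  have lim1: "(\<lambda>n. LINT v|lborel. fourier f v * complex_of_real (exp (- (s n * v)\<^sup>2 / 2)))
      \<longlonglongrightarrow> (LINT v|lborel. fourier f v * complex_of_real (exp (- (0 * v)\<^sup>2 / 2)))"
  proof (rule integral_dominated_convergence[where w="\<lambda>v. norm (fourier f v)"])
    show "AE v in lborel. (\<lambda>n. fourier f v * complex_of_real (exp (- (s n * v)\<^sup>2 / 2)))
       \<longlonglongrightarrow> fourier f v * complex_of_real (exp (- (0 * v)\<^sup>2 / 2))"
      by (intro AE_I2 tendsto_intros s) auto
  qed (use F in \<open>auto simp: norm_mult mult_left_le\<close>)
  have lim2: "(\<lambda>n. LINT u|lborel. f (s n * u) * complex_of_real (exp (- u\<^sup>2 / 2)))
      \<longlonglongrightarrow> (LINT u|lborel. f 0 * complex_of_real (exp (- u\<^sup>2 / 2)))"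
  proof (rule integral_dominated_convergence[where w="\<lambda>u. M * exp (- u\<^sup>2 / 2)"])
    show "AE u in lborel. (\<lambda>n. f (s n * u) * complex_of_real (exp (- u\<^sup>2 / 2)))
      \<longlonglongrightarrow> f 0 * complex_of_real (exp (- u\<^sup>2 / 2))"
    proof (intro AE_I2 tendsto_intros)
      fix u
      have "(\<lambda>n. s n * u) \<longlonglongrightarrow> 0" using tendsto_mult_right[OF s(2), of u] by simp
      then show "(\<lambda>n. f (s n * u)) \<longlonglongrightarrow> f 0"
        by (rule isCont_tendsto_compose[OF bcontfun_isCont[OF f(2)]])
    qed
    show "integrable lborel (\<lambda>u. M * exp (- u\<^sup>2 / 2))"
      using integrable_norm[OF gauss_integrable] by simp
    show "AE x in lborel. norm (f (s n * x) * complex_of_real (exp (- x\<^sup>2 / 2))) \<le> M * exp (- x\<^sup>2 / 2)" for n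
      using M by (auto simp: norm_mult)
  qed auto
  have "(LINT u|lborel. complex_of_real (exp (- u\<^sup>2 / 2))) = complex_of_real (sqrt (2 * pi))"
    using fourier_gauss[of 0] by (simp add: fourier_def field_simps)
  moreover have "(LINT v|lborel. fourier f v) = (LINT u|lborel. f 0 * complex_of_real (exp (- u\<^sup>2 / 2)))"
    using LIMSEQ_unique[OF lim1[unfolded eq] lim2] by simp
  ultimately have "(LINT v|lborel. fourier f v) = f 0 * complex_of_real (sqrt (2 * pi))"
    by (simp only: integral_mult_right_zero)
  then show ?thesis by (simp add: fourier_def[of "fourier f"])
qed

text \<open>Translating f by x reduces to the value at 0; on the transform side the translation is a
  modulation, which preserves integrability.\<close>

theorem fourier_inversion:
  assumes f: "integrable lborel f" "f \<in> bcontfun" and F: "integrable lborel (fourier f)"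
  shows "f x = fourier (fourier f) (- x)"
proof -
  let ?f = "\<lambda>t. f (t + x)"
  have 1: "integrable lborel ?f"
    using lborel_integrable_real_affine[OF f(1), of 1 x] by (simp add: add.commute)
  obtain M where M: "\<And>x. norm (f x) \<le> M" using bcontfun_bound[OF f(2)] by blast
  have 2: "?f \<in> bcontfun"
  proof (rule bcontfun_normI)
    show "continuous_on UNIV ?f"
      using f(2) by (intro continuous_on_compose2[of UNIV f UNIV "\<lambda>t. t + x"] continuous_intros)
        (auto simp: bcontfun_def)
    show "norm (f (t + x)) \<le> M" for t by (rule M)
  qed
  have F': "fourier ?f = (\<lambda>v. fourier f v * exp (\<i> * complex_of_real v * complex_of_real x))"
    by (auto simp: fourier_translate mult_ac)
  have 3: "integrable lborel (fourier ?f)"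
    unfolding F'
  proof (rule integrable_mult_unimodular[OF F])
    show "norm (exp (\<i> * complex_of_real v * complex_of_real x)) \<le> 1" for v
      by (simp)
  qed measurable
  have "f x = fourier (fourier ?f) 0"
    using fourier_inversion_at_0[OF 1 2 3] by simp
  then show ?thesis
    unfolding F' fourier_modulate by simp
qed

lemma fourier_inversion_integral:
  assumes "integrable lborel f" "f \<in> bcontfun" "integrable lborel (fourier f)"
  shows "f x = complex_of_real (1 / sqrt (2 * pi)) *
    (LINT v|lborel. fourier f v * exp (\<i> * complex_of_real v * complex_of_real x))"
  using fourier_inversion[OF assms, of x] by (simp add: fourier_def[of "fourier f"])

section \<open>The Plancherel inequality and completeness of the space of square integrable functions\<close>

lemma scaled_gauss_nn_integral:
  assumes "s > 0"
  shows "(\<integral>\<^sup>+z. ennreal (exp (- ((z - y) / s)\<^sup>2 / 2) / s) \<partial>lborel) = ennreal (sqrt (2 * pi))"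
    and "(\<integral>\<^sup>+y. ennreal (exp (- ((z - y) / s)\<^sup>2 / 2) / s) \<partial>lborel) = ennreal (sqrt (2 * pi))"
proof -
  have 0: "(\<integral>\<^sup>+z. ennreal (exp (- z\<^sup>2 / 2)) \<partial>lborel) = ennreal (sqrt (2 * pi))"
  proof -
    have "(LINT z|lborel. complex_of_real (exp (- z\<^sup>2 / 2))) = complex_of_real (sqrt (2 * pi))"
      using fourier_gauss[of 0] by (simp add: fourier_def field_simps)
    then have "(LINT z|lborel. exp (- z\<^sup>2 / 2)) = sqrt (2 * pi)"
      unfolding integral_complex_of_real of_real_eq_iff .
    moreover have "integrable lborel (\<lambda>z::real. exp (- z\<^sup>2 / 2))"
      using integrable_norm[OF gauss_integrable] by simp
    ultimately show ?thesis by (subst nn_integral_eq_integral) auto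
  qed
  have eq: "(\<integral>\<^sup>+z. ennreal (exp (- z\<^sup>2 / 2)) * ennreal (1 / s) \<partial>lborel) = ennreal (sqrt (2 * pi)) * ennreal (1 / s)"
    using 0 by (subst nn_integral_multc) auto
  have eq': "ennreal s * (\<integral>\<^sup>+z. ennreal (exp (- (z\<^sup>2 / 2))) * ennreal (1 / s) \<partial>lborel) = ennreal (sqrt (2 * pi))"
    using eq assms by (simp add: ennreal_mult[symmetric])
  have A: "ennreal (exp (- u / 2) / s) = ennreal (exp (- u / 2)) * ennreal (1 / s)" for u :: real
    using assms by (subst ennreal_mult[symmetric]) auto
  show "(\<integral>\<^sup>+z. ennreal (exp (- ((z - y) / s)\<^sup>2 / 2) / s) \<partial>lborel) = ennreal (sqrt (2 * pi))"
    unfolding A using assms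
    by (subst nn_integral_real_affine[where c=s and t=y]) (auto simp: eq')
  show "(\<integral>\<^sup>+y. ennreal (exp (- ((z - y) / s)\<^sup>2 / 2) / s) \<partial>lborel) = ennreal (sqrt (2 * pi))"
    unfolding A using assms
    by (subst nn_integral_real_affine[where c="-s" and t=z]) (auto simp: eq')
qed

text \<open>A Schur test: after splitting \<open>a y * a z\<close> into half the sum of the squares,
  the kernel is integrated out in whichever variable the square does not contain. Its mass is
  \<open>sqrt (2 * pi)\<close> in either variable, so each half contributes half of the right-hand
  side.\<close>

lemma gauss_convolution_bound:
  fixes a :: "real \<Rightarrow> real"
  assumes [measurable]: "a \<in> borel_measurable borel" and "\<And>x. a x \<ge> 0" and s: "s > 0"
  shows "(\<integral>\<^sup>+y. \<integral>\<^sup>+z. ennreal (a y * a z * (exp (- ((z - y) / s)\<^sup>2 / 2) / s)) \<partial>lborel \<partial>lborel)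
     \<le> ennreal (sqrt (2 * pi)) * (\<integral>\<^sup>+y. ennreal ((a y)\<^sup>2) \<partial>lborel)"
proof -
  define K where "K y z = exp (- ((z - y) / s)\<^sup>2 / 2) / s" for y z
  have [measurable]: "case_prod K \<in> borel_measurable (borel \<Otimes>\<^sub>M borel)"
    unfolding K_def by measurable
  have K0: "K y z \<ge> 0" for y z using s by (simp add: K_def)
  have K1: "(\<integral>\<^sup>+z. ennreal (K y z) \<partial>lborel) = ennreal (sqrt (2 * pi))"
    and K2: "(\<integral>\<^sup>+y. ennreal (K y z) \<partial>lborel) = ennreal (sqrt (2 * pi))" for y z
    using scaled_gauss_nn_integral[OF s] by (auto simp: K_def)
  have "(\<integral>\<^sup>+y. \<integral>\<^sup>+z. ennreal (a y * a z * K y z) \<partial>lborel \<partial>lborel)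
     \<le> (\<integral>\<^sup>+y. \<integral>\<^sup>+z. ennreal ((a y)\<^sup>2 / 2) * ennreal (K y z) + ennreal ((a z)\<^sup>2 / 2) * ennreal (K y z) \<partial>lborel \<partial>lborel)"
  proof (intro nn_integral_mono)
    fix y z
    have "a y * a z \<le> (a y)\<^sup>2 / 2 + (a z)\<^sup>2 / 2"
      using sum_squares_bound[of "a y" "a z"] by (simp add: field_simps)
    then have "a y * a z * K y z \<le> ((a y)\<^sup>2 / 2 + (a z)\<^sup>2 / 2) * K y z"
      using K0 by (intro mult_right_mono) auto
    then show "ennreal (a y * a z * K y z)
      \<le> ennreal ((a y)\<^sup>2 / 2) * ennreal (K y z) + ennreal ((a z)\<^sup>2 / 2) * ennreal (K y z)"
      using K0 by (simp add: ennreal_mult[symmetric] ennreal_plus[symmetric] distrib_right ennreal_leI del: ennreal_plus)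
  qed
  also have "\<dots> = (\<integral>\<^sup>+y. \<integral>\<^sup>+z. ennreal ((a y)\<^sup>2 / 2) * ennreal (K y z) \<partial>lborel \<partial>lborel)
      + (\<integral>\<^sup>+y. \<integral>\<^sup>+z. ennreal ((a z)\<^sup>2 / 2) * ennreal (K y z) \<partial>lborel \<partial>lborel)"
    by (simp add: nn_integral_add)
  also have "(\<integral>\<^sup>+y. \<integral>\<^sup>+z. ennreal ((a z)\<^sup>2 / 2) * ennreal (K y z) \<partial>lborel \<partial>lborel)
     = (\<integral>\<^sup>+z. \<integral>\<^sup>+y. ennreal ((a z)\<^sup>2 / 2) * ennreal (K y z) \<partial>lborel \<partial>lborel)"
    by (rule lborel_pair.Fubini'[symmetric]) measurable
  also have "\<dots> = (\<integral>\<^sup>+y. ennreal ((a y)\<^sup>2 / 2) \<partial>lborel) * ennreal (sqrt (2 * pi))"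
    by (simp add: nn_integral_cmult K2 nn_integral_multc)
  also have "(\<integral>\<^sup>+y. \<integral>\<^sup>+z. ennreal ((a y)\<^sup>2 / 2) * ennreal (K y z) \<partial>lborel \<partial>lborel)
     = (\<integral>\<^sup>+y. ennreal ((a y)\<^sup>2 / 2) \<partial>lborel) * ennreal (sqrt (2 * pi))"
    by (simp add: nn_integral_cmult K1 nn_integral_multc)
  also have "(\<integral>\<^sup>+y. ennreal ((a y)\<^sup>2 / 2) \<partial>lborel) * ennreal (sqrt (2 * pi))
       + (\<integral>\<^sup>+y. ennreal ((a y)\<^sup>2 / 2) \<partial>lborel) * ennreal (sqrt (2 * pi))
     = ennreal (sqrt (2 * pi)) * (\<integral>\<^sup>+y. ennreal ((a y)\<^sup>2 / 2) + ennreal ((a y)\<^sup>2 / 2) \<partial>lborel)"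
    by (subst nn_integral_add) (auto simp: distrib_left mult.commute)
  also have "(\<integral>\<^sup>+y. ennreal ((a y)\<^sup>2 / 2) + ennreal ((a y)\<^sup>2 / 2) \<partial>lborel) = (\<integral>\<^sup>+y. ennreal ((a y)\<^sup>2) \<partial>lborel)"
    by (simp add: ennreal_plus[symmetric] del: ennreal_plus)
  finally show ?thesis by (simp add: K_def)
qed

text \<open>The damped integral is a double integral of \<open>f y * cnj (f z)\<close> against a Gaussian in \<open>z - y\<close>;
  the inequality between the geometric and arithmetic means decouples the two factors.\<close>
lemma gauss_damped_plancherel_le:
  assumes f: "integrable lborel f" and s: "s > 0"
  shows "(\<integral>\<^sup>+v. ennreal ((norm (fourier f v))\<^sup>2 * exp (- (s * v)\<^sup>2 / 2)) \<partial>lborel)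
     \<le> (\<integral>\<^sup>+x. ennreal ((norm (f x))\<^sup>2) \<partial>lborel)"
proof -
  define w where "w v = complex_of_real (exp (- (s * v)\<^sup>2 / 2))" for v
  define K where "K x = exp (- (x / s)\<^sup>2 / 2) / s" for x
  have wint: "integrable lborel w" unfolding w_def by (rule scaled_gauss_integrable[OF s])
  have wK: "fourier w x = complex_of_real (K x)" for x
    unfolding w_def K_def by (rule fourier_scaled_gauss[OF s])
  have [measurable]: "f \<in> borel_measurable borel" using f by auto
  have [measurable]: "fourier f \<in> borel_measurable borel" by (rule borel_measurable_fourier[OF f])
  have [measurable]: "w \<in> borel_measurable borel" "cnj \<in> borel_measurable borel"
    using wint by (auto intro!: borel_measurable_continuous_onI continuous_intros)
  define B where "B = (LINT u|lborel. norm (f u))"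
  have bd: "norm (fourier f v) \<le> B" for v unfolding B_def by (rule norm_fourier_le[OF f])
  have B0: "B \<ge> 0" using bd[of 0] norm_ge_zero order_trans by blast
  \<comment> \<open>Chosen so that \<open>fourier f v * g v\<close> is the damped squared modulus.
    The factor \<open>w\<close> makes \<open>g\<close> integrable, which the multiplication formula
    requires.\<close>
  define g where "g v = cnj (fourier f v) * w v" for v
  have gint: "integrable lborel g"
  proof (rule Bochner_Integration.integrable_bound)
    show "integrable lborel (\<lambda>v. B *\<^sub>R w v)" using wint by auto
    show "g \<in> borel_measurable lborel" unfolding g_def by measurable
    show "AE v in lborel. norm (g v) \<le> norm (B *\<^sub>R w v)"
      using bd B0 by (auto simp: g_def norm_mult intro!: mult_right_mono)
  qed
  have Fg: "fourier f v * g v = complex_of_real ((norm (fourier f v))\<^sup>2 * exp (- (s * v)\<^sup>2 / 2))" for v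
    unfolding g_def w_def by (simp add: complex_mult_cnj cmod_power2 mult.assoc[symmetric] del: of_real_power)
  have int2: "integrable lborel (\<lambda>v. (norm (fourier f v))\<^sup>2 * exp (- (s * v)\<^sup>2 / 2))"
  proof (rule Bochner_Integration.integrable_bound)
    show "integrable lborel (\<lambda>v. B *\<^sub>R g v)" using gint by auto
    show "AE v in lborel. norm ((norm (fourier f v))\<^sup>2 * exp (- (s * v)\<^sup>2 / 2)) \<le> norm (B *\<^sub>R g v)"
      using bd B0 by (simp add: g_def w_def norm_mult power2_eq_square mult.assoc[symmetric] mult_right_mono)
  qed measurable
  have gF: "fourier g y = complex_of_real (1 / sqrt (2 * pi)) *
      (LINT z|lborel. cnj (f z) * complex_of_real (K (z - y)))" for y
  proof -
    have "fourier g y = fourier (\<lambda>v. g (- v)) (- y)"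
      by (simp add: fourier_reflect)
    also have "(\<lambda>v. g (- v)) = (\<lambda>v. fourier (\<lambda>x. cnj (f x)) v * w v)"
      by (auto simp: g_def fourier_cnj w_def)
    also have "fourier \<dots> (- y) = complex_of_real (1 / sqrt (2 * pi)) *
      (LINT v|lborel. fourier (\<lambda>x. cnj (f x)) v * (w v * exp (\<i> * complex_of_real v * complex_of_real y)))"
      by (simp add: fourier_def[of _ "- y"] mult.assoc)
    also have "(LINT v|lborel. fourier (\<lambda>x. cnj (f x)) v * (w v * exp (\<i> * complex_of_real v * complex_of_real y)))
      = (LINT z|lborel. cnj (f z) * complex_of_real (K (z - y)))"
      using f wint integrable_mult_unimodular[OF wint, of "\<lambda>v. exp (\<i> * complex_of_real v * complex_of_real y)"]
      by (subst fourier_multiplication_formula) (auto simp: fourier_modulate wK)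
    finally show ?thesis .
  qed
  have "ennreal (LINT v|lborel. (norm (fourier f v))\<^sup>2 * exp (- (s * v)\<^sup>2 / 2))
     = ennreal (norm (LINT v|lborel. fourier f v * g v))"
    unfolding Fg integral_complex_of_real by (simp add: integral_nonneg_AE)
  also have "(LINT v|lborel. fourier f v * g v) = (LINT y|lborel. f y * fourier g y)"
    by (rule fourier_multiplication_formula[OF f gint])
  also have "ennreal (norm \<dots>) \<le> (\<integral>\<^sup>+y. ennreal (norm (f y * fourier g y)) \<partial>lborel)"
  proof (rule integral_norm_bound_ennreal)
    show "integrable lborel (\<lambda>y. f y * fourier g y)"
    proof (rule Bochner_Integration.integrable_bound)
      show "integrable lborel (\<lambda>y. (LINT u|lborel. norm (g u)) *\<^sub>R f y)" using f by auto
      show "(\<lambda>y. f y * fourier g y) \<in> borel_measurable lborel"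
        using borel_measurable_fourier[OF gint] by measurable
      show "AE y in lborel. norm (f y * fourier g y) \<le> norm ((LINT u|lborel. norm (g u)) *\<^sub>R f y)"
        using norm_fourier_le[OF gint] 
        by (auto simp: norm_mult mult.commute[of "norm (f _)"] intro!: mult_right_mono)
    qed
  qed
  also have "\<dots> \<le> (\<integral>\<^sup>+y. ennreal (1 / sqrt (2 * pi)) *
      (\<integral>\<^sup>+z. ennreal (norm (f y) * norm (f z) * K (z - y)) \<partial>lborel) \<partial>lborel)"
  proof (rule nn_integral_mono)
    fix y
    have K1: "0 \<le> K x" "K x \<le> 1 / s" for x using s by (auto simp: K_def divide_right_mono)
    have "integrable lborel (\<lambda>z. cnj (f z) * complex_of_real (K (z - y)))"
    proof (rule Bochner_Integration.integrable_bound)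
      show "integrable lborel (\<lambda>z. (1 / s) *\<^sub>R f z)" using f by auto
      show "AE z in lborel. norm (cnj (f z) * complex_of_real (K (z - y))) \<le> norm ((1 / s) *\<^sub>R f z)"
        using K1 mult_left_mono[OF K1(2) norm_ge_zero[of "f _"]] s by (auto simp: norm_mult)
      show "(\<lambda>z. cnj (f z) * complex_of_real (K (z - y))) \<in> borel_measurable lborel"
        unfolding K_def by measurable
    qed
    then have "ennreal (norm (LINT z|lborel. cnj (f z) * complex_of_real (K (z - y))))
      \<le> (\<integral>\<^sup>+z. ennreal (norm (f z) * K (z - y)) \<partial>lborel)"
      using integral_norm_bound_ennreal[of lborel "\<lambda>z. cnj (f z) * complex_of_real (K (z - y))"] K1
      by (simp add: norm_mult)
    then have "ennreal (norm (f y)) * (ennreal (1 / sqrt (2 * pi)) *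
       ennreal (norm (LINT z|lborel. cnj (f z) * complex_of_real (K (z - y)))))
       \<le> ennreal (norm (f y)) * (ennreal (1 / sqrt (2 * pi)) * (\<integral>\<^sup>+z. ennreal (norm (f z) * K (z - y)) \<partial>lborel))"
      by (intro mult_left_mono) auto
    also have "\<dots> = ennreal (1 / sqrt (2 * pi)) * (\<integral>\<^sup>+z. ennreal (norm (f y)) * ennreal (norm (f z) * K (z - y)) \<partial>lborel)"
      by (subst nn_integral_cmult) (auto simp: K_def mult_ac)
    also have "\<dots> = ennreal (1 / sqrt (2 * pi)) * (\<integral>\<^sup>+z. ennreal (norm (f y) * norm (f z) * K (z - y)) \<partial>lborel)"
      using K1 by (simp add: ennreal_mult[symmetric] mult.assoc)
    finally show "ennreal (norm (f y * fourier g y)) \<le> \<dots>"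
      unfolding gF norm_mult by (simp add: norm_divide ennreal_mult[symmetric] del: ennreal_mult)
  qed
  also have "\<dots> = ennreal (1 / sqrt (2 * pi)) *
      (\<integral>\<^sup>+y. \<integral>\<^sup>+z. ennreal (norm (f y) * norm (f z) * K (z - y)) \<partial>lborel \<partial>lborel)"
    by (rule nn_integral_cmult) (unfold K_def, measurable)
  also have "\<dots> \<le> ennreal (1 / sqrt (2 * pi)) * (ennreal (sqrt (2 * pi)) * (\<integral>\<^sup>+y. ennreal ((norm (f y))\<^sup>2) \<partial>lborel))"
    unfolding K_def by (intro mult_left_mono gauss_convolution_bound s) auto
  also have "\<dots> = (\<integral>\<^sup>+y. ennreal ((norm (f y))\<^sup>2) \<partial>lborel)"
    by (simp add: mult.assoc[symmetric] ennreal_mult[symmetric])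
  finally show ?thesis
    by (subst nn_integral_eq_integral[OF int2]) auto
qed

text \<open>Fatou's lemma removes the damping. Nonnegative integrals allow infinite values, so
  square integrability of the transform comes out as a conclusion.\<close>

lemma plancherel_nn_le:
  assumes f: "integrable lborel f"
  shows "(\<integral>\<^sup>+v. ennreal ((norm (fourier f v))\<^sup>2) \<partial>lborel) \<le> (\<integral>\<^sup>+x. ennreal ((norm (f x))\<^sup>2) \<partial>lborel)"
proof -
  have [measurable]: "fourier f \<in> borel_measurable borel" by (rule borel_measurable_fourier[OF f])
  define s where "s n = 1 / real (Suc n)" for n
  have s: "s n > 0" "s \<longlonglongrightarrow> 0" for n
    unfolding s_def using LIMSEQ_inverse_real_of_nat by (auto simp: inverse_eq_divide)
  have "(\<integral>\<^sup>+v. ennreal ((norm (fourier f v))\<^sup>2) \<partial>lborel)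
    = (\<integral>\<^sup>+v. liminf (\<lambda>n. ennreal ((norm (fourier f v))\<^sup>2 * exp (- (s n * v)\<^sup>2 / 2))) \<partial>lborel)"
  proof (intro nn_integral_cong)
    fix v
    have "(\<lambda>n. ennreal ((norm (fourier f v))\<^sup>2 * exp (- (s n * v)\<^sup>2 / 2)))
       \<longlonglongrightarrow> ennreal ((norm (fourier f v))\<^sup>2 * exp (- (0 * v)\<^sup>2 / 2))"
      by (intro tendsto_intros s tendsto_ennrealI) auto
    from lim_imp_Liminf[OF _ this]
    show "ennreal ((norm (fourier f v))\<^sup>2) = liminf (\<lambda>n. ennreal ((norm (fourier f v))\<^sup>2 * exp (- (s n * v)\<^sup>2 / 2)))"
      by simp
  qed
  also have "\<dots> \<le> liminf (\<lambda>n. \<integral>\<^sup>+v. ennreal ((norm (fourier f v))\<^sup>2 * exp (- (s n * v)\<^sup>2 / 2)) \<partial>lborel)"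
    by (rule nn_integral_liminf) measurable
  also have "\<dots> \<le> liminf (\<lambda>n::nat. \<integral>\<^sup>+x. ennreal ((norm (f x))\<^sup>2) \<partial>lborel)"
    by (intro Liminf_mono always_eventually allI gauss_damped_plancherel_le f s)
  finally show ?thesis by (simp add: Liminf_const)
qed

section \<open>Square integrable functions: squared norms, limits, completeness\<close>

lemma L2_iff_nn_integral:
  "f \<in> L2 \<longleftrightarrow> f \<in> borel_measurable borel \<and> (\<integral>\<^sup>+x. ennreal ((norm (f x))\<^sup>2) \<partial>lborel) < \<infinity>"
  unfolding L2_def by (auto simp: integrable_iff_bounded)

lemma L2_nn_integral:
  "f \<in> L2 \<Longrightarrow> (\<integral>\<^sup>+x. ennreal ((norm (f x))\<^sup>2) \<partial>lborel) = ennreal (LINT x|lborel. (norm (f x))\<^sup>2)"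
  by (rule nn_integral_eq_integral) (auto simp: L2_def)

lemma L2_nn_leD:
  assumes "f \<in> borel_measurable borel" "C \<ge> 0" "(\<integral>\<^sup>+x. ennreal ((norm (f x))\<^sup>2) \<partial>lborel) \<le> ennreal C"
  shows "f \<in> L2" "(LINT x|lborel. (norm (f x))\<^sup>2) \<le> C"
proof -
  show f: "f \<in> L2"
    using assms unfolding L2_iff_nn_integral by (auto intro: le_less_trans)
  show "(LINT x|lborel. (norm (f x))\<^sup>2) \<le> C"
    using assms(2,3) unfolding L2_nn_integral[OF f] by simp
qed

lemma plancherel_le:
  assumes "integrable lborel f" "f \<in> L2"
  shows "fourier f \<in> L2" "(LINT v|lborel. (norm (fourier f v))\<^sup>2) \<le> (LINT x|lborel. (norm (f x))\<^sup>2)"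
  using L2_nn_leD[OF borel_measurable_fourier[OF assms(1)] _
      plancherel_nn_le[OF assms(1), unfolded L2_nn_integral[OF assms(2)]]]
  by auto

lemma L2_measurable: "f \<in> L2 \<Longrightarrow> f \<in> borel_measurable borel"
  by (simp add: L2_def)

text \<open>Stands in for Minkowski's inequality. All L2 estimates below work with squared norms;
  the factors 2 that accumulate are harmless because every quantity they multiply tends to
  0.\<close>

lemma norm_diff_sq_le: "(norm (a - b :: complex))\<^sup>2 \<le> 2 * (norm a)\<^sup>2 + 2 * (norm b)\<^sup>2"
proof -
  have "(norm (a - b))\<^sup>2 \<le> (norm a + norm b)\<^sup>2"
    by (intro power_mono norm_triangle_ineq4) auto
  also have "\<dots> \<le> 2 * (norm a)\<^sup>2 + 2 * (norm b)\<^sup>2"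
    using sum_squares_bound[of "norm a" "norm b"] by (simp add: power2_sum)
  finally show ?thesis .
qed

lemma
  assumes "f \<in> L2" "g \<in> L2"
  shows L2_diff: "(\<lambda>x. f x - g x) \<in> L2"
    and L2_diff_le: "(LINT x|lborel. (norm (f x - g x))\<^sup>2)
      \<le> 2 * (LINT x|lborel. (norm (f x))\<^sup>2) + 2 * (LINT x|lborel. (norm (g x))\<^sup>2)"
proof -
  have [measurable]: "f \<in> borel_measurable borel" "g \<in> borel_measurable borel"
    using assms by (auto simp: L2_measurable)
  have int: "integrable lborel (\<lambda>x. 2 * (norm (f x))\<^sup>2 + 2 * (norm (g x))\<^sup>2)"
    using assms by (auto simp: L2_def)
  have int': "integrable lborel (\<lambda>x. (norm (f x - g x))\<^sup>2)"
    by (rule Bochner_Integration.integrable_bound[OF int]) (use norm_diff_sq_le in auto)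
  then show "(\<lambda>x. f x - g x) \<in> L2" by (simp add: L2_def)
  have "(LINT x|lborel. (norm (f x - g x))\<^sup>2) \<le> (LINT x|lborel. 2 * (norm (f x))\<^sup>2 + 2 * (norm (g x))\<^sup>2)"
    by (rule integral_mono[OF int' int]) (rule norm_diff_sq_le)
  then show "(LINT x|lborel. (norm (f x - g x))\<^sup>2)
      \<le> 2 * (LINT x|lborel. (norm (f x))\<^sup>2) + 2 * (LINT x|lborel. (norm (g x))\<^sup>2)"
    using assms by (simp add: L2_def)
qed

lemma tendsto_L2_iff:
  "tendsto_L2 X g F \<longleftrightarrow> (\<forall>\<^sub>F i in F. (\<lambda>x. X i x - g x) \<in> L2) \<and>
     ((\<lambda>i. LINT x|lborel. (norm (X i x - g x))\<^sup>2) \<longlongrightarrow> 0) F"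
proof -
  have "((\<lambda>i. L2_norm (\<lambda>x. X i x - g x)) \<longlongrightarrow> 0) F \<longleftrightarrow>
        ((\<lambda>i. LINT x|lborel. (norm (X i x - g x))\<^sup>2) \<longlongrightarrow> 0) F" (is "?L \<longleftrightarrow> ?R")
  proof
    assume ?L
    then have "((\<lambda>i. (L2_norm (\<lambda>x. X i x - g x))\<^sup>2) \<longlongrightarrow> 0\<^sup>2) F" by (intro tendsto_intros)
    then show ?R by (simp add: L2_norm_def)
  next
    assume ?R
    then have "((\<lambda>i. sqrt (LINT x|lborel. (norm (X i x - g x))\<^sup>2)) \<longlongrightarrow> sqrt 0) F" by (intro tendsto_intros)
    then show ?L by (simp add: L2_norm_def)
  qed
  then show ?thesis unfolding tendsto_L2_def by simp
qed

text \<open>The Riesz-Fischer theorem in quantitative form: the Cauchy bound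
  \<open>e m + e n\<close> passes to the distance \<open>e n\<close> from the limit. A subsequence
  converges almost everywhere, and Fatou's lemma along it gives the distance bound for every
  n.\<close>

lemma L2_complete:
  fixes X :: "nat \<Rightarrow> real \<Rightarrow> complex"
  assumes X: "\<And>n. X n \<in> L2" and e: "e \<longlonglongrightarrow> 0"
    and cauchy: "\<And>m n. (LINT x|lborel. (norm (X m x - X n x))\<^sup>2) \<le> e m + e n"
  obtains g where "g \<in> L2" "\<And>n. (LINT x|lborel. (norm (X n x - g x))\<^sup>2) \<le> e n"
proof -
  have [measurable]: "X n \<in> borel_measurable borel" for n by (rule L2_measurable[OF X])
  have e0: "e n \<ge> 0" for n using cauchy[of n n] by simp
  have cauchy': "(\<integral>\<^sup>+x. ennreal ((norm (X m x - X n x))\<^sup>2) \<partial>lborel) \<le> ennreal (e m + e n)" for m n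
    unfolding L2_nn_integral[OF L2_diff[OF X X]] by (intro ennreal_leI cauchy)
  \<comment> \<open>The rate 1/8 leaves room for the weight \<open>2 ^ k\<close> introduced below:
    2^k * 2 * 8^(-k) is 2 * 4^(-k), still summable.\<close>
  have "\<forall>k. \<exists>N. \<forall>n\<ge>N. e n \<le> (1/8) ^ k"
  proof
    fix k
    have "eventually (\<lambda>n. e n < (1/8) ^ k) sequentially"
      by (rule order_tendstoD[OF e]) auto
    then show "\<exists>N. \<forall>n\<ge>N. e n \<le> (1/8) ^ k"
      unfolding eventually_sequentially by (meson less_imp_le)
  qed
  then obtain r where "\<And>k n. n \<ge> r k \<Longrightarrow> e n \<le> (1/8) ^ k" by metis
  then have r: "e (r k) \<le> (1/8) ^ k" for k by simp
  define d where "d k x = X (r (Suc k)) x - X (r k) x" for k x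
  have [measurable]: "d k \<in> borel_measurable borel" for k unfolding d_def by measurable
  \<comment> \<open>The weights make a finite sum of squares useful pointwise: if the weighted sum
    at x is at most C, then \<open>norm (d k x)\<close> is at most sqrt C * 2^(-k/2), so the
    telescoping series converges absolutely.\<close>
  have d: "(\<integral>\<^sup>+x. ennreal (2 ^ k * (norm (d k x))\<^sup>2) \<partial>lborel) \<le> ennreal (2 * (1/4) ^ k)" for k
  proof -
    have "e (r (Suc k)) + e (r k) \<le> 2 * (1/8) ^ k"
      using r[of "Suc k"] r[of k] e0[of "r (Suc k)"] unfolding power_Suc by linarith
    then have "(\<integral>\<^sup>+x. ennreal ((norm (d k x))\<^sup>2) \<partial>lborel) \<le> ennreal (2 * (1/8) ^ k)"
      unfolding d_def using cauchy'[of "r (Suc k)" "r k"] by (meson ennreal_leI order_trans)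
    then have "ennreal (2 ^ k) * (\<integral>\<^sup>+x. ennreal ((norm (d k x))\<^sup>2) \<partial>lborel) \<le> ennreal (2 ^ k) * ennreal (2 * (1/8) ^ k)"
      by (intro mult_left_mono) auto
    also have "\<dots> = ennreal (2 * (2 * (1/8)) ^ k)"
      by (subst ennreal_mult[symmetric], simp, simp, simp only: power_mult_distrib mult_ac)
    finally show ?thesis
      by (simp add: nn_integral_cmult ennreal_mult)
  qed
  have "(\<integral>\<^sup>+x. (\<Sum>k. ennreal (2 ^ k * (norm (d k x))\<^sup>2)) \<partial>lborel)
      = (\<Sum>k. \<integral>\<^sup>+x. ennreal (2 ^ k * (norm (d k x))\<^sup>2) \<partial>lborel)"
    by (rule nn_integral_suminf) measurable
  also have "\<dots> \<le> (\<Sum>k. ennreal (2 * (1/4) ^ k))"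
    by (intro suminf_le d) auto
  also have "\<dots> = ennreal (\<Sum>k. 2 * (1/4) ^ k)"
    by (intro suminf_ennreal2) (auto intro!: summable_mult summable_geometric)
  also have "\<dots> < \<infinity>" by simp
  finally have "AE x in lborel. (\<Sum>k. ennreal (2 ^ k * (norm (d k x))\<^sup>2)) \<noteq> \<infinity>"
    by (intro nn_integral_PInf_AE) auto
  then have conv: "AE x in lborel. convergent (\<lambda>k. X (r k) x)"
  proof eventually_elim
    case (elim x)
    define C where "C = enn2real (\<Sum>k. ennreal (2 ^ k * (norm (d k x))\<^sup>2))"
    have C: "C \<ge> 0" "(\<Sum>k. ennreal (2 ^ k * (norm (d k x))\<^sup>2)) = ennreal C"
      using elim unfolding C_def by (auto simp: less_top)
    have bd: "norm (d k x) \<le> sqrt C * (1 / sqrt 2) ^ k" for k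
    proof -
      have "sum (\<lambda>k. ennreal (2 ^ k * (norm (d k x))\<^sup>2)) {k} \<le> (\<Sum>k. ennreal (2 ^ k * (norm (d k x))\<^sup>2))"
        by (rule sum_le_suminf) auto
      then have "ennreal (2 ^ k * (norm (d k x))\<^sup>2) \<le> ennreal C"
        by (simp only: C(2) sum.insert sum.empty finite.emptyI empty_iff not_False_eq_True add_0_right)
      then have "2 ^ k * (norm (d k x))\<^sup>2 \<le> C"
        using C(1) by (simp only: ennreal_le_iff)
      then have "sqrt (2 ^ k * (norm (d k x))\<^sup>2) \<le> sqrt C" by (rule real_sqrt_le_mono)
      then show ?thesis by (simp add: real_sqrt_mult real_sqrt_power power_divide field_simps)
    qed
    have "summable (\<lambda>k. d k x)"
      by (rule summable_comparison_test'[OF _ bd]) (auto intro!: summable_mult summable_geometric)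
    then have "convergent (\<lambda>n. \<Sum>k<n. d k x)" by (simp add: summable_iff_convergent)
    then have "convergent (\<lambda>n. (\<Sum>k<n. d k x) + X (r 0) x)" by (intro convergent_add convergent_const)
    moreover have "(\<Sum>k<n. d k x) + X (r 0) x = X (r n) x" for n
      unfolding d_def sum_lessThan_telescope[of "\<lambda>k. X (r k) x"] by simp
    ultimately show ?case by simp
  qed
  define g where "g x = lim (\<lambda>k. X (r k) x)" for x
  have [measurable]: "g \<in> borel_measurable borel" unfolding g_def by measurable
  have close: "(\<integral>\<^sup>+x. ennreal ((norm (X n x - g x))\<^sup>2) \<partial>lborel) \<le> ennreal (e n)" for n
  proof -
    have "(\<integral>\<^sup>+x. ennreal ((norm (X n x - g x))\<^sup>2) \<partial>lborel)
      = (\<integral>\<^sup>+x. liminf (\<lambda>k. ennreal ((norm (X n x - X (r k) x))\<^sup>2)) \<partial>lborel)"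
    proof (rule nn_integral_cong_AE, use conv in eventually_elim)
      case (elim x)
      then have "(\<lambda>k. X (r k) x) \<longlonglongrightarrow> g x" unfolding g_def by (simp add: convergent_LIMSEQ_iff)
      then have "(\<lambda>k. ennreal ((norm (X n x - X (r k) x))\<^sup>2)) \<longlonglongrightarrow> ennreal ((norm (X n x - g x))\<^sup>2)"
        by (intro tendsto_intros tendsto_ennrealI)
      from lim_imp_Liminf[OF _ this] show ?case by simp
    qed
    also have "\<dots> \<le> liminf (\<lambda>k. \<integral>\<^sup>+x. ennreal ((norm (X n x - X (r k) x))\<^sup>2) \<partial>lborel)"
      by (rule nn_integral_liminf) measurable
    also have "\<dots> \<le> liminf (\<lambda>k. ennreal (e n + (1/8) ^ k))"
      using order_trans[OF cauchy' ennreal_leI] r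
      by (intro Liminf_mono always_eventually allI) (meson add_left_mono)
    also have "\<dots> = ennreal (e n + 0)"
      by (intro lim_imp_Liminf tendsto_ennrealI tendsto_intros LIMSEQ_realpow_zero) auto
    finally show ?thesis by simp
  qed
  have meas: "(\<lambda>x. X n x - g x) \<in> borel_measurable borel" for n by measurable
  have "(\<lambda>x. X 0 x - (X 0 x - g x)) \<in> L2"
    by (intro L2_diff X L2_nn_leD[OF meas e0 close])
  then have "g \<in> L2" by simp
  then show ?thesis
    using that L2_nn_leD(2)[OF meas e0 close] by blast
qed

text \<open>The set of disagreement is open and null, and a nonempty open set is not null.\<close>

lemma continuous_AE_eq:
  fixes f g :: "real \<Rightarrow> complex"
  assumes "continuous_on UNIV f" "continuous_on UNIV g" "AE x in lborel. f x = g x"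
  shows "f = g"
proof (rule ccontr)
  let ?S = "{x. f x \<noteq> g x}"
  assume "f \<noteq> g"
  then have "?S \<noteq> {}" by auto
  moreover have "open ?S" using assms(1,2) by (rule open_Collect_neq)
  ultimately have "\<not> negligible ?S" by (simp add: open_not_negligible)
  moreover have "?S \<in> null_sets lborel"
    using assms(3) \<open>open ?S\<close> by (subst AE_iff_null_sets) auto
  ultimately show False
    using negligible_iff_null_sets null_sets_completionI by blast
qed

lemma tendsto_L2_unique:
  assumes "tendsto_L2 X g F" "tendsto_L2 X h F" "F \<noteq> bot"
    and [measurable]: "g \<in> borel_measurable borel" "h \<in> borel_measurable borel"
  shows "AE x in lborel. g x = h x"
proof -
  have ev: "\<forall>\<^sub>F i in F. (\<lambda>x. X i x - g x) \<in> L2 \<and> (\<lambda>x. X i x - h x) \<in> L2"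
    and lim: "((\<lambda>i. LINT x|lborel. (norm (X i x - g x))\<^sup>2) \<longlongrightarrow> 0) F"
        "((\<lambda>i. LINT x|lborel. (norm (X i x - h x))\<^sup>2) \<longlongrightarrow> 0) F"
    using assms(1,2) unfolding tendsto_L2_iff by (auto intro: eventually_conj)
  have *: "(\<lambda>x. h x - g x) \<in> L2 \<and> (LINT x|lborel. (norm (h x - g x))\<^sup>2) \<le>
      2 * (LINT x|lborel. (norm (X i x - g x))\<^sup>2) + 2 * (LINT x|lborel. (norm (X i x - h x))\<^sup>2)"
    if "(\<lambda>x. X i x - g x) \<in> L2 \<and> (\<lambda>x. X i x - h x) \<in> L2" for i
    using L2_diff[of "\<lambda>x. X i x - g x" "\<lambda>x. X i x - h x"]
      L2_diff_le[of "\<lambda>x. X i x - g x" "\<lambda>x. X i x - h x"] that by simp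
  have "((\<lambda>i. 2 * (LINT x|lborel. (norm (X i x - g x))\<^sup>2) + 2 * (LINT x|lborel. (norm (X i x - h x))\<^sup>2))
      \<longlongrightarrow> 2 * 0 + 2 * 0) F"
    by (intro tendsto_intros lim)
  then have "(LINT x|lborel. (norm (h x - g x))\<^sup>2) \<le> 2 * 0 + 2 * 0"
    by (rule tendsto_lowerbound[OF _ _ assms(3)]) (use ev * in \<open>auto elim: eventually_mono\<close>)
  moreover have L2: "(\<lambda>x. h x - g x) \<in> L2"
    using eventually_happens'[OF assms(3) ev] * by blast
  moreover have "(LINT x|lborel. (norm (h x - g x))\<^sup>2) \<ge> 0" by simp
  ultimately have "(LINT x|lborel. (norm (h x - g x))\<^sup>2) = 0" by linarith
  then have "AE x in lborel. (norm (h x - g x))\<^sup>2 = 0"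
    using L2 by (subst (asm) integral_nonneg_eq_0_iff_AE) (auto simp: L2_def)
  then show ?thesis by eventually_elim simp
qed

text \<open>Discharges the definite description: L2 limits agree almost everywhere, and continuous
  functions agreeing almost everywhere are equal.\<close>

lemma fourier_Cb_eqI:
  assumes "F \<in> bcontfun" "has_L2_fourier f F"
  shows "fourier_Cb f = F"
  unfolding fourier_Cb_def
proof (rule the_equality)
  fix H assume H: "H \<in> bcontfun \<and> has_L2_fourier f H"
  then have "AE x in lborel. H x = F x"
    using assms by (intro tendsto_L2_unique[of _ H at_top F])
      (auto simp: has_L2_fourier_def L2_measurable)
  then show "H = F"
    using H assms by (intro continuous_AE_eq) (auto simp: bcontfun_def)
qed (use assms in auto)

section \<open>Distance from the Bernstein space\<close>

text \<open>For nonnegative integrands a gauge integral is a Lebesgue integral. This imports the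
  known integrals of powers on bounded and unbounded intervals.\<close>

lemma set_integrable_has_integral_nonneg:
  fixes f :: "real \<Rightarrow> real"
  assumes "(f has_integral I) A" "\<And>x. x \<in> A \<Longrightarrow> 0 \<le> f x"
    and [measurable]: "f \<in> borel_measurable borel" "A \<in> sets borel"
  shows "set_integrable lborel A f"
  unfolding set_integrable_def
proof (rule integrableI_bounded)
  have "(\<integral>\<^sup>+x. ennreal (norm (indicator A x *\<^sub>R f x)) \<partial>lborel) = (\<integral>\<^sup>+x. ennreal (f x) * indicator A x \<partial>lborel)"
    using assms(2) by (intro nn_integral_cong) (auto simp: indicator_def)
  also have "\<dots> = ennreal I" by (rule nn_integral_has_integral_lebesgue'[OF assms(2,1)])
  finally show "(\<integral>\<^sup>+x. ennreal (norm (indicator A x *\<^sub>R f x)) \<partial>lborel) < \<infinity>" by simp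
qed measurable

lemma set_integrable_powr_atLeast:
  "e < -1 \<Longrightarrow> a > 0 \<Longrightarrow> set_integrable lborel {a..} (\<lambda>x::real. x powr e)"
  by (rule set_integrable_has_integral_nonneg[OF has_integral_powr_to_inf]) auto

lemma set_integrable_powr_from_0:
  "e > -1 \<Longrightarrow> c \<ge> 0 \<Longrightarrow> set_integrable lborel {0..c} (\<lambda>x::real. x powr e)"
  by (rule set_integrable_has_integral_nonneg[OF has_integral_powr_from_0]) auto

text \<open>The first bound handles [-1, 1], the second the tails, which converge because a > 1.
  This is how integrability of a transform is obtained from boundedness of its product with
  \<open>\<bar>v\<bar> powr \<alpha>\<close>.\<close>

lemma integrable_powr_decay:
  fixes F :: "real \<Rightarrow> complex"
  assumes F: "F \<in> borel_measurable borel" and a: "a > 1"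
    and C: "\<And>v. norm (F v) \<le> C" "\<And>v. \<bar>v\<bar> powr a * norm (F v) \<le> C"
  shows "integrable lborel F"
proof (rule Bochner_Integration.integrable_bound)
  have C0: "C \<ge> 0" using C(1)[of 0] norm_ge_zero order_trans by blast
  let ?p = "\<lambda>v::real. indicator {1..} v *\<^sub>R (v powr - a)"
  have p: "integrable lborel ?p"
    using set_integrable_powr_atLeast[of "-a" 1] a by (simp add: set_integrable_def)
  have p': "integrable lborel (\<lambda>v. ?p (- v))"
    using lborel_integrable_real_affine[OF p, of "-1" 0] by simp
  have q: "integrable lborel (\<lambda>v::real. indicator {-1..1} v :: real)"
    by (simp add: integrable_indicator_iff)
  show "integrable lborel (\<lambda>v. C * (indicator {-1..1} v + ?p v + ?p (- v)))"
    by (intro integrable_mult_right Bochner_Integration.integrable_add p p' q)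
  show "F \<in> borel_measurable lborel" using F by simp
  have "norm (F v) \<le> C * (indicator {-1..1} v + ?p v + ?p (- v))" for v
  proof (cases "\<bar>v\<bar> \<le> 1")
    case True
    have "C * 1 \<le> C * (indicator {-1..1} v + ?p v + ?p (- v))"
      using True C0 by (intro mult_left_mono) (auto simp: indicator_def)
    with C(1)[of v] show ?thesis by simp
  next
    case False
    have "norm (F v) \<le> C * \<bar>v\<bar> powr - a"
      using C(2)[of v] False by (simp add: powr_minus field_simps)
    also have "\<dots> = C * (indicator {-1..1} v + ?p v + ?p (- v))"
      using False by (auto simp: indicator_def abs_if)
    finally show ?thesis .
  qed
  then show "AE v in lborel. norm (F v) \<le> norm (C * (indicator {-1..1} v + ?p v + ?p (- v)))"
    by (intro AE_I2) (metis abs_ge_self order_trans real_norm_def)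
qed

section \<open>Tent functions, and interpolation by transforms of integrable functions\<close>

text \<open>The linear B-spline. Its integer translates form a partition of unity, and its
  transform, the Fejer kernel of the line, decays quadratically; these two properties are all that
  the interpolation uses.\<close>

definition hat :: "real \<Rightarrow> real" where
  "hat x = max 0 (1 - \<bar>x\<bar>)"

lemma hat_bounds: "0 \<le> hat x" "hat x \<le> 1"
  by (auto simp: hat_def)

lemma hat_eq_0_iff: "hat x = 0 \<longleftrightarrow> 1 \<le> \<bar>x\<bar>"
  by (auto simp: hat_def max_def)

lemma hat_measurable [measurable]: "hat \<in> borel_measurable borel"
  unfolding hat_def by measurable

lemma integrable_hat: "integrable lborel (\<lambda>x. complex_of_real (hat x))"
proof (rule Bochner_Integration.integrable_bound)
  show "integrable lborel (\<lambda>v::real. indicator {-1..1} v :: real)"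
    by (simp add: integrable_indicator_iff)
  show "AE x in lborel. norm (complex_of_real (hat x)) \<le> norm (indicator {-1..1} x :: real)"
    using hat_bounds hat_eq_0_iff by (intro AE_I2) (auto simp: indicator_def abs_if hat_def)
qed measurable

text \<open>The tent is not differentiable at 0, so each half is integrated separately by the
  fundamental theorem. The single half decays only like 1/v, because of the term linear in
  v.\<close>

lemma fourier_half_hat:
  assumes "v \<noteq> 0"
  shows "fourier (\<lambda>x. indicator {0..1} x *\<^sub>R complex_of_real (1 - x)) v =
    complex_of_real (1 / sqrt (2 * pi)) * ((1 - \<i> * complex_of_real v - exp (- (\<i> * complex_of_real v)))
       / complex_of_real (v\<^sup>2))"
    and "integrable lborel (\<lambda>x. indicator {0..1} x *\<^sub>R complex_of_real (1 - x))"
proof -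
  define c where "c = - (\<i> * complex_of_real v)"
  have c: "c \<noteq> 0" "c * c = - complex_of_real (v\<^sup>2)"
    using assms by (auto simp: c_def power_mult_distrib simp flip: power2_eq_square)
  \<comment> \<open>An antiderivative of (1 - x) * exp (c * x), found by one integration by
    parts.\<close>
  define P where "P x = (complex_of_real (1 - x) * exp (c * complex_of_real x)) / c
     + exp (c * complex_of_real x) / (c * c)" for x
  have "(P has_vector_derivative complex_of_real (1 - x) * exp (c * complex_of_real x)) (at x within {0..1})" for x
  proof -
    have "((\<lambda>z. ((1 - z) * exp (c * z)) / c + exp (c * z) / (c * c)) has_field_derivative
        (1 - complex_of_real x) * exp (c * complex_of_real x)) (at (complex_of_real x))"
      using c(1) by (auto intro!: derivative_eq_intros simp: field_simps)
    from field_vector_diff_chain_at[OF has_vector_derivative_of_real[OF DERIV_ident] this]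
    show ?thesis
      unfolding P_def comp_def by (auto intro: has_vector_derivative_at_within)
  qed
  then have "(LINT x|lborel. indicator {0..1} x *\<^sub>R (complex_of_real (1 - x) * exp (c * complex_of_real x)))
     = P 1 - P 0"
    by (intro integral_FTC_Icc) (auto intro!: continuous_intros)
  moreover have "P 1 - P 0 = (1 - \<i> * complex_of_real v - exp (- (\<i> * complex_of_real v)))
       / complex_of_real (v\<^sup>2)"
    using c assms unfolding P_def c(2) by (simp add: field_simps power2_eq_square) (simp add: c_def algebra_simps)
  ultimately show "fourier (\<lambda>x. indicator {0..1} x *\<^sub>R complex_of_real (1 - x)) v =
    complex_of_real (1 / sqrt (2 * pi)) * ((1 - \<i> * complex_of_real v - exp (- (\<i> * complex_of_real v)))
       / complex_of_real (v\<^sup>2))"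
    unfolding fourier_def by (simp add: c_def mult_ac)
  show "integrable lborel (\<lambda>x. indicator {0..1} x *\<^sub>R complex_of_real (1 - x))"
    by (rule borel_integrable_compact) (auto intro!: continuous_intros)
qed

text \<open>Adding the half-tent transforms at v and -v cancels the linear terms and leaves 2 - exp
  (-iv) - exp (iv), of modulus at most 4, over v^2.\<close>

lemma norm_fourier_hat_le: "v\<^sup>2 * norm (fourier (\<lambda>x. complex_of_real (hat x)) v) \<le> 4"
proof (cases "v = 0")
  case False
  let ?h = "\<lambda>x. indicator {0..1} x *\<^sub>R complex_of_real (1 - x)"
  have h: "integrable lborel ?h" "integrable lborel (\<lambda>x. ?h (- x))"
    using fourier_half_hat(2)[OF False] lborel_integrable_real_affine[of ?h "-1" 0] by auto
  have "fourier (\<lambda>x. complex_of_real (hat x)) v = fourier (\<lambda>x. ?h x + ?h (- x)) v"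
  proof -
    \<comment> \<open>Equality fails at x = 0, where both halves take the value 1 and the tent is
      counted twice.\<close>
    have "AE x in lborel. complex_of_real (hat x) * exp (- (\<i> * complex_of_real x * complex_of_real v))
       = (?h x + ?h (- x)) * exp (- (\<i> * complex_of_real x * complex_of_real v))"
      using AE_lborel_singleton[of 0]
    proof eventually_elim
      case (elim x)
      then have "complex_of_real (hat x) = ?h x + ?h (- x)"
        by (auto simp: hat_def indicator_def)
      then show ?case by simp
    qed
    then show ?thesis
      unfolding fourier_def by (subst integral_cong_AE) auto
  qed
  also have "\<dots> = fourier ?h v + fourier ?h (- v)"
    by (simp only: fourier_add[OF h] fourier_reflect[of ?h])
  also have "\<dots> = complex_of_real (1 / sqrt (2 * pi)) *
     ((2 - exp (- (\<i> * complex_of_real v)) - exp (\<i> * complex_of_real v)) / complex_of_real (v\<^sup>2))"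
    using False by (subst (1 2) fourier_half_hat(1)) (auto simp: distrib_left[symmetric] add_divide_distrib[symmetric])
  finally have "v\<^sup>2 * norm (fourier (\<lambda>x. complex_of_real (hat x)) v) =
     (1 / sqrt (2 * pi)) * norm (2 - exp (- (\<i> * complex_of_real v)) - exp (\<i> * complex_of_real v))"
    using False by (simp add: norm_mult norm_divide del: of_real_power)
  also have "\<dots> \<le> 1 * 4"
  proof (intro mult_mono)
    have "norm (2 - exp (- (\<i> * complex_of_real v)) - exp (\<i> * complex_of_real v))
       \<le> norm (2::complex) + norm (exp (- (\<i> * complex_of_real v))) + norm (exp (\<i> * complex_of_real v))"
      by (intro order_trans[OF norm_triangle_ineq4] add_mono norm_triangle_ineq4) auto
    then show "norm (2 - exp (- (\<i> * complex_of_real v)) - exp (\<i> * complex_of_real v)) \<le> 4"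
      by simp
  qed (use pi_gt3 in \<open>auto simp: real_sqrt_ge_one\<close>)
  finally show ?thesis by simp
qed simp

text \<open>The transform of the tent is integrable by its quadratic decay, and inversion returns
  the tent since it is even. Dilation by \<open>a\<close> and modulation by \<open>b\<close> then
  set the width and the centre.\<close>

lemma fourier_hat_kernel:
  assumes "a > 0"
  obtains g where "integrable lborel g" "\<And>v. fourier g v = complex_of_real (hat ((v - b) / a))"
proof -
  let ?T = "\<lambda>x. complex_of_real (hat x)"
  define k where "k = fourier ?T"
  have Tb: "?T \<in> bcontfun"
    using hat_bounds by (intro bcontfun_normI[of _ 1]) (auto simp: hat_def intro!: continuous_intros)
  define N where "N = (LINT u|lborel. norm (?T u))"
  have N: "N \<ge> 0" unfolding N_def by (rule Bochner_Integration.integral_nonneg) simp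
  have kint: "integrable lborel k"
    unfolding k_def
  proof (rule integrable_powr_decay[where a=2])
    show "norm (fourier ?T v) \<le> N + 4" for v
      using norm_fourier_le[OF integrable_hat, of v] unfolding N_def by linarith
    show "\<bar>v\<bar> powr 2 * norm (fourier ?T v) \<le> N + 4" for v
      using norm_fourier_hat_le[of v] N
      by (cases "v = 0") (auto simp: powr_numeral)
  qed (auto intro: borel_measurable_fourier integrable_hat)
  have kF: "fourier k v = ?T v" for v
    using fourier_inversion[OF integrable_hat Tb kint[unfolded k_def], of "-v"]
    unfolding k_def by (simp add: hat_def)
  define g where "g x = complex_of_real a * k (a * x) * exp (\<i> * complex_of_real x * complex_of_real b)" for x
  have "integrable lborel (\<lambda>x. complex_of_real a * k (a * x))"
    using lborel_integrable_real_affine[OF kint, of a 0] assms by auto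
  then have "integrable lborel g"
    unfolding g_def by (rule integrable_mult_unimodular) auto
  moreover have "fourier g v = ?T ((v - b) / a)" for v
  proof -
    have "fourier g v = fourier (\<lambda>x. complex_of_real a * k (a * x)) (v - b)"
      unfolding g_def by (rule fourier_modulate)
    also have "\<dots> = complex_of_real a * fourier (\<lambda>x. k (a * x)) (v - b)" by (rule fourier_cmult)
    also have "\<dots> = fourier k ((v - b) / a)" using assms by (simp add: fourier_scale)
    finally show ?thesis by (simp add: kF)
  qed
  ultimately show ?thesis using that by blast
qed

lemma sum_hat_eq_1:
  assumes "\<bar>x\<bar> \<le> real n"
  shows "(\<Sum>i\<in>{- int n..int n}. hat (x - real_of_int i)) = 1"
\<comment> \<open>At the right end point the floor of x is n, and its successor lies outside the
  index range; elsewhere the two tents at the floor and its successor are both in the sum.\<close>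
proof (cases "x = real n")
  case True
  have "(\<Sum>i\<in>{- int n..int n}. hat (x - real_of_int i)) = (\<Sum>i\<in>{int n}. hat (x - real_of_int i))"
    using True by (intro sum.mono_neutral_right) (auto simp: hat_eq_0_iff)
  then show ?thesis using True by (simp add: hat_def)
next
  case False
  define k where "k = \<lfloor>x\<rfloor>"
  have k: "real_of_int k \<le> x" "x < real_of_int k + 1" unfolding k_def by linarith+
  have kn: "- int n \<le> k" "k < int n" using assms False k by linarith+
  have "(\<Sum>i\<in>{- int n..int n}. hat (x - real_of_int i)) = (\<Sum>i\<in>{k, k + 1}. hat (x - real_of_int i))"
  proof (intro sum.mono_neutral_right ballI)
    fix i assume "i \<in> {- int n..int n} - {k, k + 1}"
    then have "i \<le> k - 1 \<or> i \<ge> k + 2" by auto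
    then have "real_of_int i \<le> real_of_int k - 1 \<or> real_of_int i \<ge> real_of_int k + 2" by linarith
    with k show "hat (x - real_of_int i) = 0" by (auto simp: hat_eq_0_iff)
  qed (use kn in auto)
  then show ?thesis using k by (simp add: hat_def max_def)
qed

text \<open>Makes the infimum over the Bernstein space one over a nonempty set.\<close>

lemma Bernstein1_zero: "(\<lambda>_. 0) \<in> Bernstein1 \<sigma>"
  by (simp add: Bernstein1_def L1_def fourier_def)

text \<open>G is interpolated linearly on an equidistant grid, except that the values at the end
  nodes are replaced by 0 to make the interpolant vanish for |v| \<ge> \<sigma>. This replacement
  costs at most M, the bound on G at the end nodes; uniform continuity on the compact interval
  accounts for \<eta>.\<close>

lemma Bernstein1_approx:
  assumes G: "G \<in> bcontfun" and s: "\<sigma> > 0" and eta: "\<eta> > 0"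
    and M: "\<And>v. \<bar>v\<bar> \<ge> \<sigma> \<Longrightarrow> norm (G v) \<le> M"
  obtains g where "g \<in> Bernstein1 \<sigma>" "\<And>v. norm (G v - fourier g v) \<le> M + \<eta>"
proof -
  have M0: "M \<ge> 0" using M[of \<sigma>] norm_ge_zero[of "G \<sigma>"] by linarith
  have "uniformly_continuous_on {-\<sigma>..\<sigma>} G"
    using G by (intro compact_uniformly_continuous) (auto simp: bcontfun_def intro: continuous_on_subset)
  then obtain d where d: "d > 0" and
    dG: "\<And>x y. x \<in> {-\<sigma>..\<sigma>} \<Longrightarrow> y \<in> {-\<sigma>..\<sigma>} \<Longrightarrow> dist y x < d \<Longrightarrow> dist (G y) (G x) < \<eta>"
    using eta unfolding uniformly_continuous_on_def by metis
  \<comment> \<open>The mesh a = \<sigma> / n is made smaller than the modulus d, so that only nodes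
    within distance d of v contribute, and \<plusminus>\<sigma> are nodes.\<close>
  obtain n0 :: nat where n0: "real n0 > \<sigma> / d" using reals_Archimedean2 by blast
  define n where "n = Suc n0"
  define a where "a = \<sigma> / real n"
  have n: "real n > 0" and a: "a > 0" "a * real n = \<sigma>" using s by (auto simp: a_def n_def)
  have ad: "a < d"
  proof -
    have "\<sigma> < d * real n0" using n0 d by (simp add: field_simps)
    also have "\<dots> \<le> d * real n" using d by (simp add: n_def)
    finally show ?thesis using n by (simp add: a_def field_simps)
  qed
  have "\<exists>g. integrable lborel g \<and> (\<forall>v. fourier g v = complex_of_real (hat ((v - a * of_int i) / a)))"
    for i :: int
    using fourier_hat_kernel[OF a(1), of "a * of_int i"] by metis
  then have "\<forall>i::int. \<exists>g. integrable lborel g \<and> (\<forall>v. fourier g v = complex_of_real (hat ((v - a * of_int i) / a)))"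
    by blast
  from choice[OF this] obtain g where g: "\<And>i::int. integrable lborel (g i)"
    "\<And>i v. fourier (g i) v = complex_of_real (hat ((v - a * of_int i) / a))" by blast
  \<comment> \<open>The nodes \<open>i = \<plusminus>n\<close> get the value 0: a tent centred there
    would reach beyond (-\<sigma>, \<sigma>).\<close>
  define c where "c i = (if \<bar>i\<bar> < int n then G (a * of_int i) else 0)" for i
  define h where "h x = (\<Sum>i\<in>{- int n..int n}. c i * g i x)" for x
  have hF: "fourier h v = (\<Sum>i\<in>{- int n..int n}. c i * complex_of_real (hat (v / a - of_int i)))" for v
    unfolding h_def using g a by (subst fourier_sum) (auto simp: fourier_cmult diff_divide_distrib)
  have hint: "integrable lborel h" unfolding h_def using g by auto
  have out: "fourier h v = 0" if "\<bar>v\<bar> \<ge> \<sigma>" for v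
    unfolding hF
  proof (rule sum.neutral, rule ballI)
    fix i :: int
    have "\<bar>v / a\<bar> \<ge> real n" using that a by (simp add: field_simps)
    then have "hat (v / a - of_int i) = 0" if "\<bar>i\<bar> < int n"
      using that by (auto simp: hat_eq_0_iff)
    then show "c i * complex_of_real (hat (v / a - of_int i)) = 0"
      by (auto simp: c_def)
  qed
  have "h \<in> Bernstein1 \<sigma>"
    using hint out by (auto simp: Bernstein1_def L1_def)
  moreover have "norm (G v - fourier h v) \<le> M + \<eta>" for v
  proof (cases "\<bar>v\<bar> \<ge> \<sigma>")
    case True
    then show ?thesis using out[OF True] M[OF True] eta by simp
  next
    case False
    let ?t = "\<lambda>i. hat (v / a - of_int i)"
    have "\<bar>v / a\<bar> \<le> real n" using False a by (simp add: field_simps)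
    then have t1: "(\<Sum>i\<in>{- int n..int n}. ?t i) = 1" by (rule sum_hat_eq_1)
    \<comment> \<open>The tents sum to 1 at v, so the error is a convex combination of the errors
      \<open>G v - c i\<close> at nearby nodes, each at most M + \<eta>.\<close>
    have "G v - fourier h v = (\<Sum>i\<in>{- int n..int n}. complex_of_real (?t i) * (G v - c i))"
      unfolding hF right_diff_distrib sum_subtractf
      unfolding sum_distrib_right[symmetric] of_real_sum[symmetric] t1 by (simp add: mult.commute)
    also have "norm \<dots> \<le> (\<Sum>i\<in>{- int n..int n}. ?t i * (M + \<eta>))"
    proof (rule sum_norm_le)
      fix i assume i: "i \<in> {- int n..int n}"
      show "norm (complex_of_real (?t i) * (G v - c i)) \<le> ?t i * (M + \<eta>)"
      proof (cases "?t i = 0")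
        case False
        then have "\<bar>v / a - of_int i\<bar> < 1" by (simp add: hat_eq_0_iff)
        then have "dist v (a * of_int i) < d"
          using a ad by (simp add: dist_real_def field_simps abs_less_iff)
        moreover have ia: "\<bar>a * of_int i\<bar> \<le> \<sigma>"
        proof -
          have "\<bar>of_int i\<bar> \<le> real n" using i by (simp add: abs_le_iff)
          then have "a * \<bar>of_int i\<bar> \<le> a * real n" using a by (intro mult_left_mono) auto
          then show ?thesis using a by (simp add: abs_mult)
        qed
        ultimately have "dist (G v) (G (a * of_int i)) < \<eta>"
          using \<open>\<not> \<bar>v\<bar> \<ge> \<sigma>\<close> by (intro dG) (auto simp: abs_le_iff)
        then have close: "norm (G v - G (a * of_int i)) < \<eta>" by (simp add: dist_norm)
        have "norm (G v - c i) \<le> M + \<eta>"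
        proof (cases "\<bar>i\<bar> < int n")
          case True
          then show ?thesis using close M0 by (simp add: c_def)
        next
          case nlt: False
          then have "\<bar>real_of_int i\<bar> = real n" using i by auto
          then have "\<bar>a * of_int i\<bar> = \<sigma>" using a by (simp add: abs_mult)
          then have "norm (G (a * of_int i)) \<le> M" by (intro M) simp
          then show ?thesis
            using close nlt norm_triangle_sub[of "G v" "G (a * of_int i)"] by (simp add: c_def)
        qed
        then show ?thesis
          using hat_bounds by (simp add: norm_mult mult_left_mono)
      qed simp
    qed
    also have "\<dots> = M + \<eta>" unfolding sum_distrib_right[symmetric] t1 by simp
    finally show ?thesis .
  qed
  ultimately show ?thesis using that by blast
qed

text \<open>The reals are only conditionally complete, so the boundedness facts at the beginning are
  what gives the suprema and the infimum their meaning. The interpolant attains the bound up to an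
  arbitrary \<eta>.\<close>

lemma Bernstein1_dist_eq:
  assumes G: "G \<in> bcontfun" and s: "\<sigma> > 0"
  shows "(INF g\<in>Bernstein1 \<sigma>. SUP v. norm (G v - fourier g v)) = (SUP v\<in>{v. \<sigma> \<le> \<bar>v\<bar>}. norm (G v))"
proof (rule antisym)
  obtain B where B: "\<And>v. norm (G v) \<le> B" using bcontfun_bound[OF G] by blast
  have bdd: "bdd_above ((\<lambda>v. norm (G v)) ` S)" for S using B by (intro bdd_aboveI2)
  have bdd2: "bdd_above (range (\<lambda>v. norm (G v - fourier g v)))" if "g \<in> Bernstein1 \<sigma>" for g
  proof -
    have "norm (G v - fourier g v) \<le> B + (LINT u|lborel. norm (g u))" for v
      using norm_triangle_ineq4[of "G v" "fourier g v"] B[of v] norm_fourier_le[of g v] that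
      by (auto simp: Bernstein1_def L1_def)
    then show ?thesis by (intro bdd_aboveI2)
  qed
  have ne: "{v::real. \<sigma> \<le> \<bar>v\<bar>} \<noteq> {}" by (auto intro: exI[of _ \<sigma>])
  let ?M = "SUP v\<in>{v. \<sigma> \<le> \<bar>v\<bar>}. norm (G v)"
  have M: "norm (G v) \<le> ?M" if "\<bar>v\<bar> \<ge> \<sigma>" for v
    using that bdd by (intro cSUP_upper) auto
  have bddb: "bdd_below ((\<lambda>g. SUP v. norm (G v - fourier g v)) ` Bernstein1 \<sigma>)"
  proof (rule bdd_belowI2)
    fix g assume "g \<in> Bernstein1 \<sigma>"
    from cSUP_upper[OF UNIV_I bdd2[OF this], of 0]
    show "0 \<le> (SUP v. norm (G v - fourier g v))" using norm_ge_zero order_trans by blast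
  qed
  show "(INF g\<in>Bernstein1 \<sigma>. SUP v. norm (G v - fourier g v)) \<le> ?M"
  proof (rule field_le_epsilon)
    fix \<eta> :: real assume "\<eta> > 0"
    then obtain g where g: "g \<in> Bernstein1 \<sigma>" "\<And>v. norm (G v - fourier g v) \<le> ?M + \<eta>"
      using Bernstein1_approx[OF G s _ M] by metis
    have "(INF g\<in>Bernstein1 \<sigma>. SUP v. norm (G v - fourier g v)) \<le> (SUP v. norm (G v - fourier g v))"
      by (rule cINF_lower[OF bddb g(1)])
    also have "\<dots> \<le> ?M + \<eta>" using g(2) by (intro cSUP_least) auto
    finally show "(INF g\<in>Bernstein1 \<sigma>. SUP v. norm (G v - fourier g v)) \<le> ?M + \<eta>" .
  qed
  show "?M \<le> (INF g\<in>Bernstein1 \<sigma>. SUP v. norm (G v - fourier g v))"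
  proof (rule cINF_greatest)
    fix g assume g: "g \<in> Bernstein1 \<sigma>"
    show "?M \<le> (SUP v. norm (G v - fourier g v))"
    proof (rule cSUP_least[OF ne])
      fix v assume "v \<in> {v. \<sigma> \<le> \<bar>v\<bar>}"
      then have "v \<notin> {-\<sigma><..<\<sigma>}" by (auto simp: abs_if split: if_splits)
      then have "fourier g v = 0" using g unfolding Bernstein1_def mem_Collect_eq by blast
      then show "norm (G v) \<le> (SUP v. norm (G v - fourier g v))"
        using cSUP_upper[OF UNIV_I bdd2[OF g], of v] by simp
    qed
  qed (use Bernstein1_zero in blast)
qed

section \<open>The multiplier of the truncated Riesz derivative\<close>

lemma integrable_bcontfun_mult:
  assumes f: "f \<in> bcontfun" and w: "integrable lborel (w :: real \<Rightarrow> complex)"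
  shows "integrable lborel (\<lambda>u. f (x + c * u) * w u)"
proof -
  obtain M where M: "M \<ge> 0" "\<And>x. norm (f x) \<le> M" using bcontfun_bound[OF f] by blast
  have [measurable]: "f \<in> borel_measurable borel" by (rule bcontfun_measurable[OF f])
  show ?thesis
  proof (rule Bochner_Integration.integrable_bound)
    show "integrable lborel (\<lambda>u. M *\<^sub>R w u)" using w by auto
    show "AE u in lborel. norm (f (x + c * u) * w u) \<le> norm (M *\<^sub>R w u)"
      using M by (auto simp: norm_mult intro!: mult_right_mono)
    show "(\<lambda>u. f (x + c * u) * w u) \<in> borel_measurable lborel"
      using w by measurable
  qed
qed

text \<open>A weighted average of translates of f; translation by c * u multiplies the transform by
  an exponential, so the average multiplies it by the integral of these exponentials against
  \<open>w\<close>. Each term of the truncated difference integral has this shape.\<close>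

lemma
  fixes w :: "real \<Rightarrow> complex"
  assumes f: "integrable lborel f" "f \<in> bcontfun" and w: "integrable lborel w"
  shows smear_bcontfun: "(\<lambda>x. LINT u|lborel. f (x + c * u) * w u) \<in> bcontfun"
    and smear_integrable: "integrable lborel (\<lambda>x. LINT u|lborel. f (x + c * u) * w u)"
    and fourier_smear: "fourier (\<lambda>x. LINT u|lborel. f (x + c * u) * w u) v =
      fourier f v * (LINT u|lborel. exp (\<i> * complex_of_real (c * u) * complex_of_real v) * w u)"
proof -
  obtain M where M: "M \<ge> 0" "\<And>x. norm (f x) \<le> M" using bcontfun_bound[OF f(2)] by blast
  have [measurable]: "f \<in> borel_measurable borel" "w \<in> borel_measurable borel" using f w by auto
  let ?A = "\<lambda>x. LINT u|lborel. f (x + c * u) * w u"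
  have fx: "integrable lborel (\<lambda>x. f (x + c * u))" for u
    using lborel_integrable_real_affine[OF f(1), of 1 "c * u"] by (simp add: add.commute)
  have fn: "(LINT x|lborel. norm (f (x + c * u))) = (LINT x|lborel. norm (f x))" for u
    using lborel_integral_real_affine[of 1 "\<lambda>x. norm (f x)" "c * u"] by (simp add: add.commute)
  \<comment> \<open>The free factor \<open>z\<close> of modulus 1 lets one Fubini argument serve
    twice: with z = 1 for integrability of the average, and with the exponential for its
    transform.\<close>
  have int: "integrable (lborel \<Otimes>\<^sub>M lborel) (case_prod (\<lambda>u x. f (x + c * u) * w u * z x))"
    if z: "z \<in> borel_measurable borel" "\<And>x. norm (z x) = 1" for z :: "real \<Rightarrow> complex"
  proof (rule lborel_pair.Fubini_integrable)
    have [measurable]: "z \<in> borel_measurable borel" by fact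
    show "case_prod (\<lambda>u x. f (x + c * u) * w u * z x) \<in> borel_measurable (lborel \<Otimes>\<^sub>M lborel)"
      by measurable
    show "integrable lborel (\<lambda>u. LINT x|lborel. norm (case (u, x) of (u, x) \<Rightarrow> f (x + c * u) * w u * z x))"
      using w by (simp add: norm_mult z fn)
    show "AE u in lborel. integrable lborel (\<lambda>x. case (u, x) of (u, x) \<Rightarrow> f (x + c * u) * w u * z x)"
    proof (intro AE_I2)
      fix u
      have "integrable lborel (\<lambda>x. w u * (f (x + c * u) * z x))"
        using z by (intro integrable_mult_right integrable_mult_unimodular[OF fx]) auto
      then show "integrable lborel (\<lambda>x. case (u, x) of (u, x) \<Rightarrow> f (x + c * u) * w u * z x)"
        by (simp add: mult_ac)
    qed
  qed
  show "?A \<in> bcontfun"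
  proof (rule bcontfun_normI)
    show "continuous_on UNIV ?A"
    proof (intro continuous_at_imp_continuous_on ballI)
      fix x
      have "(?A \<longlongrightarrow> ?A x) (at x)"
        unfolding tendsto_at_iff_sequentially comp_def
      proof (intro allI impI)
        fix X :: "nat \<Rightarrow> real" assume X: "\<forall>i. X i \<in> UNIV - {x}" "X \<longlonglongrightarrow> x"
        show "(\<lambda>i. ?A (X i)) \<longlonglongrightarrow> ?A x"
        proof (rule integral_dominated_convergence[where w="\<lambda>u. M * norm (w u)"])
          show "AE u in lborel. (\<lambda>i. f (X i + c * u) * w u) \<longlonglongrightarrow> f (x + c * u) * w u"
            by (intro AE_I2 tendsto_intros isCont_tendsto_compose[OF bcontfun_isCont[OF f(2)]] X(2))
          show "AE u in lborel. norm (f (X i + c * u) * w u) \<le> M * norm (w u)" for i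
            using M by (auto simp: norm_mult intro!: mult_right_mono)
        qed (use w in auto)
      qed
      then show "isCont ?A x" by (simp add: isCont_def)
    qed
    show "norm (?A x) \<le> (LINT u|lborel. M * norm (w u))" for x
    proof -
      have "norm (?A x) \<le> (LINT u|lborel. norm (f (x + c * u) * w u))" by simp
      also have "\<dots> \<le> (LINT u|lborel. M * norm (w u))"
        using integrable_norm[OF integrable_bcontfun_mult[OF f(2) w, of x c]] w M
        by (intro integral_mono) (auto simp: norm_mult intro!: mult_right_mono)
      finally show ?thesis .
    qed
  qed
  show "integrable lborel ?A"
    using lborel_pair.integrable_snd[OF int[of "\<lambda>_. 1"]] by simp
  let ?e = "\<lambda>x. exp (- (\<i> * complex_of_real x * complex_of_real v))"
  have "fourier ?A v = complex_of_real (1 / sqrt (2 * pi)) *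
      (LINT x|lborel. LINT u|lborel. f (x + c * u) * w u * ?e x)"
    unfolding fourier_def by simp
  also have "\<dots> = complex_of_real (1 / sqrt (2 * pi)) *
      (LINT u|lborel. LINT x|lborel. f (x + c * u) * w u * ?e x)"
    by (subst lborel_pair.Fubini_integral[OF int]) auto
  also have "\<dots> = complex_of_real (1 / sqrt (2 * pi)) *
      (LINT u|lborel. LINT x|lborel. w u * (f (x + c * u) * ?e x))"
    by (simp only: mult_ac)
  also have "\<dots> = (LINT u|lborel. w u * fourier (\<lambda>x. f (x + c * u)) v)"
    unfolding fourier_def integral_mult_right_zero by (simp add: mult_ac)
  also have "\<dots> = (LINT u|lborel. fourier f v * (exp (\<i> * complex_of_real (c * u) * complex_of_real v) * w u))"
    unfolding fourier_translate by (simp add: mult_ac)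
  also have "\<dots> = fourier f v * (LINT u|lborel. exp (\<i> * complex_of_real (c * u) * complex_of_real v) * w u)"
    by (rule integral_mult_right_zero)
  finally show "fourier ?A v = \<dots>" .
qed

section \<open>Symbols of the central difference and of the truncated integral\<close>

text \<open>With t = u * v / 2 the sum is the binomial expansion of (exp (it) - exp (-it))^(2j),
  that is (2i sin t)^(2j); the power i^(2j) gives the sign.\<close>

lemma central_diff_symbol:
  "(\<Sum>k\<le>2 * j. (-1) ^ k * of_nat ((2 * j) choose k) * exp (\<i> * complex_of_real ((real j - real k) * u) * complex_of_real v))
    = complex_of_real ((-1) ^ j * (2 * sin (u * v / 2)) ^ (2 * j))"
proof -
  define t where "t = u * v / 2"
  have "complex_of_real ((-1) ^ j * (2 * sin t) ^ (2 * j)) = (2 * \<i> * complex_of_real (sin t)) ^ (2 * j)"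
  proof -
    have "(-1) ^ j * (2 * sin t) ^ (2 * j) = (- ((2 * sin t)\<^sup>2)) ^ j"
      by (subst power_minus) (simp add: power_mult)
    then show ?thesis by (simp add: power_mult power_mult_distrib)
  qed
  also have "2 * \<i> * complex_of_real (sin t) = - exp (- (\<i> * t)) + exp (\<i> * t)"
    by (simp add: sin_of_real[symmetric] sin_exp_eq field_simps)
  also have "\<dots> ^ (2 * j) = (\<Sum>k\<le>2 * j. of_nat ((2 * j) choose k) * (- exp (- (\<i> * t))) ^ k * exp (\<i> * t) ^ (2 * j - k))"
    by (rule binomial_ring)
  also have "\<dots> = (\<Sum>k\<le>2 * j. (-1) ^ k * of_nat ((2 * j) choose k) *
      exp (\<i> * complex_of_real ((real j - real k) * u) * complex_of_real v))"
  proof (intro sum.cong refl)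
    fix k assume "k \<in> {..2 * j}"
    then have k: "k \<le> 2 * j" by simp
    have "(- exp (- (\<i> * t))) ^ k * exp (\<i> * t) ^ (2 * j - k) =
      (-1) ^ k * exp (of_nat k * (- (\<i> * t)) + of_nat (2 * j - k) * (\<i> * t))"
      by (subst power_minus) (simp only: exp_add exp_of_nat_mult mult.assoc)
    also have "of_nat k * (- (\<i> * t)) + of_nat (2 * j - k) * (\<i> * t) =
       \<i> * complex_of_real ((real j - real k) * u) * complex_of_real v"
      using k by (simp add: t_def of_nat_diff field_simps)
    finally show "of_nat ((2 * j) choose k) * (- exp (- (\<i> * t))) ^ k * exp (\<i> * t) ^ (2 * j - k) =
        (-1) ^ k * of_nat ((2 * j) choose k) * exp (\<i> * complex_of_real ((real j - real k) * u) * complex_of_real v)"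
      by (simp add: mult_ac)
  qed
  finally show ?thesis by (simp add: t_def)
qed

definition Riesz_truncation :: "real \<Rightarrow> nat \<Rightarrow> real \<Rightarrow> (real \<Rightarrow> complex) \<Rightarrow> real \<Rightarrow> complex" where
  "Riesz_truncation \<alpha> j \<epsilon> f x = complex_of_real (1 / Riesz_const \<alpha> j) *
     (LINT u:{\<epsilon>..}|lborel. central_diff j u f x / complex_of_real (u powr (1 + \<alpha>)))"

text \<open>The half-line is open so that the value at 0 is exactly the integral in
  \<open>Riesz_const\<close>.\<close>

definition Riesz_tail :: "real \<Rightarrow> nat \<Rightarrow> real \<Rightarrow> real" where
  "Riesz_tail \<alpha> j \<delta> = (LINT u:{\<delta><..}|lborel. sin u ^ (2 * j) / u powr (1 + \<alpha>))"

text \<open>The factor by which truncation at \<epsilon> acts on transforms. The quotient of tails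
  lies between 0 and 1 for \<epsilon> \<ge> 0 and tends to 1 as \<epsilon> tends to 0, leaving the
  symbol of the full derivative.\<close>

definition Riesz_multiplier :: "real \<Rightarrow> nat \<Rightarrow> real \<Rightarrow> real \<Rightarrow> real" where
  "Riesz_multiplier \<alpha> j \<epsilon> v = \<bar>v\<bar> powr \<alpha> * (Riesz_tail \<alpha> j (\<epsilon> * \<bar>v\<bar> / 2) / Riesz_tail \<alpha> j 0)"

context
  fixes \<alpha> :: real and j :: nat
  assumes \<alpha>: "0 < \<alpha>" "\<alpha> < 2 * real j"
begin

text \<open>Near 0, |sin u| \<le> u leaves the exponent 2j - 1 - \<alpha>, which exceeds -1 because
  \<alpha> < 2j. Near infinity |sin u| \<le> 1 leaves -1 - \<alpha>, integrable because \<alpha> >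
  0.\<close>

lemma Riesz_kernel_integrable: "set_integrable lborel {0<..} (\<lambda>u. sin u ^ (2 * j) / u powr (1 + \<alpha>))"
proof -
  have 1: "integrable lborel (\<lambda>x. indicator {0..1} x *\<^sub>R (x powr (2 * real j - (1 + \<alpha>))))"
    using set_integrable_powr_from_0[of "2 * real j - (1 + \<alpha>)" 1] \<alpha> by (simp add: set_integrable_def)
  have 2: "integrable lborel (\<lambda>x::real. indicator {1..} x *\<^sub>R (x powr - (1 + \<alpha>)))"
    using set_integrable_powr_atLeast[of "- (1 + \<alpha>)" 1] \<alpha> by (simp add: set_integrable_def)
  show ?thesis
    unfolding set_integrable_def
  proof (rule Bochner_Integration.integrable_bound[OF Bochner_Integration.integrable_add[OF 1 2]])
    show "AE x in lborel. norm (indicator {0<..} x *\<^sub>R (sin x ^ (2 * j) / x powr (1 + \<alpha>)))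
       \<le> norm (indicator {0..1} x *\<^sub>R (x powr (2 * real j - (1 + \<alpha>))) + indicator {1..} x *\<^sub>R (x powr - (1 + \<alpha>)))"
    proof (intro AE_I2)
      fix x :: real
      have "norm (sin x ^ (2 * j) / x powr (1 + \<alpha>)) \<le>
         norm (indicator {0..1} x *\<^sub>R (x powr (2 * real j - (1 + \<alpha>))) + indicator {1..} x *\<^sub>R (x powr - (1 + \<alpha>)))"
        if x: "x > 0"
      proof (cases "x < 1")
        case True
        have "\<bar>sin x\<bar> ^ (2 * j) \<le> x ^ (2 * j)" using x abs_sin_x_le_abs_x[of x] by (intro power_mono) auto
        also have "\<dots> = x powr (2 * real j)" using x by (simp flip: powr_realpow)
        finally show ?thesis
          using x True by (simp add: indicator_def power_abs powr_diff divide_right_mono)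
      next
        case False
        have "\<bar>sin x\<bar> ^ (2 * j) \<le> 1" by (intro power_le_one) auto
        then have "norm (sin x ^ (2 * j) / x powr (1 + \<alpha>)) \<le> x powr - (1 + \<alpha>)"
          using x unfolding powr_minus by (simp add: power_abs divide_right_mono inverse_eq_divide)
        also have "\<dots> \<le> norm (indicator {0..1} x *\<^sub>R (x powr (2 * real j - (1 + \<alpha>))) + indicator {1..} x *\<^sub>R (x powr - (1 + \<alpha>)))"
          using False by (simp add: indicator_def)
        finally show ?thesis .
      qed
      then show "norm (indicator {0<..} x *\<^sub>R (sin x ^ (2 * j) / x powr (1 + \<alpha>)))
       \<le> norm (indicator {0..1} x *\<^sub>R (x powr (2 * real j - (1 + \<alpha>))) + indicator {1..} x *\<^sub>R (x powr - (1 + \<alpha>)))"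
        by (cases "x > 0") auto
    qed
  qed measurable
qed

lemma Riesz_tail_integrable:
  assumes "\<delta> \<ge> 0"
  shows "set_integrable lborel {\<delta><..} (\<lambda>u. sin u ^ (2 * j) / u powr (1 + \<alpha>))"
  by (rule set_integrable_subset[OF Riesz_kernel_integrable]) (use assms in auto)

lemma Riesz_tail_bounds:
  assumes "\<delta> \<ge> 0"
  shows "0 \<le> Riesz_tail \<alpha> j \<delta>" "Riesz_tail \<alpha> j \<delta> \<le> Riesz_tail \<alpha> j 0"
  using assms Riesz_tail_integrable[OF assms] Riesz_kernel_integrable
  unfolding Riesz_tail_def set_lebesgue_integral_def set_integrable_def
  by (auto intro!: integral_mono Bochner_Integration.integral_nonneg simp: indicator_def)

text \<open>The integrand is nonnegative and strictly positive on (0, pi), which is not a null set.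
  Positivity is what permits division by this integral.\<close>

lemma Riesz_tail_pos: "0 < Riesz_tail \<alpha> j 0"
proof -
  let ?s = "\<lambda>u::real. sin u ^ (2 * j) / u powr (1 + \<alpha>)"
  have "Riesz_tail \<alpha> j 0 \<noteq> 0"
  proof
    assume "Riesz_tail \<alpha> j 0 = 0"
    then have "AE u in lborel. indicator {0<..} u *\<^sub>R ?s u = 0"
      using Riesz_kernel_integrable unfolding Riesz_tail_def set_lebesgue_integral_def set_integrable_def
      by (subst (asm) integral_nonneg_eq_0_iff_AE) (auto simp: indicator_def)
    then have "AE u in lborel. u \<notin> {0<..<pi}"
    proof eventually_elim
      case (elim u)
      show ?case
      proof
        assume u: "u \<in> {0<..<pi}"
        then have "sin u > 0" by (intro sin_gt_zero) auto
        then show False using elim u by simp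
      qed
    qed
    then have "{0<..<pi} \<in> null_sets lborel" by (subst AE_iff_null_sets) auto
    then have "emeasure lborel {0<..<pi} = 0" by blast
    then show False using pi_gt_zero by (simp add: ennreal_eq_0_iff)
  qed
  then show ?thesis using Riesz_tail_bounds(1)[of 0] by simp
qed

lemma Riesz_const_eq: "Riesz_const \<alpha> j = (-1) ^ j * 2 powr (2 * real j - \<alpha>) * Riesz_tail \<alpha> j 0"
  by (simp add: Riesz_const_def Riesz_tail_def)

lemma Riesz_tail_tendsto:
  assumes "X \<longlonglongrightarrow> 0" "\<And>n. X n \<ge> 0"
  shows "(\<lambda>n. Riesz_tail \<alpha> j (X n)) \<longlonglongrightarrow> Riesz_tail \<alpha> j 0"
  unfolding Riesz_tail_def set_lebesgue_integral_def
proof (rule integral_dominated_convergence)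
  let ?s = "\<lambda>u::real. sin u ^ (2 * j) / u powr (1 + \<alpha>)"
  show "integrable lborel (\<lambda>u. indicator {0<..} u *\<^sub>R ?s u)"
    using Riesz_kernel_integrable by (simp add: set_integrable_def)
  show "AE u in lborel. norm (indicator {X n<..} u *\<^sub>R ?s u) \<le> indicator {0<..} u *\<^sub>R ?s u" for n
    using assms(2)[of n] by (auto simp: indicator_def)
  show "AE u in lborel. (\<lambda>n. indicator {X n<..} u *\<^sub>R ?s u) \<longlonglongrightarrow> indicator {0<..} u *\<^sub>R ?s u"
  proof (intro AE_I2)
    fix u :: real
    show "(\<lambda>n. indicator {X n<..} u *\<^sub>R ?s u) \<longlonglongrightarrow> indicator {0<..} u *\<^sub>R ?s u"
    proof (cases "u > 0")
      case True
      then have "eventually (\<lambda>n. X n < u) sequentially" by (rule order_tendstoD[OF assms(1)])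
      then have "eventually (\<lambda>n. indicator {X n<..} u *\<^sub>R ?s u = indicator {0<..} u *\<^sub>R ?s u) sequentially"
        by eventually_elim (use True in simp)
      then show ?thesis by (rule tendsto_eventually)
    next
      case False
      then have "indicator {X n<..} u *\<^sub>R ?s u = indicator {0<..} u *\<^sub>R ?s u" for n
        using assms(2)[of n] by (auto simp: indicator_def)
      then show ?thesis by (simp only: tendsto_const)
    qed
  qed
qed measurable

lemma Riesz_multiplier_bounds:
  assumes "\<epsilon> \<ge> 0"
  shows "0 \<le> Riesz_multiplier \<alpha> j \<epsilon> v" "Riesz_multiplier \<alpha> j \<epsilon> v \<le> \<bar>v\<bar> powr \<alpha>"
proof -
  have "0 \<le> Riesz_tail \<alpha> j (\<epsilon> * \<bar>v\<bar> / 2) / Riesz_tail \<alpha> j 0" "Riesz_tail \<alpha> j (\<epsilon> * \<bar>v\<bar> / 2) / Riesz_tail \<alpha> j 0 \<le> 1"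
    using assms Riesz_tail_bounds[of "\<epsilon> * \<bar>v\<bar> / 2"] Riesz_tail_pos by auto
  then show "0 \<le> Riesz_multiplier \<alpha> j \<epsilon> v" "Riesz_multiplier \<alpha> j \<epsilon> v \<le> \<bar>v\<bar> powr \<alpha>"
    unfolding Riesz_multiplier_def by (auto simp only: mult_nonneg_nonneg powr_ge_zero mult_left_le)
qed

text \<open>For v nonzero the integral is rescaled by p = |v| / 2: the lower limit becomes
  \<epsilon> * p and the powers combine to 4^j * p^\<alpha>, which is 2^(2j - \<alpha>) *
  |v|^\<alpha>. This explains the power of 2 in \<open>Riesz_const\<close>. For v = 0 both sides are
  0.\<close>

lemma Riesz_multiplier_eq:
  assumes e: "\<epsilon> > 0"
  shows "(LINT u|lborel. (-1) ^ j * (2 * sin (u * v / 2)) ^ (2 * j) * (indicator {\<epsilon>..} u * u powr - (1 + \<alpha>)))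
     = Riesz_const \<alpha> j * Riesz_multiplier \<alpha> j \<epsilon> v"
proof (cases "v = 0")
  case True
  then show ?thesis using \<alpha> by (simp add: Riesz_multiplier_def power_0_left)
next
  case False
  define p where "p = \<bar>v\<bar> / 2"
  have p: "p > 0" using False by (simp add: p_def)
  have sv: "sin (u * v / 2) ^ (2 * j) = sin (p * u) ^ (2 * j)" for u
    unfolding p_def by (cases "v > 0") (auto simp: mult_ac)
  let ?g = "\<lambda>u. (-1) ^ j * (2 * sin (u * v / 2)) ^ (2 * j) * (indicator {\<epsilon>..} u * u powr - (1 + \<alpha>))"
  have "(LINT u|lborel. ?g u) = \<bar>1 / p\<bar> *\<^sub>R (LINT u|lborel. ?g (0 + (1 / p) * u))"
    using p by (intro lborel_integral_real_affine) auto
  also have "(LINT u|lborel. ?g (0 + (1 / p) * u)) = (LINT u|lborel. ((-1) ^ j * 4 ^ j * p powr (1 + \<alpha>)) *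
      (indicator {\<epsilon> * p<..} u *\<^sub>R (sin u ^ (2 * j) / u powr (1 + \<alpha>))))"
  proof (rule integral_cong_AE)
    \<comment> \<open>The truncated integral runs over a closed half-line and
      \<open>Riesz_tail\<close> over an open one; the end point \<epsilon> * p is a null
      set.\<close>
    show "AE u in lborel. ?g (0 + (1 / p) * u) = ((-1) ^ j * 4 ^ j * p powr (1 + \<alpha>)) *
      (indicator {\<epsilon> * p<..} u *\<^sub>R (sin u ^ (2 * j) / u powr (1 + \<alpha>)))"
      using AE_lborel_singleton[of "\<epsilon> * p"]
    proof eventually_elim
      case (elim u)
      have s2: "(2 * sin ((0 + 1 / p * u) * v / 2)) ^ (2 * j) = 4 ^ j * sin u ^ (2 * j)"
        using p unfolding power_mult_distrib sv by (simp add: power_mult)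
      show ?case
      proof (cases "u > \<epsilon> * p")
        case True
        have u: "u > 0" using True e p by (meson less_trans mult_pos_pos)
        have "(u / p) powr - (1 + \<alpha>) = p powr (1 + \<alpha>) / u powr (1 + \<alpha>)"
          using u p by (simp only: powr_divide powr_minus) (simp add: field_simps)
        moreover have "\<epsilon> \<le> u / p" using True p by (simp add: field_simps)
        ultimately show ?thesis
          unfolding s2 using True p by (simp add: mult_ac)
      next
        case False
        then have "\<not> \<epsilon> \<le> u / p" using elim p by (simp add: field_simps)
        then show ?thesis using False by simp
      qed
    qed
  qed measurable
  also have "\<dots> = ((-1) ^ j * 4 ^ j * p powr (1 + \<alpha>)) * Riesz_tail \<alpha> j (\<epsilon> * p)"
    unfolding Riesz_tail_def set_lebesgue_integral_def by (rule integral_mult_right_zero)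
  also have "\<bar>1 / p\<bar> *\<^sub>R \<dots> = (-1) ^ j * (4 ^ j * p powr \<alpha>) * Riesz_tail \<alpha> j (\<epsilon> * p)"
    using p by (simp add: powr_add)
  also have "4 ^ j * p powr \<alpha> = 2 powr (2 * real j - \<alpha>) * \<bar>v\<bar> powr \<alpha>"
  proof -
    have "(4::real) ^ j = 2 powr (2 * real j)"
      using powr_realpow[of "2::real" "2 * j"] by (simp add: power_mult)
    then show ?thesis by (simp add: p_def powr_divide powr_diff)
  qed
  finally show ?thesis
    using Riesz_tail_pos by (simp add: Riesz_const_eq Riesz_multiplier_def p_def)
qed

lemma Riesz_const_nonzero: "Riesz_const \<alpha> j \<noteq> 0"
  using Riesz_tail_pos by (simp add: Riesz_const_eq)

text \<open>Cutting at \<epsilon> makes the weight \<open>u powr - (1 + \<alpha>)\<close>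
  integrable, so the truncation is a finite combination of averaged translates of f. It therefore
  stays integrable, bounded and continuous, and its symbol is bounded for each fixed \<epsilon>,
  although \<open>\<bar>v\<bar> powr \<alpha>\<close> is not.\<close>

lemma
  assumes f: "integrable lborel f" "f \<in> bcontfun" and e: "\<epsilon> > 0"
  shows Riesz_truncation_bcontfun: "Riesz_truncation \<alpha> j \<epsilon> f \<in> bcontfun"
    and Riesz_truncation_integrable: "integrable lborel (Riesz_truncation \<alpha> j \<epsilon> f)"
    and fourier_Riesz_truncation:
      "fourier (Riesz_truncation \<alpha> j \<epsilon> f) v = complex_of_real (Riesz_multiplier \<alpha> j \<epsilon> v) * fourier f v"
    and Riesz_multiplier_bounded: "\<exists>K. \<forall>v. Riesz_multiplier \<alpha> j \<epsilon> v \<le> K"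
proof -
  define w0 where "w0 u = indicator {\<epsilon>..} u * u powr - (1 + \<alpha>)" for u :: real
  define w where "w u = complex_of_real (w0 u)" for u
  have w0: "integrable lborel w0"
    using set_integrable_powr_atLeast[of "- (1 + \<alpha>)" \<epsilon>] \<alpha> e by (simp add: w0_def[abs_def] set_integrable_def)
  then have w: "integrable lborel w" unfolding w_def by simp
  define c where "c k = complex_of_real (1 / Riesz_const \<alpha> j) * ((-1) ^ k * of_nat ((2 * j) choose k))" for k
  define A where "A k x = (LINT u|lborel. f (x + (real j - real k) * u) * w u)" for k x
  have T: "Riesz_truncation \<alpha> j \<epsilon> f = (\<lambda>x. \<Sum>k\<le>2 * j. c k * A k x)"
  proof
    fix x
    have "(LINT u:{\<epsilon>..}|lborel. central_diff j u f x / complex_of_real (u powr (1 + \<alpha>)))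
      = (LINT u|lborel. (\<Sum>k\<le>2 * j. ((-1) ^ k * of_nat ((2 * j) choose k)) * (f (x + (real j - real k) * u) * w u)))"
      unfolding set_lebesgue_integral_def central_diff_def
    proof (intro Bochner_Integration.integral_cong refl)
      fix u :: real
      have "u powr - (1 + \<alpha>) = inverse (u powr (1 + \<alpha>))" by (rule powr_minus)
      then have *: "complex_of_real (indicator {\<epsilon>..} u) / complex_of_real (u powr (1 + \<alpha>)) = w u"
        by (simp add: w_def w0_def field_simps)
      show "indicator {\<epsilon>..} u *\<^sub>R ((\<Sum>k\<le>2 * j. (- 1) ^ k * of_nat (2 * j choose k) * f (x + (real j - real k) * u)) / complex_of_real (u powr (1 + \<alpha>)))
        = (\<Sum>k\<le>2 * j. ((-1) ^ k * of_nat ((2 * j) choose k)) * (f (x + (real j - real k) * u) * w u))"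
        unfolding *[symmetric] scaleR_conv_of_real
        by (simp add: sum_distrib_left sum_divide_distrib mult_ac)
    qed
    also have "\<dots> = (\<Sum>k\<le>2 * j. ((-1) ^ k * of_nat ((2 * j) choose k)) * A k x)"
      unfolding A_def
      by (subst Bochner_Integration.integral_sum) (auto intro!: integrable_mult_right integrable_bcontfun_mult f w)
    finally show "Riesz_truncation \<alpha> j \<epsilon> f x = (\<Sum>k\<le>2 * j. c k * A k x)"
      unfolding Riesz_truncation_def c_def by (simp add: sum_distrib_left mult.assoc)
  qed
  have Ab: "A k \<in> bcontfun" for k unfolding A_def by (rule smear_bcontfun[OF f w])
  have Ai: "integrable lborel (A k)" for k unfolding A_def by (rule smear_integrable[OF f w])
  have AF: "fourier (A k) v = fourier f v *
    (LINT u|lborel. exp (\<i> * complex_of_real ((real j - real k) * u) * complex_of_real v) * w u)" for k v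
    unfolding A_def by (rule fourier_smear[OF f w])
  show "Riesz_truncation \<alpha> j \<epsilon> f \<in> bcontfun"
  proof -
    have "\<forall>k. \<exists>M. \<forall>x. norm (A k x) \<le> M" using bcontfun_bound[OF Ab] by metis
    then obtain M where M: "\<And>k x. norm (A k x) \<le> M k" by metis
    show ?thesis
      unfolding T
    proof (rule bcontfun_normI)
      show "continuous_on UNIV (\<lambda>x. \<Sum>k\<le>2 * j. c k * A k x)"
        using Ab by (intro continuous_intros) (auto simp: bcontfun_def)
      show "norm (\<Sum>k\<le>2 * j. c k * A k x) \<le> (\<Sum>k\<le>2 * j. norm (c k) * M k)" for x
        using M by (intro sum_norm_le) (auto simp: norm_mult intro!: mult_left_mono)
    qed
  qed
  show "integrable lborel (Riesz_truncation \<alpha> j \<epsilon> f)"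
    unfolding T using Ai by auto
  have eint: "integrable lborel (\<lambda>u. exp (\<i> * complex_of_real (d * u) * complex_of_real v) * w u)" for d v
    using integrable_mult_unimodular[OF w, of "\<lambda>u. exp (\<i> * complex_of_real (d * u) * complex_of_real v)"]
    by (simp add: mult.commute)
  have sym: "(\<Sum>k\<le>2 * j. c k * (LINT u|lborel. exp (\<i> * complex_of_real ((real j - real k) * u) * complex_of_real v) * w u))
     = complex_of_real (Riesz_multiplier \<alpha> j \<epsilon> v)" for v
  proof -
    have "(\<Sum>k\<le>2 * j. c k * (LINT u|lborel. exp (\<i> * complex_of_real ((real j - real k) * u) * complex_of_real v) * w u))
      = (LINT u|lborel. (\<Sum>k\<le>2 * j. c k * (exp (\<i> * complex_of_real ((real j - real k) * u) * complex_of_real v) * w u)))"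
      by (subst Bochner_Integration.integral_sum; (rule integrable_mult_right, rule eint | simp))
    also have "\<dots> = (LINT u|lborel. complex_of_real (1 / Riesz_const \<alpha> j) *
        complex_of_real ((-1) ^ j * (2 * sin (u * v / 2)) ^ (2 * j) * w0 u))"
    proof (intro Bochner_Integration.integral_cong refl)
      fix u
      have "(\<Sum>k\<le>2 * j. c k * (exp (\<i> * complex_of_real ((real j - real k) * u) * complex_of_real v) * w u))
        = complex_of_real (1 / Riesz_const \<alpha> j) * ((\<Sum>k\<le>2 * j. (-1) ^ k * of_nat ((2 * j) choose k) * exp (\<i> * complex_of_real ((real j - real k) * u) * complex_of_real v)) * w u)"
        unfolding c_def sum_distrib_left sum_distrib_right by (simp only: mult_ac)
      then show "(\<Sum>k\<le>2 * j. c k * (exp (\<i> * complex_of_real ((real j - real k) * u) * complex_of_real v) * w u))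
        = complex_of_real (1 / Riesz_const \<alpha> j) * complex_of_real ((-1) ^ j * (2 * sin (u * v / 2)) ^ (2 * j) * w0 u)"
        unfolding central_diff_symbol by (simp add: w_def)
    qed
    also have "\<dots> = complex_of_real (1 / Riesz_const \<alpha> j) * complex_of_real (Riesz_const \<alpha> j * Riesz_multiplier \<alpha> j \<epsilon> v)"
      unfolding integral_mult_right_zero integral_complex_of_real w0_def Riesz_multiplier_eq[OF e] ..
    finally show ?thesis using Riesz_const_nonzero by simp
  qed
  show "fourier (Riesz_truncation \<alpha> j \<epsilon> f) v = complex_of_real (Riesz_multiplier \<alpha> j \<epsilon> v) * fourier f v"
    unfolding T sym[symmetric]
    by (subst fourier_sum) (use Ai in \<open>auto simp: fourier_cmult AF sum_distrib_left sum_distrib_right mult_ac\<close>)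
  have "Riesz_multiplier \<alpha> j \<epsilon> v \<le> (\<Sum>k\<le>2 * j. norm (c k) * (LINT u|lborel. norm (w u)))" for v
  proof -
    have "Riesz_multiplier \<alpha> j \<epsilon> v \<le> norm (complex_of_real (Riesz_multiplier \<alpha> j \<epsilon> v))" by simp
    also have "\<dots> \<le> (\<Sum>k\<le>2 * j. norm (c k) * (LINT u|lborel. norm (w u)))"
      unfolding sym[symmetric]
    proof (rule sum_norm_le)
      fix k
      have "norm (LINT u|lborel. exp (\<i> * complex_of_real ((real j - real k) * u) * complex_of_real v) * w u)
         \<le> (LINT u|lborel. norm (exp (\<i> * complex_of_real ((real j - real k) * u) * complex_of_real v) * w u))"
        by (rule integral_norm_bound)
      also have "\<dots> = (LINT u|lborel. norm (w u))"
        by (simp add: norm_mult)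
      finally show "norm (c k * (LINT u|lborel. exp (\<i> * complex_of_real ((real j - real k) * u) * complex_of_real v) * w u))
         \<le> norm (c k) * (LINT u|lborel. norm (w u))"
        by (simp add: norm_mult mult_left_mono)
    qed
    finally show ?thesis .
  qed
  then show "\<exists>K. \<forall>v. Riesz_multiplier \<alpha> j \<epsilon> v \<le> K" by blast
qed

end

section \<open>The Fourier transform of the strong Riesz derivative\<close>

lemma L1_bcontfun_L2:
  assumes "integrable lborel f" "f \<in> bcontfun"
  shows "f \<in> L2"
proof -
  obtain M where M: "M \<ge> 0" "\<And>x. norm (f x) \<le> M" using bcontfun_bound[OF assms(2)] by blast
  have [measurable]: "f \<in> borel_measurable borel" using assms(1) by auto
  have "integrable lborel (\<lambda>x. (norm (f x))\<^sup>2)"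
  proof (rule Bochner_Integration.integrable_bound)
    show "integrable lborel (\<lambda>x. M *\<^sub>R f x)" using assms(1) by auto
    show "AE x in lborel. norm ((norm (f x))\<^sup>2) \<le> norm (M *\<^sub>R f x)"
      using M by (auto simp: power2_eq_square intro!: mult_right_mono)
  qed measurable
  then show ?thesis by (simp add: L2_def)
qed

lemma integral_norm_diff_commute:
  "(LINT x|M. (norm (f x - g x))\<^sup>2) = (LINT x|M. (norm (g x - f x :: complex))\<^sup>2)"
  by (simp add: norm_minus_commute)

text \<open>The multiplier lies between 0 and its limit \<open>\<bar>v\<bar> powr \<alpha>\<close>,
  so the error is dominated by the limit function itself, which is square integrable. Pointwise
  convergence is that of the tails to the full integral.\<close>

lemma Riesz_truncation_symbol_tendsto:
  assumes \<alpha>: "0 < \<alpha>" "\<alpha> < 2 * real j" and F: "F \<in> borel_measurable borel"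
    and G: "(\<lambda>v. complex_of_real (\<bar>v\<bar> powr \<alpha>) * F v) \<in> L2"
    and m: "\<And>\<epsilon>. \<epsilon> > 0 \<Longrightarrow> (\<lambda>v. complex_of_real (Riesz_multiplier \<alpha> j \<epsilon> v) * F v) \<in> borel_measurable borel"
  defines "D \<equiv> \<lambda>\<epsilon> v. complex_of_real (Riesz_multiplier \<alpha> j \<epsilon> v) * F v - complex_of_real (\<bar>v\<bar> powr \<alpha>) * F v"
  shows "\<epsilon> > 0 \<Longrightarrow> D \<epsilon> \<in> L2"
    and "((\<lambda>\<epsilon>. LINT v|lborel. (norm (D \<epsilon> v))\<^sup>2) \<longlongrightarrow> 0) (at_right 0)"
proof -
  let ?G = "\<lambda>v. complex_of_real (\<bar>v\<bar> powr \<alpha>) * F v"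
  have bound: "norm (D \<epsilon> v) \<le> norm (?G v)" if "\<epsilon> > 0" for \<epsilon> v
  proof -
    have "norm (D \<epsilon> v) = \<bar>Riesz_multiplier \<alpha> j \<epsilon> v - \<bar>v\<bar> powr \<alpha>\<bar> * norm (F v)"
      unfolding D_def left_diff_distrib[symmetric] norm_mult of_real_diff[symmetric] norm_of_real ..
    also have "\<dots> \<le> \<bar>v\<bar> powr \<alpha> * norm (F v)"
      using Riesz_multiplier_bounds[OF \<alpha>, of \<epsilon> v] that by (intro mult_right_mono) auto
    finally show ?thesis by (simp add: norm_mult)
  qed
  have bound2: "(norm (D \<epsilon> v))\<^sup>2 \<le> (norm (?G v))\<^sup>2" if "\<epsilon> > 0" for \<epsilon> v
    using bound[OF that] by (intro power_mono) auto
  have Gint: "integrable lborel (\<lambda>v. (norm (?G v))\<^sup>2)" using G by (simp add: L2_def)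
  have [measurable]: "D \<epsilon> \<in> borel_measurable borel" if "\<epsilon> > 0" for \<epsilon>
    unfolding D_def using m[OF that] L2_measurable[OF G] by measurable
  show "D \<epsilon> \<in> L2" if "\<epsilon> > 0"
    unfolding L2_def
  proof (intro CollectI conjI)
    show "D \<epsilon> \<in> borel_measurable lborel" using that by simp
    show "integrable lborel (\<lambda>v. (norm (D \<epsilon> v))\<^sup>2)"
      by (rule Bochner_Integration.integrable_bound[OF Gint]) (use that bound2[OF that] in auto)
  qed
  show "((\<lambda>\<epsilon>. LINT v|lborel. (norm (D \<epsilon> v))\<^sup>2) \<longlongrightarrow> 0) (at_right 0)"
    unfolding tendsto_at_iff_sequentially comp_def
  proof (intro allI impI)
    fix X :: "nat \<Rightarrow> real" assume X: "\<forall>i. X i \<in> {0<..} - {0}" "X \<longlonglongrightarrow> 0"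
    then have X0: "X i > 0" for i by auto
    have "(\<lambda>i. LINT v|lborel. (norm (D (X i) v))\<^sup>2) \<longlonglongrightarrow> (LINT v::real|lborel. 0)"
    proof (rule integral_dominated_convergence[OF _ _ Gint])
      show "AE v in lborel. norm ((norm (D (X i) v))\<^sup>2) \<le> (norm (?G v))\<^sup>2" for i
        using bound2[OF X0] by simp
      show "AE v in lborel. (\<lambda>i. (norm (D (X i) v))\<^sup>2) \<longlonglongrightarrow> 0"
      proof (intro AE_I2)
        fix v
        have "(\<lambda>i. X i * \<bar>v\<bar> / 2) \<longlonglongrightarrow> 0 * \<bar>v\<bar> / 2" by (intro tendsto_intros X(2)) auto
        then have "(\<lambda>i. Riesz_tail \<alpha> j (X i * \<bar>v\<bar> / 2)) \<longlonglongrightarrow> Riesz_tail \<alpha> j 0"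
          using X0 by (intro Riesz_tail_tendsto[OF \<alpha>]) (auto simp: less_imp_le)
        then have "(\<lambda>i. (norm (D (X i) v))\<^sup>2) \<longlonglongrightarrow> (norm (complex_of_real (\<bar>v\<bar> powr \<alpha> *
            (Riesz_tail \<alpha> j 0 / Riesz_tail \<alpha> j 0)) * F v - ?G v))\<^sup>2"
          unfolding D_def Riesz_multiplier_def using Riesz_tail_pos[OF \<alpha>] by (intro tendsto_intros) auto
        then show "(\<lambda>i. (norm (D (X i) v))\<^sup>2) \<longlonglongrightarrow> 0"
          using Riesz_tail_pos[OF \<alpha>] by simp
      qed
    qed (use X0 in auto)
    then show "(\<lambda>i. LINT v|lborel. (norm (D (X i) v))\<^sup>2) \<longlonglongrightarrow> 0" by simp
  qed
qed

context
  fixes \<alpha> :: real and j :: nat and f :: "real \<Rightarrow> complex"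
  assumes \<alpha>: "0 < \<alpha>" "\<alpha> < 2 * real j"
    and f: "integrable lborel f" "f \<in> bcontfun" and Fint: "integrable lborel (fourier f)"
    and G: "(\<lambda>v. complex_of_real (\<bar>v\<bar> powr \<alpha>) * fourier f v) \<in> L2"
begin

abbreviation "symbol_error \<epsilon> \<equiv> LINT v|lborel. (norm (complex_of_real (Riesz_multiplier \<alpha> j \<epsilon> v) * fourier f v
    - complex_of_real (\<bar>v\<bar> powr \<alpha>) * fourier f v))\<^sup>2"

lemma fourier_trunc_fun:
  "\<epsilon> > 0 \<Longrightarrow> fourier (Riesz_truncation \<alpha> j \<epsilon> f) = (\<lambda>v. complex_of_real (Riesz_multiplier \<alpha> j \<epsilon> v) * fourier f v)"
  using fourier_Riesz_truncation[OF \<alpha> f] by auto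

lemma symbol_measurable:
  "\<epsilon> > 0 \<Longrightarrow> (\<lambda>v. complex_of_real (Riesz_multiplier \<alpha> j \<epsilon> v) * fourier f v) \<in> borel_measurable borel"
  using borel_measurable_fourier[OF Riesz_truncation_integrable[OF \<alpha> f]] fourier_trunc_fun by simp

lemmas symbol_error_L2 = Riesz_truncation_symbol_tendsto(1)[OF \<alpha> borel_measurable_fourier[OF f(1)] G symbol_measurable]
lemmas symbol_error_tendsto = Riesz_truncation_symbol_tendsto(2)[OF \<alpha> borel_measurable_fourier[OF f(1)] G symbol_measurable]

text \<open>For fixed \<epsilon> the symbol is bounded and \<open>fourier f\<close> is integrable.
  Inversion for the truncations rests on this.\<close>

lemma fourier_Riesz_truncation_integrable:
  assumes "\<epsilon> > 0"
  shows "integrable lborel (fourier (Riesz_truncation \<alpha> j \<epsilon> f))"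
proof -
  obtain K where K: "\<And>v. Riesz_multiplier \<alpha> j \<epsilon> v \<le> K"
    using Riesz_multiplier_bounded[OF \<alpha> f assms] by blast
  show ?thesis
    unfolding fourier_trunc_fun[OF assms]
  proof (rule Bochner_Integration.integrable_bound)
    show "integrable lborel (\<lambda>v. K *\<^sub>R fourier f v)" using Fint by auto
    show "AE v in lborel. norm (complex_of_real (Riesz_multiplier \<alpha> j \<epsilon> v) * fourier f v) \<le> norm (K *\<^sub>R fourier f v)"
    proof (intro AE_I2)
      fix v
      have "\<bar>Riesz_multiplier \<alpha> j \<epsilon> v\<bar> \<le> \<bar>K\<bar>"
        using K[of v] Riesz_multiplier_bounds(1)[OF \<alpha>, of \<epsilon> v] assms by simp
      then show "norm (complex_of_real (Riesz_multiplier \<alpha> j \<epsilon> v) * fourier f v) \<le> norm (K *\<^sub>R fourier f v)"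
        by (simp add: norm_mult mult_right_mono)
    qed
  qed (use symbol_measurable[OF assms] in simp)
qed

text \<open>The Plancherel inequality is applied to the transform of the difference, which inversion maps
  back to the difference; equality in Plancherel's theorem is never needed.\<close>
lemma Riesz_truncation_diff_le:
  assumes e: "\<epsilon> > 0" "\<delta> > 0"
  shows "(LINT x|lborel. (norm (Riesz_truncation \<alpha> j \<epsilon> f x - Riesz_truncation \<alpha> j \<delta> f x))\<^sup>2)
     \<le> 2 * symbol_error \<epsilon> + 2 * symbol_error \<delta>"
proof -
  let ?T = "\<lambda>\<epsilon>. Riesz_truncation \<alpha> j \<epsilon> f"
  let ?G = "\<lambda>v. complex_of_real (\<bar>v\<bar> powr \<alpha>) * fourier f v"
  define D where "D x = ?T \<epsilon> x - ?T \<delta> x" for x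
  have Dint: "integrable lborel D"
    unfolding D_def using Riesz_truncation_integrable[OF \<alpha> f] e by auto
  have Db: "D \<in> bcontfun"
    unfolding D_def[abs_def] using Riesz_truncation_bcontfun[OF \<alpha> f] e by (intro minus_cont)
  have DF: "fourier D = (\<lambda>v. fourier (?T \<epsilon>) v - fourier (?T \<delta>) v)"
    unfolding D_def[abs_def] using Riesz_truncation_integrable[OF \<alpha> f] e by (intro ext fourier_diff) auto
  have DFint: "integrable lborel (fourier D)"
    unfolding DF using fourier_Riesz_truncation_integrable e by auto
  have DF': "fourier D = (\<lambda>v. (fourier (?T \<epsilon>) v - ?G v) - (fourier (?T \<delta>) v - ?G v))"
    unfolding DF by simp
  have L2: "(\<lambda>v. fourier (?T \<epsilon>) v - ?G v) \<in> L2" "(\<lambda>v. fourier (?T \<delta>) v - ?G v) \<in> L2"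
    using symbol_error_L2 e by (simp_all add: fourier_trunc_fun)
  have "(LINT x|lborel. (norm (D x))\<^sup>2) = (LINT x|lborel. (norm (fourier (fourier D) (0 + (-1) * x)))\<^sup>2)"
    using fourier_inversion[OF Dint Db DFint] by simp
  also have "\<dots> = (LINT x|lborel. (norm (fourier (fourier D) x))\<^sup>2)"
    by (subst lborel_integral_real_affine[where c="-1" and t=0 and f="\<lambda>x. (norm (fourier (fourier D) x))\<^sup>2"]) auto
  also have "\<dots> \<le> (LINT v|lborel. (norm (fourier D v))\<^sup>2)"
    unfolding DF' by (rule plancherel_le(2)) (use DFint[unfolded DF'] L2_diff[OF L2] in auto)
  also have "\<dots> \<le> 2 * symbol_error \<epsilon> + 2 * symbol_error \<delta>"
    unfolding DF' using L2_diff_le[OF L2] e by (simp add: fourier_trunc_fun)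
  finally show ?thesis by (simp add: D_def)
qed

text \<open>Justifies the choice operator in \<open>strong_Riesz_derivative\<close>. The symbol
  errors along 1 / (n + 1) provide the Cauchy bound for completeness, and the limit found along this
  sequence is then shown to be the limit as \<epsilon> tends to 0 from the right.\<close>

lemma has_strong_Riesz_derivative_exists:
  "\<exists>g. has_strong_Riesz_derivative \<alpha> j f g"
proof -
  let ?T = "\<lambda>\<epsilon>. Riesz_truncation \<alpha> j \<epsilon> f"
  define s where "s n = 1 / real (Suc n)" for n
  have s: "s n > 0" "s \<longlonglongrightarrow> 0" for n
    unfolding s_def using LIMSEQ_inverse_real_of_nat by (auto simp: inverse_eq_divide)
  have TL2: "?T \<epsilon> \<in> L2" if "\<epsilon> > 0" for \<epsilon>
    using that Riesz_truncation_integrable[OF \<alpha> f] Riesz_truncation_bcontfun[OF \<alpha> f] by (intro L1_bcontfun_L2)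
  have "filterlim s (at_right 0) sequentially"
    using s(2) by (auto simp: filterlim_at s_def)
  from filterlim_compose[OF symbol_error_tendsto this]
  have lim: "(\<lambda>n. symbol_error (s n)) \<longlonglongrightarrow> 0" by simp
  from tendsto_mult_right_zero[OF lim, of 2]
  obtain g where g: "g \<in> L2" "\<And>n. (LINT x|lborel. (norm (?T (s n) x - g x))\<^sup>2) \<le> 2 * symbol_error (s n)"
    using L2_complete[of "\<lambda>n. ?T (s n)" "\<lambda>n. 2 * symbol_error (s n)"] TL2[OF s(1)]
      Riesz_truncation_diff_le[OF s(1) s(1)] by blast
  \<comment> \<open>Passage from the sequence to all \<epsilon>: the truncation at
    \<open>s n\<close> is inserted between and n sent to infinity. The constants 4 and 8 result from
    iterating the squared triangle inequality.\<close>
  have le: "(LINT x|lborel. (norm (?T \<epsilon> x - g x))\<^sup>2) \<le> 4 * symbol_error \<epsilon>" if e: "\<epsilon> > 0" for \<epsilon>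
  proof -
    have *: "(LINT x|lborel. (norm (?T \<epsilon> x - g x))\<^sup>2) \<le> 4 * symbol_error \<epsilon> + 8 * symbol_error (s n)" for n
    proof -
      have "(LINT x|lborel. (norm ((?T \<epsilon> x - ?T (s n) x) - (g x - ?T (s n) x)))\<^sup>2)
        \<le> 2 * (LINT x|lborel. (norm (?T \<epsilon> x - ?T (s n) x))\<^sup>2) + 2 * (LINT x|lborel. (norm (g x - ?T (s n) x))\<^sup>2)"
        by (rule L2_diff_le) (intro L2_diff TL2 e s(1) g(1))+
      moreover have "(LINT x|lborel. (norm (g x - ?T (s n) x))\<^sup>2) \<le> 2 * symbol_error (s n)"
        using g(2)[of n] by (subst integral_norm_diff_commute)
      ultimately show ?thesis
        using Riesz_truncation_diff_le[OF e s(1), of n] by simp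
    qed
    have "(\<lambda>n. 4 * symbol_error \<epsilon> + 8 * symbol_error (s n)) \<longlonglongrightarrow> 4 * symbol_error \<epsilon> + 8 * 0"
      by (intro tendsto_intros lim)
    from LIMSEQ_le_const[OF this] * show ?thesis by auto
  qed
  have "tendsto_L2 ?T g (at_right 0)"
    unfolding tendsto_L2_iff
  proof
    show "\<forall>\<^sub>F \<epsilon> in at_right 0. (\<lambda>x. ?T \<epsilon> x - g x) \<in> L2"
      using eventually_at_right_less[of 0] by eventually_elim (intro L2_diff TL2 g(1))
    show "((\<lambda>\<epsilon>. LINT x|lborel. (norm (?T \<epsilon> x - g x))\<^sup>2) \<longlongrightarrow> 0) (at_right 0)"
    proof (rule tendsto_sandwich[OF _ _ tendsto_const])
      show "\<forall>\<^sub>F \<epsilon> in at_right 0. 0 \<le> (LINT x|lborel. (norm (?T \<epsilon> x - g x))\<^sup>2)" by simp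
      show "\<forall>\<^sub>F \<epsilon> in at_right 0. (LINT x|lborel. (norm (?T \<epsilon> x - g x))\<^sup>2) \<le> 4 * symbol_error \<epsilon>"
        using eventually_at_right_less[of 0] by eventually_elim (rule le)
      show "((\<lambda>\<epsilon>. 4 * symbol_error \<epsilon>) \<longlongrightarrow> 0) (at_right 0)"
        by (rule tendsto_mult_right_zero[OF symbol_error_tendsto]) simp
    qed
  qed
  then show ?thesis
    using \<alpha> L1_bcontfun_L2[OF f] g(1)
    unfolding has_strong_Riesz_derivative_def Riesz_truncation_def by blast
qed

text \<open>The derivative \<open>g\<close> is known only as an L2 limit of integrable truncations,
  and its transform only as an L2 limit of transforms of cut-offs. The Plancherel inequality is
  applied to cut-off minus truncation, which is integrable; the two limits are then taken one after
  the other.\<close>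

lemma strong_Riesz_derivative_L2_fourier:
  assumes "has_strong_Riesz_derivative \<alpha> j f g"
  shows "has_L2_fourier g (\<lambda>v. complex_of_real (\<bar>v\<bar> powr \<alpha>) * fourier f v)"
proof -
  let ?T = "\<lambda>\<epsilon>. Riesz_truncation \<alpha> j \<epsilon> f"
  let ?G = "\<lambda>v. complex_of_real (\<bar>v\<bar> powr \<alpha>) * fourier f v"
  have g: "g \<in> L2" and T: "tendsto_L2 ?T g (at_right 0)"
    using assms unfolding has_strong_Riesz_derivative_def Riesz_truncation_def by auto
  have [measurable]: "g \<in> borel_measurable borel" by (rule L2_measurable[OF g])
  have gint: "integrable lborel (\<lambda>x. (norm (g x))\<^sup>2)" using g by (simp add: L2_def)
  have TL2: "?T \<epsilon> \<in> L2" if "\<epsilon> > 0" for \<epsilon>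
    using that Riesz_truncation_integrable[OF \<alpha> f] Riesz_truncation_bcontfun[OF \<alpha> f] by (intro L1_bcontfun_L2)
  define gr where "gr r u = indicator {-r..r} u *\<^sub>R g u" for r u
  have gr_meas [measurable]: "gr r \<in> borel_measurable borel" for r unfolding gr_def by measurable
  have grL2: "gr r \<in> L2" for r
    unfolding L2_def
  proof (intro CollectI conjI)
    show "integrable lborel (\<lambda>x. (norm (gr r x))\<^sup>2)"
      by (rule Bochner_Integration.integrable_bound[OF gint]) (auto simp: gr_def indicator_def)
  qed simp
  \<comment> \<open>On a bounded interval a square integrable function is integrable, because |g|
    \<le> 1 + |g|^2.\<close>
  have grint: "integrable lborel (gr r)" for r
  proof (rule Bochner_Integration.integrable_bound)
    show "integrable lborel (\<lambda>x. indicator {-r..r} x + (norm (g x))\<^sup>2)"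
      using gint by (intro Bochner_Integration.integrable_add) (auto simp: integrable_indicator_iff emeasure_lborel_Icc_eq)
    have "norm (g x) \<le> 1 + (norm (g x))\<^sup>2" for x
      using sum_squares_bound[of "norm (g x)" 1] norm_ge_zero[of "g x"]
      unfolding power_one mult_1_right by linarith
    then show "AE x in lborel. norm (gr r x) \<le> norm (indicator {-r..r} x + (norm (g x))\<^sup>2)"
      by (auto simp: gr_def indicator_def)
  qed simp
  \<comment> \<open>A truncation at \<epsilon> is inserted: its transform is close to
    \<open>?G\<close> by the symbol error and it is itself close to \<open>g\<close>. Both
    contributions vanish as \<epsilon> tends to 0, leaving only the cut-off error.\<close>
  have bound: "(\<lambda>v. fourier (gr r) v - ?G v) \<in> L2 \<and>
    (LINT v|lborel. (norm (fourier (gr r) v - ?G v))\<^sup>2) \<le> 4 * (LINT x|lborel. (norm (gr r x - g x))\<^sup>2)" for r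
  proof -
    have L: "(\<lambda>v. fourier (gr r) v - ?G v) \<in> L2"
      by (intro L2_diff plancherel_le grint grL2 G)
    have *: "(LINT v|lborel. (norm (fourier (gr r) v - ?G v))\<^sup>2) \<le>
       4 * (LINT x|lborel. (norm (gr r x - g x))\<^sup>2) +
       (4 * (LINT x|lborel. (norm (?T \<epsilon> x - g x))\<^sup>2) + 2 * symbol_error \<epsilon>)"
      if e: "\<epsilon> > 0" for \<epsilon>
    proof -
      have d: "integrable lborel (\<lambda>x. gr r x - ?T \<epsilon> x)" "(\<lambda>x. gr r x - ?T \<epsilon> x) \<in> L2"
        using grint Riesz_truncation_integrable[OF \<alpha> f e] L2_diff[OF grL2 TL2[OF e]] by auto
      have dF: "fourier (\<lambda>x. gr r x - ?T \<epsilon> x) = (\<lambda>v. fourier (gr r) v - fourier (?T \<epsilon>) v)"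
        by (intro ext fourier_diff grint Riesz_truncation_integrable[OF \<alpha> f e])
      have TG: "(\<lambda>v. ?G v - fourier (?T \<epsilon>) v) \<in> L2"
        by (intro L2_diff G plancherel_le Riesz_truncation_integrable[OF \<alpha> f e] TL2 e)
      have "(LINT v|lborel. (norm (fourier (gr r) v - ?G v))\<^sup>2) =
        (LINT v|lborel. (norm ((fourier (gr r) v - fourier (?T \<epsilon>) v) - (?G v - fourier (?T \<epsilon>) v)))\<^sup>2)"
        by simp
      also have "\<dots> \<le> 2 * (LINT v|lborel. (norm (fourier (gr r) v - fourier (?T \<epsilon>) v))\<^sup>2) +
         2 * (LINT v|lborel. (norm (?G v - fourier (?T \<epsilon>) v))\<^sup>2)"
        using plancherel_le(1)[OF d] unfolding dF by (intro L2_diff_le TG)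
      also have "(LINT v|lborel. (norm (?G v - fourier (?T \<epsilon>) v))\<^sup>2) = symbol_error \<epsilon>"
        by (subst integral_norm_diff_commute) (simp add: fourier_trunc_fun[OF e])
      also have "(LINT v|lborel. (norm (fourier (gr r) v - fourier (?T \<epsilon>) v))\<^sup>2) \<le>
         (LINT x|lborel. (norm (gr r x - ?T \<epsilon> x))\<^sup>2)"
        using plancherel_le(2)[OF d] unfolding dF .
      also have "(LINT x|lborel. (norm (gr r x - ?T \<epsilon> x))\<^sup>2) =
          (LINT x|lborel. (norm ((gr r x - g x) - (?T \<epsilon> x - g x)))\<^sup>2)" by simp
      also have "\<dots> \<le> 2 * (LINT x|lborel. (norm (gr r x - g x))\<^sup>2) + 2 * (LINT x|lborel. (norm (?T \<epsilon> x - g x))\<^sup>2)"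
        by (intro L2_diff_le L2_diff grL2 g TL2 e)
      finally show ?thesis by simp
    qed
    have "((\<lambda>\<epsilon>. 4 * (LINT x|lborel. (norm (gr r x - g x))\<^sup>2) +
       (4 * (LINT x|lborel. (norm (?T \<epsilon> x - g x))\<^sup>2) + 2 * symbol_error \<epsilon>)) \<longlongrightarrow>
       4 * (LINT x|lborel. (norm (gr r x - g x))\<^sup>2) + (4 * 0 + 2 * 0)) (at_right 0)"
      using T[unfolded tendsto_L2_iff] by (intro tendsto_intros symbol_error_tendsto) auto
    moreover have "\<forall>\<^sub>F \<epsilon> in at_right 0. (LINT v|lborel. (norm (fourier (gr r) v - ?G v))\<^sup>2) \<le>
       4 * (LINT x|lborel. (norm (gr r x - g x))\<^sup>2) +
       (4 * (LINT x|lborel. (norm (?T \<epsilon> x - g x))\<^sup>2) + 2 * symbol_error \<epsilon>)"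
      using eventually_at_right_less[of 0] by eventually_elim (rule *)
    ultimately have "(LINT v|lborel. (norm (fourier (gr r) v - ?G v))\<^sup>2) \<le>
       4 * (LINT x|lborel. (norm (gr r x - g x))\<^sup>2) + (4 * 0 + 2 * 0)"
      by (rule tendsto_lowerbound) simp
    then show ?thesis using L by simp
  qed
  have lim: "((\<lambda>r. LINT x|lborel. (norm (gr r x - g x))\<^sup>2) \<longlongrightarrow> (LINT x::real|lborel. 0)) at_top"
  proof (rule integral_dominated_convergence_at_top[OF _ _ gint])
    show "AE x in lborel. ((\<lambda>r. (norm (gr r x - g x))\<^sup>2) \<longlongrightarrow> 0) at_top"
    proof (intro AE_I2 tendsto_eventually)
      fix x
      show "\<forall>\<^sub>F r in at_top. (norm (gr r x - g x))\<^sup>2 = 0"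
        using eventually_ge_at_top[of "\<bar>x\<bar>"] by eventually_elim (auto simp: gr_def indicator_def)
    qed
    show "\<forall>\<^sub>F r in at_top. AE x in lborel. norm ((norm (gr r x - g x))\<^sup>2) \<le> (norm (g x))\<^sup>2"
      by (intro always_eventually allI AE_I2) (auto simp: gr_def indicator_def)
  qed measurable
  have "tendsto_L2 (\<lambda>r. fourier (gr r)) ?G at_top"
    unfolding tendsto_L2_iff
  proof
    show "\<forall>\<^sub>F r in at_top. (\<lambda>v. fourier (gr r) v - ?G v) \<in> L2" using bound by simp
    show "((\<lambda>r. LINT v|lborel. (norm (fourier (gr r) v - ?G v))\<^sup>2) \<longlongrightarrow> 0) at_top"
    proof (rule tendsto_sandwich[OF _ _ tendsto_const])
      show "\<forall>\<^sub>F r in at_top. (LINT v|lborel. (norm (fourier (gr r) v - ?G v))\<^sup>2) \<le> 4 * (LINT x|lborel. (norm (gr r x - g x))\<^sup>2)"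
        using bound by simp
      show "((\<lambda>r. 4 * (LINT x|lborel. (norm (gr r x - g x))\<^sup>2)) \<longlongrightarrow> 0) at_top"
        using tendsto_mult_right_zero[OF lim[simplified]] by simp
    qed simp
  qed
  then show ?thesis
    using g G unfolding has_L2_fourier_def gr_def[abs_def] by simp
qed

end

lemma fourier_Cb_strong_Riesz_derivative:
  assumes \<alpha>: "0 < \<alpha>" and f: "integrable lborel f" "f \<in> bcontfun" "integrable lborel (fourier f)"
    and G: "(\<lambda>v. complex_of_real (\<bar>v\<bar> powr \<alpha>) * fourier f v) \<in> L2 \<inter> bcontfun"
  shows "fourier_Cb (strong_Riesz_derivative \<alpha> f) = (\<lambda>v. complex_of_real (\<bar>v\<bar> powr \<alpha>) * fourier f v)"
proof -
  obtain j :: nat where "real j > \<alpha>" using reals_Archimedean2 by blast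
  then have "\<alpha> < 2 * real j" using \<alpha> by simp
  then have "\<exists>g j. has_strong_Riesz_derivative \<alpha> j f g"
    using has_strong_Riesz_derivative_exists[OF \<alpha> _ f] G by blast
  then have "\<exists>j. has_strong_Riesz_derivative \<alpha> j f (strong_Riesz_derivative \<alpha> f)"
    unfolding strong_Riesz_derivative_def by (rule someI_ex)
  \<comment> \<open>The choice operator fixes some difference order not known to be the one used for
    existence; the transform formula holds for every admissible order, so the new one is used from
    here on.\<close>
  then obtain j where j: "has_strong_Riesz_derivative \<alpha> j f (strong_Riesz_derivative \<alpha> f)" by blast
  then have "\<alpha> < 2 * real j" by (simp add: has_strong_Riesz_derivative_def)
  from strong_Riesz_derivative_L2_fourier[OF \<alpha> this f _ j] G
  show ?thesis by (intro fourier_Cb_eqI) auto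
qed

section \<open>Tauberian theorem and Fejer kernel\<close>

lemma sum_symmetric_Suc:
  fixes a :: "int \<Rightarrow> 'a :: comm_monoid_add"
  shows "(\<Sum>k\<in>{- int (Suc n)..int (Suc n)}. a k) =
     (\<Sum>k\<in>{- int n..int n}. a k) + (a (int n + 1) + a (- int n - 1))"
proof -
  have "{- int (Suc n)..int (Suc n)} = insert (int n + 1) (insert (- int n - 1) {- int n..int n})"
    by auto
  then show ?thesis by (simp add: ac_simps)
qed

lemma sum_symmetric_conv:
  fixes a :: "int \<Rightarrow> 'a :: comm_monoid_add"
  shows "(\<Sum>k\<in>{- int n..int n}. a k) = a 0 + (\<Sum>i<n. a (int i + 1) + a (- int i - 1))"
proof (induction n)
  case (Suc n)
  show ?case unfolding sum_symmetric_Suc Suc by (simp add: ac_simps)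
qed simp

text \<open>An integer k with |k| < N occurs N - |k| times on either side; the induction step adds
  row N and column N. For exponentials it identifies the squared modulus of a geometric sum with a
  sum of Dirichlet kernels.\<close>

lemma sum_differences_eq:
  fixes a :: "int \<Rightarrow> 'a :: comm_monoid_add"
  shows "(\<Sum>m<N. \<Sum>n<N. a (int m - int n)) = (\<Sum>n<N. \<Sum>k\<in>{- int n..int n}. a k)"
proof (induction N)
  case (Suc N)
  have r: "(\<Sum>i<N. a (int i - int N)) = (\<Sum>i<N. a (- int i - 1))"
    using sum.nat_diff_reindex[of "\<lambda>i. a (- int i - 1)" N] by (simp add: of_nat_diff algebra_simps)
  have r': "(\<Sum>i<N. a (int N - int i)) = (\<Sum>i<N. a (int i + 1))"
    using sum.nat_diff_reindex[of "\<lambda>i. a (int i + 1)" N] by (simp add: of_nat_diff algebra_simps)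
  show ?case
    by (simp add: sum.distrib Suc r r' sum_symmetric_conv[of a N] ac_simps)
qed simp

text \<open>Compare \<open>s N\<close> with the average of \<open>s\<close> over the block \<open>{N..N + N div q}\<close>, which is a
  combination of two Cesaro means with bounded weights.\<close>
lemma cesaro_slowly_oscillating:
  fixes s :: "nat \<Rightarrow> complex"
  assumes cesaro: "(\<lambda>N. (\<Sum>n<N. s n) / of_nat N) \<longlonglongrightarrow> L"
    and slow: "\<And>\<epsilon>. \<epsilon> > 0 \<Longrightarrow> \<exists>q>0. \<exists>N0. \<forall>N\<ge>N0. \<forall>n\<in>{N..N + N div q}. norm (s n - s N) \<le> \<epsilon>"
  shows "s \<longlonglongrightarrow> L"
proof (rule LIMSEQ_I)
  fix \<epsilon> :: real assume \<epsilon>: "\<epsilon> > 0"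
  have "\<epsilon> / 2 > 0" using \<epsilon> by simp
  from slow[OF this] obtain q N0 where q: "q > 0"
    and *: "\<forall>N\<ge>N0. \<forall>n\<in>{N..N + N div q}. norm (s n - s N) \<le> \<epsilon> / 2" by blast
  have N0: "norm (s n - s N) \<le> \<epsilon> / 2" if "N \<ge> N0" "n \<in> {N..N + N div q}" for N n
    using * that by blast
  \<comment> \<open>The two Cesaro errors together cost at most 4 * q * d * \<delta> = d *
    4\<epsilon>/10, which with the oscillation d * \<epsilon>/2 stays below d * \<epsilon>.\<close>
  define \<delta> where "\<delta> = \<epsilon> / (10 * real q)"
  have \<delta>: "\<delta> > 0" using \<epsilon> q by (simp add: \<delta>_def)
  obtain N1 where N1: "\<And>N. N \<ge> N1 \<Longrightarrow> norm ((\<Sum>n<N. s n) / of_nat N - L) < \<delta>"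
    using LIMSEQ_D[OF cesaro \<delta>] by auto
  have "norm (s N - L) < \<epsilon>" if N: "N \<ge> max 1 (max N0 N1)" for N
  proof -
    define d where "d = N div q + 1"
    have N': "N \<ge> N0" "N \<ge> N1" "N + d \<ge> N1" "N > 0" using N by auto
    have dq: "real N \<le> real q * real d"
    proof -
      have "q * (N div q) + N mod q = N" "N mod q < q" using q by auto
      moreover have "q * d = q * (N div q) + q" by (simp add: d_def)
      ultimately have "N \<le> q * d" by linarith
      then show ?thesis by (simp flip: of_nat_mult)
    qed
    have dN: "real d \<le> real N + 1" by (simp add: d_def)
    have d0: "real d > 0" by (simp add: d_def)
    have cs: "norm ((\<Sum>n<M. s n) - of_nat M * L) \<le> real M * \<delta>" if "M \<ge> N1" "M > 0" for M
    proof -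
      have "(\<Sum>n<M. s n) - of_nat M * L = of_nat M * ((\<Sum>n<M. s n) / of_nat M - L)"
        using that by (simp add: field_simps)
      then show ?thesis using N1[OF that(1)] by (simp add: norm_mult mult_left_mono less_imp_le)
    qed
    have split: "(\<Sum>n<N + d. s n) = (\<Sum>n<N. s n) + (\<Sum>i<d. s (N + i))"
      by (induction d) (simp_all add: ac_simps)
    have "of_nat d * (s N - L) = ((\<Sum>n<N + d. s n) - of_nat (N + d) * L) - ((\<Sum>n<N. s n) - of_nat N * L)
       - (\<Sum>i<d. s (N + i) - s N)"
      by (simp add: split sum_subtractf algebra_simps)
    also have "norm \<dots> \<le> norm ((\<Sum>n<N + d. s n) - of_nat (N + d) * L) + norm ((\<Sum>n<N. s n) - of_nat N * L)
       + norm (\<Sum>i<d. s (N + i) - s N)"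
      by (intro order_trans[OF norm_triangle_ineq4] add_mono norm_triangle_ineq4) auto
    also have "\<dots> \<le> real (N + d) * \<delta> + real N * \<delta> + real d * (\<epsilon> / 2)"
    proof (intro add_mono cs)
      have "norm (\<Sum>i<d. s (N + i) - s N) \<le> (\<Sum>i<d. \<epsilon> / 2)"
        by (intro sum_norm_le N0) (use N' in \<open>auto simp: d_def\<close>)
      then show "norm (\<Sum>i<d. s (N + i) - s N) \<le> real d * (\<epsilon> / 2)" by simp
    qed (use N' in auto)
    also have "real (N + d) * \<delta> + real N * \<delta> = (2 * real N + real d) * \<delta>" by (simp add: algebra_simps)
    also have "\<dots> \<le> (4 * (real q * real d)) * \<delta>"
    proof (intro mult_right_mono)
      have "1 \<le> real N" using N' by simp
      then show "2 * real N + real d \<le> 4 * (real q * real d)" using dq dN by linarith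
    qed (use \<delta> in simp)
    also have "(4 * (real q * real d)) * \<delta> = real d * (4 * \<epsilon> / 10)" using q by (simp add: \<delta>_def)
    finally have "real d * norm (s N - L) \<le> real d * (4 * \<epsilon> / 10 + \<epsilon> / 2)"
      by (simp only: norm_mult norm_of_nat distrib_left)
    then have "norm (s N - L) \<le> 4 * \<epsilon> / 10 + \<epsilon> / 2" using d0 by simp
    then show ?thesis using \<epsilon> by simp
  qed
  then show "\<exists>no. \<forall>n\<ge>no. norm (s n - L) < \<epsilon>" by blast
qed

text \<open>A Cauchy sequence satisfies the oscillation condition with q = 1, so its limit and its
  Cesaro limit agree.\<close>

lemma cesaro_convergent:
  fixes s :: "nat \<Rightarrow> complex"
  assumes "(\<lambda>N. (\<Sum>n<N. s n) / of_nat N) \<longlonglongrightarrow> L" "convergent s"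
  shows "s \<longlonglongrightarrow> L"
proof (rule cesaro_slowly_oscillating[OF assms(1)])
  fix \<epsilon> :: real assume \<epsilon>: "\<epsilon> > 0"
  have "Cauchy s" using assms(2) by (simp add: Cauchy_convergent_iff)
  from CauchyD[OF this \<epsilon>] obtain M where "\<forall>m\<ge>M. \<forall>n\<ge>M. norm (s m - s n) < \<epsilon>" by blast
  then show "\<exists>q>0. \<exists>N0. \<forall>N\<ge>N0. \<forall>n\<in>{N..N + N div q}. norm (s n - s N) \<le> \<epsilon>"
    by (intro exI[of _ 1] conjI exI[of _ M]) (auto intro: less_imp_le)
qed

text \<open>Hardy's Tauberian theorem for symmetric sums. Between N and N + N div q the sum gains at
  most N / q pairs of terms, each term of norm at most C / N, hence changes by at most 2C /
  q.\<close>

lemma cesaro_hardy: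
  fixes a :: "int \<Rightarrow> complex"
  assumes "(\<lambda>N. (\<Sum>n<N. \<Sum>k\<in>{- int n..int n}. a k) / of_nat N) \<longlonglongrightarrow> L"
    and C: "\<And>k. \<bar>real_of_int k\<bar> * norm (a k) \<le> C"
  shows "(\<lambda>n. \<Sum>k\<in>{- int n..int n}. a k) \<longlonglongrightarrow> L"
proof (rule cesaro_slowly_oscillating[OF assms(1)])
  fix \<epsilon> :: real assume \<epsilon>: "\<epsilon> > 0"
  let ?s = "\<lambda>n. \<Sum>k\<in>{- int n..int n}. a k"
  have C0: "C \<ge> 0" using C[of 0] by simp
  obtain q0 :: nat where q0: "real q0 > 2 * C / \<epsilon>" using reals_Archimedean2 by blast
  define q where "q = Suc q0"
  have q: "q > 0" "2 * C / real q \<le> \<epsilon>"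
  proof -
    have "2 * C < \<epsilon> * real q0" using q0 \<epsilon> by (simp add: field_simps)
    also have "\<dots> \<le> \<epsilon> * real q" using \<epsilon> by (simp add: q_def)
    finally show "2 * C / real q \<le> \<epsilon>" by (simp add: q_def field_simps)
  qed (simp add: q_def)
  show "\<exists>q>0. \<exists>N0. \<forall>N\<ge>N0. \<forall>n\<in>{N..N + N div q}. norm (?s n - ?s N) \<le> \<epsilon>"
  proof (rule exI[of _ q], intro conjI q(1), rule exI[of _ 1], intro allI impI ballI)
    fix N n :: nat assume N: "N \<ge> 1" and n: "n \<in> {N..N + N div q}"
    have diff: "?s (N + d) - ?s N = (\<Sum>i<d. a (int (N + i) + 1) + a (- int (N + i) - 1))" for d
    proof (induction d)
      case (Suc d)
      have "?s (N + Suc d) - ?s N = ?s (N + d) - ?s N + (a (int (N + d) + 1) + a (- int (N + d) - 1))"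
        using sum_symmetric_Suc[of a "N + d"] by simp
      then show ?case by (simp only: Suc sum.lessThan_Suc)
    qed simp
    define d where "d = n - N"
    have d: "n = N + d" "real d \<le> real N / real q"
    proof -
      show "n = N + d" using n by (simp add: d_def)
      have "d \<le> N div q" using n by (auto simp: d_def)
      then have "real d \<le> real (N div q)" by simp
      also have "\<dots> \<le> real N / real q"
      proof -
        have "real (N div q * q) \<le> real N" unfolding of_nat_le_iff by simp
        then show ?thesis using q(1) by (simp add: field_simps)
      qed
      finally show "real d \<le> real N / real q" .
    qed
    have "norm (?s n - ?s N) \<le> (\<Sum>i<d. 2 * C / real N)"
      unfolding d(1) diff
    proof (rule sum_norm_le)
      fix i
      have *: "norm (a k) \<le> C / real N" if "\<bar>real_of_int k\<bar> \<ge> real N" for k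
      proof -
        have "real N * norm (a k) \<le> \<bar>real_of_int k\<bar> * norm (a k)" using that by (intro mult_right_mono) auto
        then have "real N * norm (a k) \<le> C" using C[of k] by linarith
        then show ?thesis using N by (simp add: field_simps)
      qed
      have "norm (a (int (N + i) + 1) + a (- int (N + i) - 1)) \<le> C / real N + C / real N"
        by (intro order_trans[OF norm_triangle_ineq] add_mono *) auto
      then show "norm (a (int (N + i) + 1) + a (- int (N + i) - 1)) \<le> 2 * C / real N" by simp
    qed
    also have "\<dots> = real d * (2 * C / real N)" by simp
    also have "\<dots> \<le> (real N / real q) * (2 * C / real N)"
      using d(2) C0 by (intro mult_right_mono) auto
    also have "\<dots> \<le> \<epsilon>" using N q by simp
    finally show "norm (?s n - ?s N) \<le> \<epsilon>" .
  qed
qed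

section \<open>The Fejer kernel as an approximate identity\<close>

text \<open>Written as a squared modulus, positivity is immediate; \<open>fejer_eq\<close> recovers
  the Cesaro mean of Dirichlet kernels. For N > 0 the mass over a period is 2 pi rather than 1, and
  for N = 0 the kernel is 0.\<close>

definition fejer :: "nat \<Rightarrow> real \<Rightarrow> real" where
  "fejer N w = (norm (\<Sum>n<N. cis (real n * w)))\<^sup>2 / real N"

lemma fejer_nonneg: "fejer N w \<ge> 0"
  by (simp add: fejer_def)

lemma fejer_eq:
  "complex_of_real (fejer N w) = (\<Sum>n<N. \<Sum>k\<in>{- int n..int n}. cis (of_int k * w)) / of_nat N"
proof -
  have "complex_of_real ((norm (\<Sum>n<N. cis (real n * w)))\<^sup>2)
     = (\<Sum>m<N. cis (real m * w)) * cnj (\<Sum>n<N. cis (real n * w))"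
    by (rule complex_norm_square)
  also have "\<dots> = (\<Sum>m<N. \<Sum>n<N. cis (of_int (int m - int n) * w))"
    by (simp add: sum_product cis_cnj cis_mult algebra_simps)
  also have "\<dots> = (\<Sum>n<N. \<Sum>k\<in>{- int n..int n}. cis (of_int k * w))"
    by (rule sum_differences_eq)
  finally show ?thesis by (simp add: fejer_def)
qed

lemma cis_add_period: "cis (real n * (w + 2 * pi * of_int k)) = cis (real n * w)"
proof -
  have "cis (2 * pi * of_int (int n * k)) = 1" by (rule cis_multiple_2pi) simp
  moreover have "real n * (w + 2 * pi * of_int k) = real n * w + 2 * pi * of_int (int n * k)"
    by (simp add: algebra_simps)
  ultimately show ?thesis by (simp add: cis_mult[symmetric])
qed

lemma fejer_periodic: "fejer N (w + 2 * pi * of_int k) = fejer N w"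
  by (simp add: fejer_def cis_add_period)

lemma continuous_fejer: "continuous_on A (fejer N)"
  unfolding fejer_def divide_inverse by (intro continuous_intros)

lemma fejer_measurable [measurable]: "fejer N \<in> borel_measurable borel"
  by (intro borel_measurable_continuous_onI continuous_fejer)

lemma fejer_le: "fejer N w \<le> real N"
proof -
  have "norm (\<Sum>n<N. cis (real n * w)) \<le> (\<Sum>n<N. 1)" by (rule sum_norm_le) simp
  then have "(norm (\<Sum>n<N. cis (real n * w)))\<^sup>2 \<le> (real N)\<^sup>2" by (intro power_mono) auto
  then show ?thesis by (cases "N = 0") (auto simp: fejer_def power2_eq_square field_simps)
qed

text \<open>The geometric sum is bounded independently of N by 2 / |cis w - 1|, and |cis w - 1| = 2
  |sin (w / 2)|. The decay comes entirely from the division by N.\<close>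

lemma fejer_away:
  assumes "0 < \<delta>" "\<delta> \<le> \<bar>w\<bar>" "\<bar>w\<bar> \<le> pi"
  shows "fejer N w \<le> (1 / (sin (\<delta> / 2))\<^sup>2) / real N"
proof -
  have sd: "0 < sin (\<delta> / 2)" using assms pi_gt_zero by (intro sin_gt_zero) linarith+
  have "sin (\<delta> / 2) \<le> sin (\<bar>w\<bar> / 2)" using assms by (intro sin_monotone_2pi_le) auto
  then have sw: "sin (\<delta> / 2) \<le> \<bar>sin (w / 2)\<bar>" using sd by (cases "w \<ge> 0") auto
  have "norm (cis w - 1) = 2 * \<bar>sin (w / 2)\<bar>"
  proof -
    have "(norm (cis w - 1))\<^sup>2 = (cos w - 1)\<^sup>2 + (sin w)\<^sup>2" by (simp add: cmod_power2)
    also have "\<dots> = 2 - 2 * cos w" using sin_cos_squared_add[of w] by (simp add: power2_diff)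
    also have "\<dots> = (2 * \<bar>sin (w / 2)\<bar>)\<^sup>2" using cos_double_sin[of "w / 2"] by (simp add: power_mult_distrib)
    finally show ?thesis by (subst (asm) power2_eq_iff_nonneg) auto
  qed
  then have c: "norm (cis w - 1) \<ge> 2 * sin (\<delta> / 2)" using sw by simp
  then have c1: "cis w \<noteq> 1" using sd by auto
  have "(\<Sum>n<N. cis (real n * w)) = (\<Sum>n<N. cis w ^ n)"
    by (intro sum.cong refl) (simp add: Complex.DeMoivre)
  also have "\<dots> = (cis w ^ N - 1) / (cis w - 1)" by (rule geometric_sum[OF c1])
  also have "norm \<dots> \<le> 2 / (2 * sin (\<delta> / 2))"
    unfolding norm_divide
  proof (rule frac_le)
    show "norm (cis w ^ N - 1) \<le> 2"
      using norm_triangle_ineq4[of "cis w ^ N" 1] by (simp add: norm_power)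
  qed (use c sd in auto)
  finally have "norm (\<Sum>n<N. cis (real n * w)) \<le> 1 / sin (\<delta> / 2)" by simp
  then have "(norm (\<Sum>n<N. cis (real n * w)))\<^sup>2 \<le> (1 / sin (\<delta> / 2))\<^sup>2" by (intro power_mono) auto
  then have "fejer N w \<le> (1 / sin (\<delta> / 2))\<^sup>2 / real N"
    unfolding fejer_def by (rule divide_right_mono) simp
  then show ?thesis by (simp add: power_divide)
qed

lemma integrable_cell_bounded:
  fixes g :: "real \<Rightarrow> 'a :: {banach, second_countable_topology}"
  assumes "g \<in> borel_measurable borel" "\<And>w. w \<in> {a<..b} \<Longrightarrow> norm (g w) \<le> M"
  shows "integrable lborel (\<lambda>w. indicator {a<..b} w *\<^sub>R g w)"
proof (rule Bochner_Integration.integrable_bound)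
  show "integrable lborel (\<lambda>w. M *\<^sub>R indicator {a..b} w :: real)"
    by (auto simp: integrable_indicator_iff emeasure_lborel_Icc_eq)
  show "(\<lambda>w. indicator {a<..b} w *\<^sub>R g w) \<in> borel_measurable lborel" using assms(1) by measurable
  show "AE w in lborel. norm (indicator {a<..b} w *\<^sub>R g w) \<le> norm (M *\<^sub>R indicator {a..b} w :: real)"
    using assms(2) abs_ge_self order_trans by (intro AE_I2) (fastforce simp: indicator_def)
qed

text \<open>The half-open cell is used because its translates by 2 pi tile the line. The fundamental
  theorem is applied on the closed interval, which differs by a null set.\<close>

lemma integral_cis_cell:
  "(LINT w|lborel. indicator {-pi<..pi} w *\<^sub>R cis (of_int k * w)) = (if k = 0 then 2 * pi else 0)"
proof -
  have "(LINT w|lborel. indicator {-pi<..pi} w *\<^sub>R cis (of_int k * w)) =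
     (LINT w|lborel. indicator {-pi..pi} w *\<^sub>R cis (of_int k * w))"
  proof (rule integral_cong_AE)
    have [measurable]: "(\<lambda>w. cis (of_int k * w)) \<in> borel_measurable borel"
      by (intro borel_measurable_continuous_onI continuous_intros)
    show "(\<lambda>w. indicator {-pi<..pi} w *\<^sub>R cis (of_int k * w)) \<in> borel_measurable lborel"
      "(\<lambda>w. indicator {-pi..pi} w *\<^sub>R cis (of_int k * w)) \<in> borel_measurable lborel" by measurable
    show "AE w in lborel. indicator {-pi<..pi} w *\<^sub>R cis (of_int k * w) = indicator {-pi..pi} w *\<^sub>R cis (of_int k * w)"
      using AE_lborel_singleton[of "-pi"] by eventually_elim (auto simp: indicator_def)
  qed
  also have "\<dots> = (if k = 0 then 2 * pi else 0)"
  proof (cases "k = 0")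
    case False
    define P where "P w = cis (of_int k * w) / (\<i> * of_int k)" for w
    have "(P has_vector_derivative cis (of_int k * w)) (at w within A)" for w A
    proof -
      have "((\<lambda>z. exp (\<i> * of_int k * z) / (\<i> * of_int k)) has_field_derivative
          exp (\<i> * of_int k * complex_of_real w)) (at (complex_of_real w))"
        using False by (auto intro!: derivative_eq_intros simp: field_simps)
      from field_vector_diff_chain_at[OF has_vector_derivative_of_real[OF DERIV_ident] this]
      show ?thesis
        unfolding P_def comp_def cis_conv_exp
        by (auto intro: has_vector_derivative_at_within simp: mult.assoc)
    qed
    then have "(LINT w|lborel. indicator {-pi..pi} w *\<^sub>R cis (of_int k * w)) = P pi - P (- pi)"
      by (intro integral_FTC_Icc) (auto intro!: continuous_intros)
    also have "\<dots> = 0"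
    proof -
      have "cis (of_int k * pi) = cis (- (of_int k * pi))"
        using cis_mult[of "- (of_int k * pi)" "2 * pi * of_int k"] cis_multiple_2pi[of "of_int k"]
        by (simp add: algebra_simps)
      then show ?thesis by (simp add: P_def)
    qed
    finally show ?thesis using False by simp
  qed (simp add: scaleR_conv_of_real)
  finally show ?thesis .
qed

lemma integrable_fejer_cell: "integrable lborel (\<lambda>w. indicator {-pi<..pi} w *\<^sub>R fejer N w)"
  by (rule integrable_cell_bounded[of _ _ _ "real N"]) (use fejer_le fejer_nonneg in auto)

text \<open>Each of the N inner sums contains the frequency k = 0 exactly once, and all other
  frequencies integrate to 0.\<close>

lemma integral_fejer_cell:
  assumes "N > 0"
  shows "(LINT w|lborel. indicator {-pi<..pi} w *\<^sub>R fejer N w) = 2 * pi"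
proof -
  have cint: "integrable lborel (\<lambda>w. indicator {-pi<..pi} w *\<^sub>R cis (of_int k * w))" for k
    by (rule integrable_cell_bounded[of _ _ _ 1]) (auto intro!: borel_measurable_continuous_onI continuous_intros)
  have "complex_of_real (LINT w|lborel. indicator {-pi<..pi} w *\<^sub>R fejer N w)
     = (LINT w|lborel. indicator {-pi<..pi} w *\<^sub>R complex_of_real (fejer N w))"
    by (simp add: integral_complex_of_real[symmetric] scaleR_conv_of_real del: integral_complex_of_real)
  also have "\<dots> = (LINT w|lborel. (\<Sum>n<N. \<Sum>k\<in>{- int n..int n}. indicator {-pi<..pi} w *\<^sub>R cis (of_int k * w)) / of_nat N)"
    unfolding fejer_eq by (simp only: scaleR_conv_of_real times_divide_eq_right sum_distrib_left)
  also have "\<dots> = (\<Sum>n<N. \<Sum>k\<in>{- int n..int n}. LINT w|lborel. indicator {-pi<..pi} w *\<^sub>R cis (of_int k * w)) / of_nat N"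
    by (simp only: integral_divide_zero Bochner_Integration.integral_sum[OF Bochner_Integration.integrable_sum[OF cint]]
        Bochner_Integration.integral_sum[OF cint])
  also have "\<dots> = complex_of_real (2 * pi)"
    unfolding integral_cis_cell using assms by (simp add: if_distrib[of complex_of_real] cong: if_cong)
  finally show ?thesis by (simp only: of_real_eq_iff)
qed

text \<open>Near 0 continuity gives \<epsilon> / (4 pi) times the mass 2 pi; away from 0 the kernel
  is O(1/N). The index \<open>Suc N\<close> avoids the zero kernel at N = 0.\<close>

lemma fejer_cell_tendsto:
  fixes g :: "real \<Rightarrow> complex"
  assumes [measurable]: "g \<in> borel_measurable borel" and cont: "isCont g 0"
    and M: "\<And>w. w \<in> {-pi<..pi} \<Longrightarrow> norm (g w) \<le> M"
  shows "(\<lambda>N. LINT w|lborel. indicator {-pi<..pi} w *\<^sub>R (g w * complex_of_real (fejer (Suc N) w)))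
     \<longlonglongrightarrow> 2 * pi * g 0"
proof (rule LIMSEQ_I)
  fix \<epsilon> :: real assume \<epsilon>: "\<epsilon> > 0"
  have M0: "M \<ge> 0" using order_trans[OF norm_ge_zero M[of 0]] pi_gt_zero by simp
  obtain d where d: "d > 0" "\<And>w. \<bar>w\<bar> < d \<Longrightarrow> norm (g w - g 0) < \<epsilon> / (4 * pi)"
    using cont \<epsilon> unfolding isCont_def LIM_def dist_norm
    by (metis diff_zero divide_pos_pos mult_pos_pos pi_gt_zero real_norm_def zero_less_numeral norm_zero diff_self)
  define \<delta> where "\<delta> = min d 1"
  have \<delta>: "\<delta> > 0" using d by (simp add: \<delta>_def)
  define K where "K = 1 / (sin (\<delta> / 2))\<^sup>2"
  have K0: "K \<ge> 0" by (simp add: K_def)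
  obtain N0 :: nat where N0: "real N0 > 2 * M * K * (2 * pi) / (\<epsilon> / 2)" using reals_Archimedean2 by blast
  have "norm ((LINT w|lborel. indicator {-pi<..pi} w *\<^sub>R (g w * complex_of_real (fejer (Suc N) w))) - 2 * pi * g 0) < \<epsilon>"
    if N: "N \<ge> N0" for N
  proof -
    let ?I = "\<lambda>w::real. indicator {-pi<..pi} w :: real" and ?K = "\<lambda>w. fejer (Suc N) w"
    have bd: "norm (g w * complex_of_real (?K w)) \<le> M * real (Suc N)" if "w \<in> {-pi<..pi}" for w
      unfolding norm_mult using M[OF that] M0 fejer_le[of "Suc N" w] fejer_nonneg[of "Suc N" w]
      by (intro mult_mono) auto
    have gint: "integrable lborel (\<lambda>w. ?I w *\<^sub>R (g w * complex_of_real (?K w)))"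
      by (rule integrable_cell_bounded[OF _ bd]) auto
    have g0: "2 * pi * g 0 = (LINT w|lborel. g 0 * complex_of_real (?I w *\<^sub>R ?K w))"
      by (simp only: integral_mult_right_zero integral_complex_of_real integral_fejer_cell[OF zero_less_Suc] mult.commute of_real_mult of_real_numeral)
    have g0int: "integrable lborel (\<lambda>w. g 0 * complex_of_real (?I w *\<^sub>R ?K w))"
      by (intro integrable_mult_right integrable_of_real integrable_fejer_cell)
    have "norm ((LINT w|lborel. ?I w *\<^sub>R (g w * complex_of_real (?K w))) - 2 * pi * g 0)
      = norm (LINT w|lborel. ?I w *\<^sub>R ((g w - g 0) * complex_of_real (?K w)))"
      unfolding g0 by (subst Bochner_Integration.integral_diff[OF gint g0int, symmetric])
        (simp add: scaleR_conv_of_real algebra_simps)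
    also have "\<dots> \<le> (LINT w|lborel. norm (?I w *\<^sub>R ((g w - g 0) * complex_of_real (?K w))))"
      by (rule integral_norm_bound)
    also have "\<dots> \<le> (LINT w|lborel. (\<epsilon> / (4 * pi)) * (?I w *\<^sub>R ?K w) + 2 * M * (K / real (Suc N)) * ?I w)"
    proof (rule integral_mono)
      show "integrable lborel (\<lambda>w. norm (?I w *\<^sub>R ((g w - g 0) * complex_of_real (?K w))))"
      proof (intro integrable_norm integrable_cell_bounded)
        fix w assume w: "w \<in> {-pi<..pi}"
        have "norm (g w - g 0) \<le> 2 * M"
          using norm_triangle_ineq4[of "g w" "g 0"] M[OF w] M[of 0] by simp
        then show "norm ((g w - g 0) * complex_of_real (?K w)) \<le> (2 * M) * real (Suc N)"
          unfolding norm_mult using M0 fejer_le[of "Suc N" w] fejer_nonneg[of "Suc N" w] by (intro mult_mono) auto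
      qed measurable
      show "integrable lborel (\<lambda>w. (\<epsilon> / (4 * pi)) * (?I w *\<^sub>R ?K w) + 2 * M * (K / real (Suc N)) * ?I w)"
        using integrable_fejer_cell[of "Suc N"]
        by (intro Bochner_Integration.integrable_add integrable_mult_right)
          (auto simp: integrable_indicator_iff)
      fix w
      show "norm (?I w *\<^sub>R ((g w - g 0) * complex_of_real (?K w)))
        \<le> (\<epsilon> / (4 * pi)) * (?I w *\<^sub>R ?K w) + 2 * M * (K / real (Suc N)) * ?I w"
      proof (cases "w \<in> {-pi<..pi}")
        case w: True
        have K: "?K w \<ge> 0" by (rule fejer_nonneg)
        show ?thesis
        proof (cases "\<bar>w\<bar> < \<delta>")
          case True
          then have "norm (g w - g 0) * ?K w \<le> (\<epsilon> / (4 * pi)) * ?K w"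
            using d(2)[of w] K by (intro mult_right_mono) (auto simp: \<delta>_def)
          moreover have "0 \<le> 2 * M * (K / real (Suc N))" using M0 K0 by simp
          ultimately show ?thesis using w K by (simp add: norm_mult)
        next
          case False
          have "norm (g w - g 0) \<le> 2 * M"
            using norm_triangle_ineq4[of "g w" "g 0"] M[OF w] M[of 0] by simp
          moreover have "?K w \<le> K / real (Suc N)"
            unfolding K_def using False w \<delta> by (intro fejer_away) auto
          ultimately have "norm (g w - g 0) * ?K w \<le> 2 * M * (K / real (Suc N))"
            using K M0 by (intro mult_mono) auto
          moreover have "0 \<le> (\<epsilon> / (4 * pi)) * ?K w" using \<epsilon> K by simp
          ultimately show ?thesis using w K by (simp add: norm_mult)
        qed
      qed simp
    qed
    also have "\<dots> = (\<epsilon> / (4 * pi)) * (2 * pi) + 2 * M * (K / real (Suc N)) * (2 * pi)"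
      using integrable_fejer_cell[of "Suc N"] integral_fejer_cell[of "Suc N"]
      by (subst Bochner_Integration.integral_add)
         (auto simp: integrable_indicator_iff)
    also have "\<dots> < \<epsilon> / 2 + \<epsilon> / 2"
    proof -
      have "2 * M * K * (2 * pi) < (\<epsilon> / 2) * real (Suc N)"
      proof -
        have "2 * M * K * (2 * pi) < (\<epsilon> / 2) * real N0" using N0 \<epsilon> by (simp add: field_simps)
        also have "\<dots> \<le> (\<epsilon> / 2) * real (Suc N)" using N \<epsilon> by (intro mult_left_mono) auto
        finally show ?thesis .
      qed
      then have "2 * M * (K / real (Suc N)) * (2 * pi) < \<epsilon> / 2" by (simp add: field_simps)
      moreover have "(\<epsilon> / (4 * pi)) * (2 * pi) = \<epsilon> / 2" by simp
      ultimately show ?thesis by linarith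
    qed
    finally show ?thesis by simp
  qed
  then show "\<exists>no. \<forall>n\<ge>no. norm ((LINT w|lborel. indicator {-pi<..pi} w *\<^sub>R (g w * complex_of_real (fejer (Suc n) w))) - 2 * pi * g 0) < \<epsilon>"
    by blast
qed

section \<open>Periodization and bounded variation\<close>

lemma cell_indicator_sum:
  fixes p :: real
  assumes "p > 0"
  shows "(\<Sum>k\<in>{- int n..int n}. indicator {c + p * of_int k<..c + p * of_int k + p} x) =
    (indicator {c - p * real n<..c + p * real n + p} x :: real)"
proof (induction n)
  case (Suc n)
  have *: "indicator {c - y<..c + y + p} x + (indicator {c + (y + p)<..c + (y + p) + p} x
      + indicator {c + - (y + p)<..c + - (y + p) + p} x)
    = (indicator {c - (y + p)<..c + (y + p) + p} x :: real)" if "y \<ge> 0" for y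
    using that assms by (auto simp: indicator_def)
  have "p * of_int (int n + 1) = p * real n + p" "p * of_int (- int n - 1) = - (p * real n + p)"
    "p * real (Suc n) = p * real n + p"
    by (simp_all add: algebra_simps)
  then show ?case
    unfolding sum_symmetric_Suc Suc using *[of "p * real n"] assms by (simp only:) simp
qed (simp add: indicator_def)

text \<open>The common device of this section: an integral over the line is folded into one cell,
  where sums over the translates of a point can be estimated or passed to the limit.\<close>

lemma cell_integral_sum:
  fixes g :: "real \<Rightarrow> 'a :: {banach, second_countable_topology}"
  assumes g: "integrable lborel g" and p: "p > 0"
  shows "(\<Sum>k\<in>{- int n..int n}. LINT x|lborel. indicator {c<..c + p} x *\<^sub>R g (x + p * of_int k))
     = (LINT x|lborel. indicator {c - p * real n<..c + p * real n + p} x *\<^sub>R g x)"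
proof -
  have "(LINT x|lborel. indicator {c<..c + p} x *\<^sub>R g (x + p * of_int k)) =
     (LINT x|lborel. indicator {c + p * of_int k<..c + p * of_int k + p} x *\<^sub>R g x)" for k :: int
    by (subst lborel_integral_real_affine[where c=1 and t="p * of_int k"
          and f="\<lambda>x. indicator {c + p * of_int k<..c + p * of_int k + p} x *\<^sub>R g x"])
       (auto intro!: Bochner_Integration.integral_cong simp: indicator_def add.commute)
  then have "(\<Sum>k\<in>{- int n..int n}. LINT x|lborel. indicator {c<..c + p} x *\<^sub>R g (x + p * of_int k)) =
    (\<Sum>k\<in>{- int n..int n}. LINT x|lborel. indicator {c + p * of_int k<..c + p * of_int k + p} x *\<^sub>R g x)"
    by simp
  also have "\<dots> = (LINT x|lborel. (\<Sum>k\<in>{- int n..int n}. indicator {c + p * of_int k<..c + p * of_int k + p} x *\<^sub>R g x))"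
    by (rule Bochner_Integration.integral_sum[symmetric]) (intro integrable_mult_indicator g, simp)
  also have "\<dots> = (LINT x|lborel. indicator {c - p * real n<..c + p * real n + p} x *\<^sub>R g x)"
    by (simp only: scaleR_sum_left[symmetric] cell_indicator_sum[OF p])
  finally show ?thesis .
qed

lemma growing_cell_integral_tendsto:
  fixes g :: "real \<Rightarrow> 'a :: {banach, second_countable_topology}"
  assumes g: "integrable lborel g" and p: "p > 0"
  shows "(\<lambda>n. LINT x|lborel. indicator {c - p * real n<..c + p * real n + p} x *\<^sub>R g x) \<longlonglongrightarrow> (LINT x|lborel. g x)"
proof (rule integral_dominated_convergence[where w="\<lambda>x. norm (g x)"])
  show "AE x in lborel. (\<lambda>n. indicator {c - p * real n<..c + p * real n + p} x *\<^sub>R g x) \<longlonglongrightarrow> g x"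
  proof (intro AE_I2 tendsto_eventually)
    fix x
    obtain N :: nat where N: "real N > (\<bar>x\<bar> + \<bar>c\<bar>) / p" using reals_Archimedean2 by blast
    show "\<forall>\<^sub>F n in sequentially. indicator {c - p * real n<..c + p * real n + p} x *\<^sub>R g x = g x"
      using eventually_ge_at_top[of N]
    proof eventually_elim
      case (elim n)
      have "\<bar>x\<bar> + \<bar>c\<bar> < p * real N" using N p by (simp add: field_simps)
      also have "\<dots> \<le> p * real n" using elim p by simp
      finally have "\<bar>x\<bar> + \<bar>c\<bar> < p * real n" .
      then have "x \<in> {c - p * real n<..c + p * real n + p}" using p by (auto simp: abs_if split: if_splits)
      then show ?case by simp
    qed
  qed
  show "AE x in lborel. norm (indicator {c - p * real n<..c + p * real n + p} x *\<^sub>R g x) \<le> norm (g x)" for n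
    by (auto simp: indicator_def)
qed (use g in auto)

section \<open>Consequences of bounded variation\<close>

text \<open>The points a 0 \<le> b 0 \<le> a 1 \<le> b 1 ... form one increasing sequence, with
  \<open>a\<close> at even and \<open>b\<close> at odd places; the increments from
  \<open>b i\<close> to \<open>a (Suc i)\<close> are dropped. A single V serves all such families,
  so the bound is uniform in a base point that is integrated over a cell.\<close>

lemma BV_sum_bound:
  assumes "f \<in> BV"
  shows "\<exists>V\<ge>0. \<forall>n a b. (\<forall>i. a i \<le> b i \<and> b i \<le> a (Suc i)) \<longrightarrow> (\<Sum>i<n. norm (f (b i) - f (a i))) \<le> V"
proof -
  obtain V where V: "\<And>n x. mono x \<Longrightarrow> (\<Sum>i<n. norm (f (x (Suc i)) - f (x i))) \<le> V"
    using assms by (auto simp: BV_def)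
  have "V \<ge> 0" using V[of "\<lambda>_. 0" 0] by (simp add: mono_def)
  moreover have "(\<Sum>i<n. norm (f (b i) - f (a i))) \<le> V" if ab: "\<And>i. a i \<le> b i \<and> b i \<le> a (Suc i)"
    for n :: nat and a b :: "nat \<Rightarrow> real"
  proof -
    define x where "x i = (if even i then a (i div 2) else b (i div 2))" for i
    have "x i \<le> x (Suc i)" for i
      using ab[of "i div 2"] by (auto simp: x_def)
    then have m: "mono x" by (simp add: mono_iff_le_Suc)
    have "(\<Sum>i<n. norm (f (b i) - f (a i))) \<le> (\<Sum>i<2 * n. norm (f (x (Suc i)) - f (x i)))"
    proof (induction n)
      case (Suc n)
      have "norm (f (b n) - f (a n)) = norm (f (x (Suc (2 * n))) - f (x (2 * n)))"
        by (simp add: x_def)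
      then show ?case using Suc by (simp add: add_increasing2)
    qed simp
    also have "\<dots> \<le> V" by (rule V[OF m])
    finally show ?thesis .
  qed
  ultimately show ?thesis by blast
qed

lemma BV_sum_bound_int:
  assumes "f \<in> BV"
  shows "\<exists>V\<ge>0. \<forall>n a b. (\<forall>k::int. a k \<le> b k \<and> b k \<le> a (k + 1)) \<longrightarrow>
       (\<Sum>k\<in>{- int n..int n}. norm (f (b k) - f (a k))) \<le> V"
proof -
  obtain V where V0: "V \<ge> 0"
    and "\<forall>n a b. (\<forall>i. a i \<le> b i \<and> b i \<le> a (Suc i)) \<longrightarrow> (\<Sum>i<n. norm (f (b i) - f (a i))) \<le> V"
    using BV_sum_bound[OF assms] by blast
  note V = V0 this(2)[rule_format]
  have "(\<Sum>k\<in>{- int n..int n}. norm (f (b k) - f (a k))) \<le> V" if ab: "\<And>k::int. a k \<le> b k \<and> b k \<le> a (k + 1)"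
    for n and a b :: "int \<Rightarrow> real"
  proof -
    have "(\<Sum>k\<in>{- int n..int n}. norm (f (b k) - f (a k))) =
      (\<Sum>i<2 * n + 1. norm (f (b (int i - int n)) - f (a (int i - int n))))"
      by (rule sum.reindex_bij_witness[of _ "\<lambda>i. int i - int n" "\<lambda>k. nat (k + int n)"]) auto
    also have "\<dots> \<le> V"
    proof (rule V(2))
      fix i show "a (int i - int n) \<le> b (int i - int n) \<and> b (int i - int n) \<le> a (int (Suc i) - int n)"
        using ab[of "int i - int n"] by (simp add: algebra_simps)
    qed
    finally show ?thesis .
  qed
  with V(1) show ?thesis by blast
qed

text \<open>Replacing a sample by the mean over the adjacent interval of length \<open>h\<close> costs at most the
  variation there.\<close>
lemma BV_L1_samples_bounded:
  assumes f: "f \<in> BV" "integrable lborel f" and h: "h > 0"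
  obtains B where "\<And>n. (\<Sum>k\<in>{- int n..int n}. norm (f (h * of_int k))) \<le> B"
proof -
  obtain V where V0: "V \<ge> 0"
    and "\<forall>n a b. (\<forall>k::int. a k \<le> b k \<and> b k \<le> a (k + 1)) \<longrightarrow>
       (\<Sum>k\<in>{- int n..int n}. norm (f (b k) - f (a k))) \<le> V"
    using BV_sum_bound_int[OF f(1)] by blast
  note V = V0 this(2)[rule_format]
  have [measurable]: "f \<in> borel_measurable borel" using f by auto
  have fk: "integrable lborel (\<lambda>x. norm (f (x + h * of_int k)))" for k :: int
    using integrable_norm[OF lborel_integrable_real_affine[OF f(2), of 1 "h * of_int k"]] by (simp add: add.commute)
  have "(\<Sum>k\<in>{- int n..int n}. norm (f (h * of_int k))) \<le> ((LINT x|lborel. norm (f x)) + h * V) / h" for n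
  proof -
    let ?K = "{- int n..int n}"
    have ic: "integrable lborel (\<lambda>x. indicator {0<..h} x *\<^sub>R (c :: real))" for c
      using h by (auto simp: integrable_indicator_iff)
    have i1: "integrable lborel (\<lambda>x. indicator {0<..h} x *\<^sub>R norm (f (x + h * of_int k)))" for k :: int
      by (intro integrable_mult_indicator fk) simp
    have "h * (\<Sum>k\<in>?K. norm (f (h * of_int k))) = (LINT x|lborel. indicator {0<..h} x *\<^sub>R (\<Sum>k\<in>?K. norm (f (h * of_int k))))"
      using h by simp
    also have "\<dots> \<le> (LINT x|lborel. (\<Sum>k\<in>?K. indicator {0<..h} x *\<^sub>R norm (f (x + h * of_int k))) + indicator {0<..h} x *\<^sub>R V)"
    proof (rule integral_mono)
      show "integrable lborel (\<lambda>x. (\<Sum>k\<in>?K. indicator {0<..h} x *\<^sub>R norm (f (x + h * of_int k))) + indicator {0<..h} x *\<^sub>R V)"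
        by (intro Bochner_Integration.integrable_add Bochner_Integration.integrable_sum i1 ic)
      fix x
      show "indicator {0<..h} x *\<^sub>R (\<Sum>k\<in>?K. norm (f (h * of_int k)))
        \<le> (\<Sum>k\<in>?K. indicator {0<..h} x *\<^sub>R norm (f (x + h * of_int k))) + indicator {0<..h} x *\<^sub>R V"
      proof (cases "x \<in> {0<..h}")
        case True
        have "(\<Sum>k\<in>?K. norm (f (h * of_int k))) \<le>
          (\<Sum>k\<in>?K. norm (f (x + h * of_int k)) + norm (f (x + h * of_int k) - f (h * of_int k)))"
          by (intro sum_mono) (metis norm_minus_commute norm_triangle_sub)
        also have "\<dots> \<le> (\<Sum>k\<in>?K. norm (f (x + h * of_int k))) + V"
          unfolding sum.distrib using True by (intro add_left_mono V(2)) (auto simp: algebra_simps)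
        finally show ?thesis using True by simp
      qed simp
    qed (rule ic)
    also have "\<dots> = (\<Sum>k\<in>?K. LINT x|lborel. indicator {0<..h} x *\<^sub>R norm (f (x + h * of_int k))) + h * V"
      using h by (simp only: Bochner_Integration.integral_add[OF Bochner_Integration.integrable_sum[OF i1] ic]
          Bochner_Integration.integral_sum[OF i1]) simp
    also have "(\<Sum>k\<in>?K. LINT x|lborel. indicator {0<..h} x *\<^sub>R norm (f (x + h * of_int k))) =
      (LINT x|lborel. indicator {0 - h * real n<..0 + h * real n + h} x *\<^sub>R norm (f x))"
      using cell_integral_sum[OF integrable_norm[OF f(2)] h, of 0 n] by simp
    also have "\<dots> \<le> (LINT x|lborel. norm (f x))"
    proof (rule integral_mono)
      show "integrable lborel (\<lambda>x. indicator {0 - h * real n<..0 + h * real n + h} x *\<^sub>R norm (f x))"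
        using f by (intro integrable_mult_indicator) auto
    qed (use f in \<open>auto simp: indicator_def\<close>)
    finally show ?thesis using h by (simp add: field_simps)
  qed
  then show ?thesis using that by blast
qed

text \<open>Folded into a cell of length \<delta>, the integrand at x is the sum of increments over
  adjacent intervals with end points x + \<delta> * k, at most V; the cell contributes its
  length.\<close>

lemma BV_translation_modulus:
  assumes F: "F \<in> BV" "integrable lborel F"
  shows "\<exists>V\<ge>0. \<forall>\<delta>>0. (LINT v|lborel. norm (F (v + \<delta>) - F v)) \<le> \<delta> * V"
proof -
  obtain V where V0: "V \<ge> 0"
    and "\<forall>n a b. (\<forall>k::int. a k \<le> b k \<and> b k \<le> a (k + 1)) \<longrightarrow>
       (\<Sum>k\<in>{- int n..int n}. norm (F (b k) - F (a k))) \<le> V"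
    using BV_sum_bound_int[OF F(1)] by blast
  note V = V0 this(2)[rule_format]
  have "(LINT v|lborel. norm (F (v + \<delta>) - F v)) \<le> \<delta> * V" if d: "\<delta> > 0" for \<delta>
  proof -
    let ?g = "\<lambda>v. norm (F (v + \<delta>) - F v)"
    have g: "integrable lborel ?g"
      using lborel_integrable_real_affine[OF F(2), of 1 \<delta>] F(2) by (auto simp: add.commute)
    have gk: "integrable lborel (\<lambda>v. indicator {0<..\<delta>} v *\<^sub>R ?g (v + \<delta> * of_int k))" for k :: int
      using lborel_integrable_real_affine[OF g, of 1 "\<delta> * of_int k"]
      by (intro integrable_mult_indicator) (auto simp: add.commute)
    have "(LINT x|lborel. indicator {0 - \<delta> * real n<..0 + \<delta> * real n + \<delta>} x *\<^sub>R ?g x) \<le> \<delta> * V" for n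
    proof -
      have "(LINT x|lborel. indicator {0 - \<delta> * real n<..0 + \<delta> * real n + \<delta>} x *\<^sub>R ?g x) =
        (LINT x|lborel. (\<Sum>k\<in>{- int n..int n}. indicator {0<..\<delta>} x *\<^sub>R ?g (x + \<delta> * of_int k)))"
        using cell_integral_sum[OF g d, of 0 n] gk by (simp only: Bochner_Integration.integral_sum add_0)
      also have "\<dots> \<le> (LINT x|lborel. indicator {0<..\<delta>} x *\<^sub>R V)"
      proof (rule integral_mono)
        fix x
        show "(\<Sum>k\<in>{- int n..int n}. indicator {0<..\<delta>} x *\<^sub>R ?g (x + \<delta> * of_int k)) \<le> indicator {0<..\<delta>} x *\<^sub>R V"
          unfolding scaleR_sum_right[symmetric] using d
          by (intro scaleR_left_mono V(2)) (auto simp: algebra_simps)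
      next
        show "integrable lborel (\<lambda>x. \<Sum>k\<in>{- int n..int n}. indicator {0<..\<delta>} x *\<^sub>R ?g (x + \<delta> * of_int k))"
          by (rule Bochner_Integration.integrable_sum[OF gk])
      qed (use d in \<open>auto simp: integrable_indicator_iff\<close>)
      also have "\<dots> = \<delta> * V" using d by simp
      finally show ?thesis .
    qed
    with growing_cell_integral_tendsto[OF g d, of 0] show ?thesis
      by (intro LIMSEQ_le_const2[of _ _ "\<delta> * V"]) auto
  qed
  with V(1) show ?thesis by blast
qed

text \<open>Translation by \<open>pi / \<bar>t\<bar>\<close> changes the sign of the exponential at frequency \<open>t\<close>.\<close>
lemma fourier_BV_decay:
  assumes F: "F \<in> BV" "integrable lborel F"
  obtains C where "\<And>t. \<bar>t\<bar> * norm (fourier F t) \<le> C"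
proof -
  obtain V where V0: "V \<ge> 0" and "\<forall>\<delta>>0. (LINT v|lborel. norm (F (v + \<delta>) - F v)) \<le> \<delta> * V"
    using BV_translation_modulus[OF F] by blast
  note V = V0 this(2)[rule_format]
  have "\<bar>t\<bar> * norm (fourier F t) \<le> pi * V" for t
  proof (cases "t = 0")
    case False
    define \<delta> where "\<delta> = pi / \<bar>t\<bar>"
    have d: "\<delta> > 0" using False by (simp add: \<delta>_def)
    have Fd: "integrable lborel (\<lambda>v. F (v + \<delta>))"
      using lborel_integrable_real_affine[OF F(2), of 1 \<delta>] by (simp add: add.commute)
    have "exp (\<i> * complex_of_real \<delta> * complex_of_real t) = cis (\<delta> * t)"
      by (simp add: cis_conv_exp mult.assoc)
    also have "\<dots> = -1"
      using False by (cases "t > 0") (auto simp: \<delta>_def complex_eq_iff)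
    finally have "fourier (\<lambda>v. F (v + \<delta>) - F v) t = - 2 * fourier F t"
      unfolding fourier_diff[OF Fd F(2)] fourier_translate by simp
    then have "2 * norm (fourier F t) = norm (fourier (\<lambda>v. F (v + \<delta>) - F v) t)"
      by (simp add: norm_mult)
    also have "\<dots> \<le> \<delta> * V"
      using norm_fourier_le[of "\<lambda>v. F (v + \<delta>) - F v" t] Fd F(2) V(2)[OF d] by auto
    finally have "norm (fourier F t) \<le> \<delta> * V"
      using norm_ge_zero[of "fourier F t"] by linarith
    then have "\<bar>t\<bar> * norm (fourier F t) \<le> \<bar>t\<bar> * (\<delta> * V)" by (intro mult_left_mono) auto
    also have "\<dots> = pi * V" using False by (simp add: \<delta>_def)
    finally show ?thesis .
  qed (use V(1) in simp)
  then show ?thesis using that by blast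
qed

lemma summable_powr_nat: "a > 1 \<Longrightarrow> summable (\<lambda>k. real (Suc k) powr - a)"
  using summable_real_powr_iff[of "-a"] by (subst summable_Suc_iff) simp

section \<open>Periodization through the Fejer kernel\<close>

text \<open>Because the kernel has period 2 pi, the integral splits into integrals of translates of
  H over one cell. The cell at k tends to 2 pi * H (2 pi k), and the decay of H supplies the
  summable bound for exchanging limit and sum.\<close>

lemma fejer_tendsto_periodization:
  fixes H :: "real \<Rightarrow> complex"
  assumes H: "H \<in> bcontfun" "integrable lborel H" and a: "a > 1"
    and decay: "\<And>w. \<bar>w\<bar> powr a * norm (H w) \<le> C"
  shows "(\<lambda>N. LINT w|lborel. H w * complex_of_real (fejer (Suc N) w)) \<longlonglongrightarrow>
     2 * pi * (H 0 + (\<Sum>k. H (2 * pi * (1 + real k)) + H (- (2 * pi * (1 + real k)))))"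
proof -
  have [measurable]: "H \<in> borel_measurable borel" by (rule bcontfun_measurable[OF H(1)])
  obtain M where M: "M \<ge> 0" "\<And>w. norm (H w) \<le> M" using bcontfun_bound[OF H(1)] by blast
  have C0: "C \<ge> 0" using decay[of 0] by simp
  define c where "c N k = (LINT w|lborel. indicator {-pi<..pi} w *\<^sub>R (H (w + 2 * pi * of_int k) * complex_of_real (fejer (Suc N) w)))"
    for N and k :: int
  have int: "integrable lborel (\<lambda>w. H w * complex_of_real (fejer (Suc N) w))" for N
  proof (rule Bochner_Integration.integrable_bound)
    show "integrable lborel (\<lambda>w. real (Suc N) *\<^sub>R H w)" using H by auto
    show "AE w in lborel. norm (H w * complex_of_real (fejer (Suc N) w)) \<le> norm (real (Suc N) *\<^sub>R H w)"
      using fejer_le[of "Suc N"] fejer_nonneg[of "Suc N"]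
      by (auto simp: norm_mult mult.commute[of "norm (H _)"] intro!: mult_right_mono)
  qed measurable
  have cell: "(\<lambda>n. \<Sum>k\<in>{- int n..int n}. c N k) \<longlonglongrightarrow> (LINT w|lborel. H w * complex_of_real (fejer (Suc N) w))" for N
  proof -
    have "(\<Sum>k\<in>{- int n..int n}. c N k) =
       (LINT w|lborel. indicator {- pi - 2 * pi * real n<..- pi + 2 * pi * real n + 2 * pi} w *\<^sub>R (H w * complex_of_real (fejer (Suc N) w)))" for n
      using cell_integral_sum[OF int[of N], of "2 * pi" "-pi" n]
      by (simp add: c_def fejer_periodic)
    then show ?thesis
      using growing_cell_integral_tendsto[OF int[of N], of "2 * pi" "-pi"] by simp
  qed
  have sums: "(\<lambda>k. c N (int k + 1) + c N (- int k - 1)) sums ((LINT w|lborel. H w * complex_of_real (fejer (Suc N) w)) - c N 0)" for N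
  proof -
    have "(\<lambda>n. (\<Sum>k\<in>{- int n..int n}. c N k) - c N 0) \<longlonglongrightarrow> (LINT w|lborel. H w * complex_of_real (fejer (Suc N) w)) - c N 0"
      by (intro tendsto_intros cell)
    then show ?thesis unfolding sums_def sum_symmetric_conv by simp
  qed
  have lim: "(\<lambda>N. c N k) \<longlonglongrightarrow> 2 * pi * H (2 * pi * of_int k)" for k
  proof -
    have "isCont (\<lambda>w. H (w + 2 * pi * of_int k)) 0"
      by (rule isCont_o2[of 0 "\<lambda>w. w + 2 * pi * of_int k" H]) (auto intro: bcontfun_isCont[OF H(1)])
    from fejer_cell_tendsto[OF _ this M(2)] show ?thesis
      unfolding c_def by simp
  qed
  \<comment> \<open>Positivity and fixed mass of the kernel turn a pointwise bound on H over the
    cell into one independent of N.\<close>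
  have bound: "norm (c N k) \<le> 2 * pi * (C * (pi * m) powr - a)"
    if k: "\<And>w. w \<in> {-pi<..pi} \<Longrightarrow> pi * m \<le> \<bar>w + 2 * pi * of_int k\<bar>" and m: "m > 0" for N k m
  proof -
    have "norm (c N k) \<le> (LINT w|lborel. norm (indicator {-pi<..pi} w *\<^sub>R (H (w + 2 * pi * of_int k) * complex_of_real (fejer (Suc N) w))))"
      unfolding c_def by (rule integral_norm_bound)
    also have "\<dots> \<le> (LINT w|lborel. (C * (pi * m) powr - a) * (indicator {-pi<..pi} w *\<^sub>R fejer (Suc N) w))"
    proof (rule integral_mono)
      show "integrable lborel (\<lambda>w. norm (indicator {-pi<..pi} w *\<^sub>R (H (w + 2 * pi * of_int k) * complex_of_real (fejer (Suc N) w))))"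
        using M fejer_le[of "Suc N"] fejer_nonneg[of "Suc N"]
        by (intro integrable_norm integrable_cell_bounded[where M="M * real (Suc N)"])
           (auto simp: norm_mult intro!: mult_mono)
      show "integrable lborel (\<lambda>w. (C * (pi * m) powr - a) * (indicator {-pi<..pi} w *\<^sub>R fejer (Suc N) w))"
        by (intro integrable_mult_right integrable_fejer_cell)
      fix w
      have "norm (H (w + 2 * pi * of_int k)) \<le> C * (pi * m) powr - a" if w: "w \<in> {-pi<..pi}"
      proof -
        have pm: "pi * m > 0" using m by simp
        have "(pi * m) powr a * norm (H (w + 2 * pi * of_int k)) \<le> \<bar>w + 2 * pi * of_int k\<bar> powr a * norm (H (w + 2 * pi * of_int k))"
          using k[OF w] pm a by (intro mult_right_mono powr_mono2) auto
        also have "\<dots> \<le> C" by (rule decay)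
        finally show ?thesis using m by (simp add: powr_minus field_simps)
      qed
      then show "norm (indicator {-pi<..pi} w *\<^sub>R (H (w + 2 * pi * of_int k) * complex_of_real (fejer (Suc N) w)))
        \<le> (C * (pi * m) powr - a) * (indicator {-pi<..pi} w *\<^sub>R fejer (Suc N) w)"
        using fejer_nonneg[of "Suc N" w] by (cases "w \<in> {-pi<..pi}") (auto simp: norm_mult intro!: mult_right_mono)
    qed
    also have "\<dots> = 2 * pi * (C * (pi * m) powr - a)"
      unfolding integral_mult_right_zero integral_fejer_cell[OF zero_less_Suc] by simp
    finally show ?thesis .
  qed
  define D where "D = 4 * pi * C * pi powr - a"
  \<comment> \<open>For w in the basic cell, |w + 2 pi m| \<ge> 2 pi |m| - pi \<ge> pi |m| when m is
    nonzero. The cells m = k + 1 and m = -(k + 1) each contribute half of D.\<close>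
  have bound2: "norm (c N (int k + 1) + c N (- int k - 1)) \<le> D * real (Suc k) powr - a" for N k
  proof -
    have "norm (c N (int k + 1)) \<le> 2 * pi * (C * (pi * real (Suc k)) powr - a)"
    proof (rule bound)
      fix w assume w: "w \<in> {-pi<..pi}"
      have *: "y + pi \<le> \<bar>w + (2 * y + 2 * pi)\<bar>" if "0 \<le> y" for y
        using w that pi_gt_zero by auto
      have e1: "pi * real (Suc k) = pi * real k + pi" by (simp add: algebra_simps)
      have e2: "2 * pi * of_int (int k + 1) = 2 * (pi * real k) + 2 * pi" by (simp add: algebra_simps)
      show "pi * real (Suc k) \<le> \<bar>w + 2 * pi * of_int (int k + 1)\<bar>"
        unfolding e1 e2 by (rule *) simp
    qed simp
    moreover have "norm (c N (- int k - 1)) \<le> 2 * pi * (C * (pi * real (Suc k)) powr - a)"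
    proof (rule bound)
      fix w assume w: "w \<in> {-pi<..pi}"
      have *: "y + pi \<le> \<bar>w + - (2 * y + 2 * pi)\<bar>" if "0 \<le> y" for y
        using w that pi_gt_zero by auto
      have e1: "pi * real (Suc k) = pi * real k + pi" by (simp add: algebra_simps)
      have e2: "2 * pi * of_int (- int k - 1) = - (2 * (pi * real k) + 2 * pi)" by (simp add: algebra_simps)
      show "pi * real (Suc k) \<le> \<bar>w + 2 * pi * of_int (- int k - 1)\<bar>"
        unfolding e1 e2 by (rule *) simp
    qed simp
    moreover have "D * real (Suc k) powr - a = 2 * pi * (C * (pi * real (Suc k)) powr - a) + 2 * pi * (C * (pi * real (Suc k)) powr - a)"
    proof -
      have "(pi * real (Suc k)) powr - a = pi powr - a * real (Suc k) powr - a" by (subst powr_mult) auto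
      then show ?thesis unfolding D_def by simp
    qed
    ultimately show ?thesis using norm_triangle_ineq[of "c N (int k + 1)" "c N (- int k - 1)"] by linarith
  qed
  have "(\<lambda>N. \<Sum>k. c N (int k + 1) + c N (- int k - 1)) \<longlonglongrightarrow>
      (\<Sum>k. 2 * pi * H (2 * pi * of_int (int k + 1)) + 2 * pi * H (2 * pi * of_int (- int k - 1)))"
  \<comment> \<open>Tannery's theorem is dominated convergence for series; the dominating terms are
    those of the preceding bound.\<close>
  proof (rule tannerys_theorem[THEN conjunct2, THEN conjunct2])
    show "((\<lambda>N. c N (int k + 1) + c N (- int k - 1)) \<longlongrightarrow>
      2 * pi * H (2 * pi * of_int (int k + 1)) + 2 * pi * H (2 * pi * of_int (- int k - 1))) sequentially" for k
      by (intro tendsto_add lim)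
    show "\<forall>\<^sub>F (k, N) in at_top \<times>\<^sub>F sequentially. norm (c N (int k + 1) + c N (- int k - 1)) \<le> D * real (Suc k) powr - a"
      using bound2 by (intro always_eventually) auto
    show "summable (\<lambda>k. D * real (Suc k) powr - a)" by (intro summable_mult summable_powr_nat a)
  qed simp
  then have "(\<lambda>N. c N 0 + (\<Sum>k. c N (int k + 1) + c N (- int k - 1))) \<longlonglongrightarrow>
      2 * pi * H (2 * pi * of_int 0) + (\<Sum>k. 2 * pi * H (2 * pi * of_int (int k + 1)) + 2 * pi * H (2 * pi * of_int (- int k - 1)))"
    by (intro tendsto_add lim)
  moreover have "c N 0 + (\<Sum>k. c N (int k + 1) + c N (- int k - 1)) = (LINT w|lborel. H w * complex_of_real (fejer (Suc N) w))" for N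
    using sums_unique[OF sums[of N]] by (simp add: algebra_simps)
  moreover have "2 * pi * H (2 * pi * of_int 0) + (\<Sum>k. 2 * pi * H (2 * pi * of_int (int k + 1)) + 2 * pi * H (2 * pi * of_int (- int k - 1)))
     = 2 * pi * (H 0 + (\<Sum>k. H (2 * pi * (1 + real k)) + H (- (2 * pi * (1 + real k)))))"
  proof -
    have s: "summable (\<lambda>k. H (2 * pi * (1 + real k)) + H (- (2 * pi * (1 + real k))))"
    proof (rule summable_comparison_test')
      show "summable (\<lambda>k. 2 * (C * (2 * pi) powr - a) * real (Suc k) powr - a)" by (intro summable_mult summable_powr_nat a)
      fix k
      have *: "norm (H w) \<le> C * (2 * pi) powr - a * real (Suc k) powr - a" if w: "\<bar>w\<bar> = 2 * pi * real (Suc k)" for w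
      proof -
        have "(2 * pi * real (Suc k)) powr a * norm (H w) \<le> C" using decay[of w] unfolding w .
        moreover have "(2 * pi * real (Suc k)) powr a = (2 * pi) powr a * real (Suc k) powr a"
          by (rule powr_mult)
        ultimately have "(2 * pi) powr a * real (Suc k) powr a * norm (H w) \<le> C" by (simp only:)
        then show ?thesis unfolding powr_minus by (simp add: field_simps)
      qed
      show "norm (H (2 * pi * (1 + real k)) + H (- (2 * pi * (1 + real k)))) \<le> 2 * (C * (2 * pi) powr - a) * real (Suc k) powr - a"
        using norm_triangle_ineq[of "H (2 * pi * (1 + real k))" "H (- (2 * pi * (1 + real k)))"]
          *[of "2 * pi * (1 + real k)"] *[of "- (2 * pi * (1 + real k))"] by (simp add: abs_mult)
    qed
    have "(\<Sum>k. 2 * pi * H (2 * pi * of_int (int k + 1)) + 2 * pi * H (2 * pi * of_int (- int k - 1))) =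
      (\<Sum>k. 2 * pi * (H (2 * pi * (1 + real k)) + H (- (2 * pi * (1 + real k)))))"
    proof -
      have "2 * pi * of_int (int k + 1) = 2 * pi * (1 + real k)" "2 * pi * of_int (- int k - 1) = - (2 * pi * (1 + real k))" for k
        by (simp_all add: algebra_simps)
      then show ?thesis by (simp only: distrib_left)
    qed
    also have "\<dots> = 2 * pi * (\<Sum>k. H (2 * pi * (1 + real k)) + H (- (2 * pi * (1 + real k))))"
      by (rule suminf_mult[OF s])
    finally show ?thesis by (simp add: distrib_left)
  qed
  ultimately show ?thesis by simp
qed

section \<open>Moebius inversion\<close>

definition moebius_mu :: "nat \<Rightarrow> real" where
  "moebius_mu n = (if squarefree n then (-1) ^ card (prime_factors n) else 0)"

lemma norm_moebius_le: "\<bar>moebius_mu n\<bar> \<le> 1"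
  by (simp add: moebius_mu_def power_abs)

lemma moebius_prime_mult:
  assumes p: "prime p" and n: "\<not> p dvd n" "n > 0"
  shows "moebius_mu (p * n) = - moebius_mu n"
proof -
  have cop: "coprime p n" using p n by (simp add: prime_imp_coprime)
  have pp: "p > 0" using p by (simp add: prime_gt_0_nat)
  have "squarefree (p * n) \<longleftrightarrow> squarefree n"
    using squarefree_mult_coprime[OF cop squarefree_prime[OF p]] squarefree_multD(2) by blast
  moreover have "prime_factors (p * n) = insert p (prime_factors n)"
    using p pp n by (simp add: prime_factors_product prime_prime_factors)
  moreover have "p \<notin> prime_factors n" using n(1) by auto
  ultimately show ?thesis by (simp add: moebius_mu_def)
qed

lemma moebius_not_squarefree_prime_mult:
  assumes "p dvd n" "prime p"
  shows "moebius_mu (p * n) = 0"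
proof -
  have "p\<^sup>2 dvd p * n" using assms by (auto simp: power2_eq_square)
  then have "\<not> squarefree (p * n)" using assms(2) by (auto simp: squarefree_def)
  then show ?thesis by (simp add: moebius_mu_def)
qed

text \<open>For a fixed prime \<open>p\<close> dividing \<open>n\<close>, the squarefree divisors come in pairs \<open>d\<close>, \<open>p * d\<close>.\<close>
lemma sum_moebius_divisors:
  assumes "n > 0"
  shows "(\<Sum>d | d dvd n. moebius_mu d) = (if n = 1 then 1 else 0)"
proof (cases "n = 1")
  case True
  then show ?thesis by (simp add: moebius_mu_def)
next
  case False
  then obtain p where p: "prime p" "p dvd n" by (metis prime_factor_nat)
  have fin: "finite {d. d dvd n}" using assms by simp
  let ?A = "{d. d dvd n \<and> \<not> p dvd d}" and ?B = "{d. d dvd n \<and> p dvd d}"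
  let ?C = "{d. d dvd n \<and> p dvd d \<and> \<not> p * p dvd d}"
  have d0: "d > 0" if "d dvd n" for d using that assms by (auto intro: Nat.gr0I)
  have "(\<Sum>d | d dvd n. moebius_mu d) = (\<Sum>d\<in>?A \<union> ?B. moebius_mu d)"
    by (intro sum.cong) auto
  also have "\<dots> = (\<Sum>d\<in>?A. moebius_mu d) + (\<Sum>d\<in>?B. moebius_mu d)"
    by (rule sum.union_disjoint) (auto intro: finite_subset[OF _ fin])
  also have "(\<Sum>d\<in>?B. moebius_mu d) = (\<Sum>d\<in>?C. moebius_mu d)"
  proof (rule sum.mono_neutral_right)
    show "\<forall>d\<in>?B - ?C. moebius_mu d = 0"
    proof
      fix d assume "d \<in> ?B - ?C"
      then have "p * p dvd d" by auto
      then obtain e where "d = p * (p * e)" by (auto simp: dvd_def mult.assoc)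
      then show "moebius_mu d = 0" using moebius_not_squarefree_prime_mult[of p "p * e"] p by simp
    qed
  qed (auto intro: finite_subset[OF _ fin])
  also have "\<dots> = (\<Sum>d\<in>?A. moebius_mu (p * d))"
  proof (rule sum.reindex_bij_witness[of _ "\<lambda>d. p * d" "\<lambda>d. d div p"])
    fix d assume d: "d \<in> ?A"
    have "coprime p d" using d p by (simp add: prime_imp_coprime)
    then have "p * d dvd n" using d p by (simp add: divides_mult)
    then show "p * d \<in> ?C" using d p prime_gt_0_nat[OF p(1)] by auto
  next
    fix d assume d: "d \<in> ?C"
    then obtain e where e: "d = p * e" by (auto simp: dvd_def)
    then have "\<not> p dvd e" using d by (auto intro: mult_dvd_mono)
    moreover have "e dvd n" using d e by (auto intro: dvd_mult_right)
    ultimately show "d div p \<in> ?A" using e prime_gt_0_nat[OF p(1)] by simp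
  qed (use p prime_gt_0_nat[OF p(1)] in auto)
  also have "\<dots> = (\<Sum>d\<in>?A. - moebius_mu d)"
    using p d0 by (intro sum.cong refl moebius_prime_mult) auto
  finally show ?thesis using False by (simp add: sum_negf)
qed

section \<open>Recovering a function from its sums over multiples\<close>

lemma has_sum_Suc_reindex:
  "((\<lambda>k. h (Suc k)) has_sum s) UNIV \<longleftrightarrow> (h has_sum s) {0<..}"
  by (rule has_sum_reindex_bij_witness[of _ "\<lambda>k. k - 1" Suc]) auto

text \<open>Inserting the definition of r and collecting the pairs (n, k) with the same product m
  gives the sum over m of \<phi> (m \<sigma>) times the sum of \<open>moebius_mu\<close> over the
  divisors of m, which is 0 unless m = 1. The decay makes the double family absolutely summable, so
  the regrouping is legitimate.\<close>

lemma moebius_inversion_powr: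
  fixes \<phi> :: "real \<Rightarrow> complex"
  assumes a: "a > 1" and s: "\<sigma> > 0"
    and decay: "\<And>x. x \<ge> \<sigma> \<Longrightarrow> norm (\<phi> x) \<le> C * x powr - a"
  defines "r \<equiv> \<lambda>x. \<Sum>k. \<phi> (real (Suc k) * x)"
  shows "(\<lambda>n. complex_of_real (moebius_mu (Suc n)) * r (real (Suc n) * \<sigma>)) sums \<phi> \<sigma>"
proof -
  define P where "P = {0::nat<..}"
  define F where "F = (\<lambda>(n, k). complex_of_real (moebius_mu n) * \<phi> (real (n * k) * \<sigma>))"
  have sp: "(\<lambda>k. real k powr - a) summable_on P"
  proof -
    have "summable (\<lambda>k. norm (real k powr - a))" using a by (simp add: summable_real_powr_iff)
    then have "(\<lambda>k. real k powr - a) summable_on UNIV"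
      by (rule norm_summable_imp_summable_on)
    then show ?thesis by (rule summable_on_subset_banach) simp
  qed
  have C0: "C \<ge> 0" using order_trans[OF norm_ge_zero decay[of \<sigma>]] s by (simp add: zero_le_mult_iff)
  have Fb: "norm (F (n, k)) \<le> C * \<sigma> powr - a * (real n powr - a * real k powr - a)" if "n \<in> P" "k \<in> P" for n k
  proof -
    have nk: "1 \<le> real (n * k)" using that unfolding P_def
      by (metis One_nat_def Suc_leI greaterThan_iff nat_0_less_mult_iff of_nat_1 of_nat_le_iff)
    have "norm (F (n, k)) \<le> 1 * norm (\<phi> (real (n * k) * \<sigma>))"
      unfolding F_def using mult_right_mono[OF norm_moebius_le norm_ge_zero] by (simp add: norm_mult del: of_nat_mult)
    also have "\<dots> \<le> C * (real (n * k) * \<sigma>) powr - a"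
      using decay[of "real (n * k) * \<sigma>"] nk s by (simp del: of_nat_mult)
    also have "\<dots> = C * \<sigma> powr - a * (real n powr - a * real k powr - a)"
      using s by (simp add: powr_mult)
    finally show ?thesis .
  qed
  \<comment> \<open>The bound factors as a function of n times a function of k, so summability over
    pairs reduces to that of k^(-a).\<close>
  have "(\<lambda>(n, k). real n powr - a * real k powr - a) summable_on P \<times> P"
    using sp by (intro summable_on_SigmaI[where g="\<lambda>n. real n powr - a * (\<Sum>\<^sub>\<infinity>k\<in>P. real k powr - a)"])
      (auto intro!: has_sum_cmult_right summable_on_cmult_left)
  then have "(\<lambda>x. C * \<sigma> powr - a * (case x of (n, k) \<Rightarrow> real n powr - a * real k powr - a)) summable_on P \<times> P"
    by (rule summable_on_cmult_right)
  then have FS: "(\<lambda>x. norm (F x)) summable_on P \<times> P"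
    by (rule summable_on_comparison_test) (use Fb in auto)
  then have FS': "F summable_on P \<times> P" by (rule abs_summable_summable)
  have inner: "((\<lambda>k. F (n, k)) has_sum (complex_of_real (moebius_mu n) * r (real n * \<sigma>))) P" if n: "n \<in> P" for n
  proof -
    have "summable (\<lambda>k. norm (\<phi> (real (Suc k) * (real n * \<sigma>))))"
    proof (rule summable_comparison_test')
      show "summable (\<lambda>k. C * (real n * \<sigma>) powr - a * real (Suc k) powr - a)"
        using a by (intro summable_mult, subst summable_Suc_iff) (simp add: summable_real_powr_iff)
      fix k
      have n1: "1 \<le> real n" using n by (simp add: P_def)
      have "1 * \<sigma> \<le> real (Suc k) * real n * \<sigma>" using n1 s by (intro mult_right_mono) (auto simp: mult_ge1_I)
      then have "norm (\<phi> (real (Suc k) * (real n * \<sigma>))) \<le> C * (real (Suc k) * (real n * \<sigma>)) powr - a"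
        by (intro decay) (simp add: mult.assoc)
      also have "\<dots> = C * (real n * \<sigma>) powr - a * real (Suc k) powr - a"
        using s by (subst powr_mult) auto
      finally show "norm (norm (\<phi> (real (Suc k) * (real n * \<sigma>)))) \<le> C * (real n * \<sigma>) powr - a * real (Suc k) powr - a"
        by simp
    qed
    then have "((\<lambda>k. \<phi> (real (Suc k) * (real n * \<sigma>))) has_sum r (real n * \<sigma>)) UNIV"
      unfolding r_def using summable_norm_cancel by (intro norm_summable_imp_has_sum summable_sums) auto
    then have "((\<lambda>k. \<phi> (real k * (real n * \<sigma>))) has_sum r (real n * \<sigma>)) P"
      unfolding has_sum_Suc_reindex[of "\<lambda>k. \<phi> (real k * (real n * \<sigma>))"] P_def .
    then show ?thesis
      unfolding F_def by (auto dest: has_sum_cmult_right[where c="complex_of_real (moebius_mu n)"] simp: mult_ac)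
  qed
  have outer: "((\<lambda>n. complex_of_real (moebius_mu n) * r (real n * \<sigma>)) has_sum infsum F (P \<times> P)) P"
    by (rule has_sum_SigmaD[OF has_sum_infsum[OF FS'] inner])
  have "((\<lambda>m. \<Sum>d | d dvd m. F (d, m div d)) has_sum infsum F (P \<times> P)) P"
  proof -
    \<comment> \<open>The bijection (n, k) with (m, d) = (n * k, n): pairs of positive integers
      correspond to a positive integer together with one of its divisors.\<close>
    have "((\<lambda>(m, d). F (d, m div d)) has_sum infsum F (P \<times> P)) (Sigma P (\<lambda>m. {d. d dvd m})) \<longleftrightarrow>
        (F has_sum infsum F (P \<times> P)) (P \<times> P)"
      by (rule has_sum_reindex_bij_witness[of _ "\<lambda>(n, k). (n * k, n)" "\<lambda>(m, d). (d, m div d)"])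
        (auto simp: P_def elim!: dvdE)
    then have "((\<lambda>(m, d). F (d, m div d)) has_sum infsum F (P \<times> P)) (Sigma P (\<lambda>m. {d. d dvd m}))"
      using has_sum_infsum[OF FS'] by simp
    then show ?thesis
      by (rule has_sum_SigmaD) (auto simp: P_def intro!: has_sum_finiteI)
  qed
  moreover have "(\<Sum>d | d dvd m. F (d, m div d)) = (if m = 1 then \<phi> \<sigma> else 0)" if "m \<in> P" for m
  proof -
    have "(\<Sum>d | d dvd m. F (d, m div d)) = complex_of_real (\<Sum>d | d dvd m. moebius_mu d) * \<phi> (real m * \<sigma>)"
      unfolding F_def of_real_sum sum_distrib_right using that
      by (intro sum.cong refl) (auto simp: P_def elim!: dvdE)
    moreover have "m > 0" using that by (simp add: P_def)
    ultimately show ?thesis by (simp only: sum_moebius_divisors) simp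
  qed
  ultimately have "((\<lambda>m. if m = 1 then \<phi> \<sigma> else 0) has_sum infsum F (P \<times> P)) P"
    by (simp cong: has_sum_cong)
  moreover have "((\<lambda>m::nat. if m = 1 then \<phi> \<sigma> else 0) has_sum \<phi> \<sigma>) P"
    by (rule has_sum_finite_neutralI[of "{1}"]) (auto simp: P_def)
  ultimately have "infsum F (P \<times> P) = \<phi> \<sigma>" by (rule has_sum_unique)
  then have "((\<lambda>n. complex_of_real (moebius_mu n) * r (real n * \<sigma>)) has_sum \<phi> \<sigma>) P" using outer by simp
  then have "((\<lambda>n. complex_of_real (moebius_mu (Suc n)) * r (real (Suc n) * \<sigma>)) has_sum \<phi> \<sigma>) UNIV"
    unfolding has_sum_Suc_reindex[of "\<lambda>n. complex_of_real (moebius_mu n) * r (real n * \<sigma>)"] P_def .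
  then show ?thesis by (rule has_sum_imp_sums)
qed

section \<open>Poisson summation and the equivalence\<close>

text \<open>Inversion writes the sample at h * k as an integral of the transform against cis (k h
  v), so Cesaro means of the samples bring in the Fejer kernel at h * v. Rescaling to period 2 pi
  leads to \<open>H\<close>; the constant is 2 pi / (sqrt (2 pi) * h) = sqrt (2 pi) / h.\<close>

lemma poisson_cesaro:
  assumes f: "integrable lborel f" "f \<in> bcontfun" and a: "a > 1"
    and decay: "\<And>v. \<bar>v\<bar> powr a * norm (fourier f v) \<le> C" and h: "h > 0"
  shows "(\<lambda>N. (\<Sum>n<N. \<Sum>k\<in>{- int n..int n}. f (h * of_int k)) / of_nat N) \<longlonglongrightarrow>
    complex_of_real (sqrt (2 * pi) / h) *
      (fourier f 0 + (\<Sum>k. fourier f (real (Suc k) * (2 * pi / h)) + fourier f (- (real (Suc k) * (2 * pi / h)))))"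
proof -
  define F where "F = fourier f"
  have Fb: "F \<in> bcontfun" unfolding F_def by (rule fourier_bcontfun[OF f(1)])
  obtain M where M: "M \<ge> 0" "\<And>v. norm (F v) \<le> M" using bcontfun_bound[OF Fb] by blast
  have C0: "C \<ge> 0" using decay[of 0] by simp
  have Fint: "integrable lborel F"
  proof (rule integrable_powr_decay[OF bcontfun_measurable[OF Fb] a])
    show "norm (F v) \<le> M + C" for v using M(2)[of v] C0 by simp
    show "\<bar>v\<bar> powr a * norm (F v) \<le> M + C" for v using decay[of v] M(1) by (simp add: F_def)
  qed
  define H where "H w = F (w / h)" for w
  have Hb: "H \<in> bcontfun"
    unfolding H_def[abs_def]
  proof (rule bcontfun_normI)
    show "continuous_on UNIV (\<lambda>w. F (w / h))"
      using Fb h by (intro continuous_on_compose2[of UNIV F UNIV "\<lambda>w. w / h"] continuous_intros) (auto simp: bcontfun_def)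
    show "norm (F (w / h)) \<le> M" for w by (rule M)
  qed
  have Hint: "integrable lborel H"
    using lborel_integrable_real_affine[OF Fint, of "1 / h" 0] h by (simp add: H_def[abs_def])
  have Hdecay: "\<bar>w\<bar> powr a * norm (H w) \<le> h powr a * C" for w
  proof -
    have "\<bar>w\<bar> powr a = h powr a * \<bar>w / h\<bar> powr a"
      using h by (simp add: powr_mult[symmetric])
    then show ?thesis
      using mult_left_mono[OF decay[of "w / h"], of "h powr a"] by (simp add: H_def F_def mult.assoc)
  qed
  have ces: "(\<Sum>n<N. \<Sum>k\<in>{- int n..int n}. f (h * of_int k)) / of_nat N =
      complex_of_real (1 / (sqrt (2 * pi) * h)) * (LINT w|lborel. H w * complex_of_real (fejer N w))"
    if N: "N > 0" for N
  proof -
    have inv: "f (h * of_int k) = complex_of_real (1 / sqrt (2 * pi)) * (LINT v|lborel. F v * cis (of_int k * (h * v)))" for k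
      using fourier_inversion_integral[OF f Fint[unfolded F_def], of "h * of_int k"]
      by (simp add: F_def cis_conv_exp mult_ac)
    have cint: "integrable lborel (\<lambda>v. F v * cis (of_int k * (h * v)))" for k
      by (rule integrable_mult_unimodular[OF Fint]) (auto intro!: borel_measurable_continuous_onI continuous_intros)
    have "(\<Sum>n<N. \<Sum>k\<in>{- int n..int n}. f (h * of_int k)) =
      complex_of_real (1 / sqrt (2 * pi)) * (\<Sum>n<N. \<Sum>k\<in>{- int n..int n}. LINT v|lborel. F v * cis (of_int k * (h * v)))"
      unfolding inv by (simp only: sum_distrib_left)
    also have "(\<Sum>n<N. \<Sum>k\<in>{- int n..int n}. LINT v|lborel. F v * cis (of_int k * (h * v))) =
      (LINT v|lborel. (\<Sum>n<N. \<Sum>k\<in>{- int n..int n}. F v * cis (of_int k * (h * v))))"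
      by (simp only: Bochner_Integration.integral_sum[OF Bochner_Integration.integrable_sum[OF cint]]
        Bochner_Integration.integral_sum[OF cint])
    also have "\<dots> = (LINT v|lborel. of_nat N * (F v * complex_of_real (fejer N (h * v))))"
    proof (intro Bochner_Integration.integral_cong refl)
      fix v
      have "of_nat N * complex_of_real (fejer N (h * v)) = (\<Sum>n<N. \<Sum>k\<in>{- int n..int n}. cis (of_int k * (h * v)))"
        unfolding fejer_eq using N by simp
      then have "F v * (of_nat N * complex_of_real (fejer N (h * v))) =
          (\<Sum>n<N. \<Sum>k\<in>{- int n..int n}. F v * cis (of_int k * (h * v)))"
        by (simp only: sum_distrib_left)
      then show "(\<Sum>n<N. \<Sum>k\<in>{- int n..int n}. F v * cis (of_int k * (h * v))) =
          of_nat N * (F v * complex_of_real (fejer N (h * v)))"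
        by (simp only: mult.left_commute)
    qed
    also have "\<dots> = of_nat N * (LINT v|lborel. F v * complex_of_real (fejer N (h * v)))"
      by (rule integral_mult_right_zero)
    also have "(LINT w|lborel. H w * complex_of_real (fejer N w)) =
       h *\<^sub>R (LINT v|lborel. F v * complex_of_real (fejer N (h * v)))"
      using h by (subst lborel_integral_real_affine[where c=h and t=0]) (auto simp: H_def)
    then have "(LINT v|lborel. F v * complex_of_real (fejer N (h * v))) =
       (LINT w|lborel. H w * complex_of_real (fejer N w)) / complex_of_real h"
      using h by (simp add: scaleR_conv_of_real)
    finally show ?thesis using N h by simp
  qed
  have "(\<lambda>N. (\<Sum>n<Suc N. \<Sum>k\<in>{- int n..int n}. f (h * of_int k)) / of_nat (Suc N)) \<longlonglongrightarrow>
      complex_of_real (1 / (sqrt (2 * pi) * h)) *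
      (2 * pi * (H 0 + (\<Sum>k. H (2 * pi * (1 + real k)) + H (- (2 * pi * (1 + real k))))))"
    unfolding ces[OF zero_less_Suc]
    by (intro tendsto_mult_left fejer_tendsto_periodization[OF Hb Hint a Hdecay])
  moreover have "complex_of_real (1 / (sqrt (2 * pi) * h)) * (complex_of_real (2 * pi) * x) =
      complex_of_real (sqrt (2 * pi) / h) * x" for x
  proof -
    have "1 / (sqrt (2 * pi) * h) * (2 * pi) = sqrt (2 * pi) / h"
      using h real_sqrt_mult_self[of "2 * pi"] by (simp add: field_simps)
    then show ?thesis
      by (metis mult.assoc of_real_mult)
  qed
  moreover have "H 0 = fourier f 0" "H (2 * pi * (1 + real k)) = fourier f (real (Suc k) * (2 * pi / h))"
    "H (- (2 * pi * (1 + real k))) = fourier f (- (real (Suc k) * (2 * pi / h)))" for k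
    by (auto simp: H_def F_def mult_ac)
  ultimately show ?thesis
    by (subst filterlim_sequentially_Suc[symmetric]) (simp only:)
qed

text \<open>The integral of f is the k = 0 term of the periodized transform, up to the factor
  \<open>sqrt (2 * pi)\<close>, so the subtraction leaves exactly the terms with k nonzero. The work
  lies in evaluating the symmetric limit inside \<open>quad_remainder\<close>.\<close>

lemma quad_remainder_eq:
  assumes fA: "f \<in> class_A" and a: "a > 1"
    and decay: "\<And>v. \<bar>v\<bar> powr a * norm (fourier f v) \<le> C" and s: "\<sigma> > 0"
  shows "quad_remainder \<sigma> f =
     - complex_of_real (sqrt (2 * pi)) * (\<Sum>k. fourier f (real (Suc k) * \<sigma>) + fourier f (- (real (Suc k) * \<sigma>)))"
proof -
  have f: "integrable lborel f" "f \<in> bcontfun" and BV: "f \<in> BV \<or> fourier f \<in> BV"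
    using fA by (auto simp: class_A_def L1_def)
  define h where "h = 2 * pi / \<sigma>"
  have h: "h > 0" "2 * pi / h = \<sigma>" using s by (auto simp: h_def)
  define S where "S = (\<Sum>k. fourier f (real (Suc k) * \<sigma>) + fourier f (- (real (Suc k) * \<sigma>)))"
  define L where "L = complex_of_real (sqrt (2 * pi) / h) * (fourier f 0 + S)"
  let ?a = "\<lambda>k::int. f (h * of_int k)"
  have ces: "(\<lambda>N. (\<Sum>n<N. \<Sum>k\<in>{- int n..int n}. ?a k) / of_nat N) \<longlonglongrightarrow> L"
    using poisson_cesaro[OF f a decay h(1)] unfolding L_def S_def h(2) .
  have "(\<lambda>n. \<Sum>k\<in>{- int n..int n}. ?a k) \<longlonglongrightarrow> L"
    using BV
  proof
    assume "f \<in> BV"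
    then obtain B where B: "\<And>n. (\<Sum>k\<in>{- int n..int n}. norm (?a k)) \<le> B"
      using BV_L1_samples_bounded[OF _ f(1) h(1)] by metis
    have "summable (\<lambda>i. norm (?a (int i + 1)) + norm (?a (- int i - 1)))"
    proof (rule bounded_imp_summable)
      show "(\<Sum>i\<le>n. norm (?a (int i + 1)) + norm (?a (- int i - 1))) \<le> B" for n
        using B[of "Suc n"] norm_ge_zero[of "?a 0"]
        unfolding sum_symmetric_conv[of "\<lambda>k. norm (?a k)"] lessThan_Suc_atMost by linarith
    qed auto
    then have "summable (\<lambda>i. ?a (int i + 1) + ?a (- int i - 1))"
      by (rule summable_comparison_test') (rule norm_triangle_ineq)
    then have "convergent (\<lambda>n. ?a 0 + (\<Sum>i<n. ?a (int i + 1) + ?a (- int i - 1)))"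
      by (intro convergent_add convergent_const) (simp add: summable_iff_convergent)
    then show ?thesis
      by (intro cesaro_convergent[OF ces]) (simp only: sum_symmetric_conv)
  next
    assume FBV: "fourier f \<in> BV"
    obtain M where M: "M \<ge> 0" "\<And>v. norm (fourier f v) \<le> M" using bcontfun_bound[OF fourier_bcontfun[OF f(1)]] by blast
    have C0: "C \<ge> 0" using decay[of 0] by simp
    have Fint: "integrable lborel (fourier f)"
    proof (rule integrable_powr_decay[OF borel_measurable_fourier[OF f(1)] a])
      show "norm (fourier f v) \<le> M + C" for v using M(2)[of v] C0 by simp
      show "\<bar>v\<bar> powr a * norm (fourier f v) \<le> M + C" for v using decay[of v] M(1) by simp
    qed
    \<comment> \<open>Inversion presents f as the reflected transform of a function of bounded
      variation, so this decay is inherited by f and its samples satisfy the Tauberian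
      condition.\<close>
    obtain K where K: "\<And>t. \<bar>t\<bar> * norm (fourier (fourier f) t) \<le> K"
      using fourier_BV_decay[OF FBV Fint] by metis
    show ?thesis
    proof (rule cesaro_hardy[OF ces])
      fix k :: int
      have "\<bar>h * of_int k\<bar> * norm (?a k) \<le> K"
        using K[of "- (h * of_int k)"] fourier_inversion[OF f Fint, of "h * of_int k"] by simp
      then show "\<bar>real_of_int k\<bar> * norm (?a k) \<le> K / h"
        using h(1) by (simp add: abs_mult field_simps)
    qed
  qed
  then have lim: "lim (\<lambda>n. \<Sum>k\<in>{- int n..int n}. ?a k) = L" by (rule limI)
  have "(LINT t|lborel. f t) = complex_of_real (sqrt (2 * pi)) * fourier f 0"
    by (simp add: fourier_def)
  moreover have "complex_of_real h * L = complex_of_real (sqrt (2 * pi)) * (fourier f 0 + S)"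
    using h(1) by (simp add: L_def)
  ultimately show ?thesis
    unfolding quad_remainder_def Let_def h_def[symmetric] lim S_def[symmetric] by (simp add: algebra_simps)
qed

section \<open>Even parts and the final estimates\<close>

lemma fourier_even_part:
  assumes "integrable lborel f"
  shows "fourier (even_part f) v = (fourier f v + fourier f (- v)) / 2"
    and "integrable lborel (even_part f)"
proof -
  have f': "integrable lborel (\<lambda>t. f (- t))"
    using lborel_integrable_real_affine[OF assms, of "-1" 0] by simp
  have eq: "even_part f = (\<lambda>t. (1 / 2) * (f t + f (- t)))"
    by (auto simp: even_part_def)
  show "integrable lborel (even_part f)"
    unfolding eq using assms f' by auto
  show "fourier (even_part f) v = (fourier f v + fourier f (- v)) / 2"
    unfolding eq fourier_cmult fourier_add[OF assms f'] fourier_reflect by simp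
qed

lemma even_part_bcontfun:
  assumes "f \<in> bcontfun"
  shows "even_part f \<in> bcontfun"
proof -
  obtain M where M: "\<And>x. norm (f x) \<le> M" using bcontfun_bound[OF assms] by blast
  have c: "continuous_on UNIV f" using assms by (simp add: bcontfun_def)
  show ?thesis
  proof (rule bcontfun_normI)
    show "continuous_on UNIV (even_part f)"
      unfolding even_part_def[abs_def]
      by (intro continuous_intros continuous_on_compose2[OF c]) auto
    show "norm (even_part f x) \<le> M" for x
      using norm_triangle_ineq[of "f x" "f (- x)"] M[of x] M[of "- x"] by (simp add: even_part_def norm_divide)
  qed
qed

lemma even_part_L2:
  assumes "f \<in> L2"
  shows "even_part f \<in> L2"
proof -
  have [measurable]: "f \<in> borel_measurable borel" by (rule L2_measurable[OF assms])
  have i: "integrable lborel (\<lambda>x. (norm (f x))\<^sup>2)" using assms by (simp add: L2_def)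
  have i': "integrable lborel (\<lambda>x. (norm (f (- x)))\<^sup>2)"
    using lborel_integrable_real_affine[OF i, of "-1" 0] by simp
  have m: "even_part f \<in> borel_measurable borel" unfolding even_part_def[abs_def] by measurable
  have "integrable lborel (\<lambda>x. (norm (even_part f x))\<^sup>2)"
  proof (rule Bochner_Integration.integrable_bound)
    show "integrable lborel (\<lambda>x. (norm (f x))\<^sup>2 + (norm (f (- x)))\<^sup>2)" using i i' by auto
    have "(norm (even_part f x))\<^sup>2 \<le> (norm (f x))\<^sup>2 + (norm (f (- x)))\<^sup>2" for x
    proof -
      have "(norm (even_part f x))\<^sup>2 = (norm (f x - - f (- x)))\<^sup>2 / 4"
        by (simp add: even_part_def norm_divide power_divide)
      also have "\<dots> \<le> (2 * (norm (f x))\<^sup>2 + 2 * (norm (f (- x)))\<^sup>2) / 4"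
        using norm_diff_sq_le[of "f x" "- f (- x)"] by (intro divide_right_mono) auto
      also have "\<dots> \<le> (norm (f x))\<^sup>2 + (norm (f (- x)))\<^sup>2" by simp
      finally show ?thesis .
    qed
    then show "AE x in lborel. norm ((norm (even_part f x))\<^sup>2) \<le> norm ((norm (f x))\<^sup>2 + (norm (f (- x)))\<^sup>2)"
      by auto
  qed (use m in measurable)
  then show ?thesis using m by (simp add: L2_def)
qed

lemma suminf_powr_bound:
  fixes x :: "nat \<Rightarrow> complex"
  assumes a: "a > 1" and x: "\<And>k. norm (x k) \<le> B * real (Suc k) powr - a"
  shows "norm (\<Sum>k. x k) \<le> B * (\<Sum>k. real (Suc k) powr - a)"
proof -
  have "norm (\<Sum>k. x k) \<le> (\<Sum>k. B * real (Suc k) powr - a)"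
    by (rule norm_suminf_le[OF x]) (intro summable_mult summable_powr_nat a)
  also have "\<dots> = B * (\<Sum>k. real (Suc k) powr - a)"
    by (rule suminf_mult[OF summable_powr_nat[OF a]])
  finally show ?thesis .
qed

theorem theorem7p4:
  fixes \<alpha> t0 :: real and f :: "real \<Rightarrow> complex" and lam :: "real \<Rightarrow> real"
  assumes "\<alpha> > 1"
    and "f \<in> class_A"
    and "(\<lambda>v. complex_of_real (\<bar>v\<bar> powr \<alpha>) * fourier f v) \<in> L2 \<inter> bcontfun"
    and "t0 > 0"
    and "\<And>t. t \<ge> t0 \<Longrightarrow> lam t \<ge> 0"
    and "antimono_on {t0..} lam"
  shows "(\<lambda>\<sigma>. dist_infty_Bernstein1 (strong_Riesz_derivative \<alpha> (even_part f)) \<sigma>)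
           \<in> O[at_top](lam)
     \<longleftrightarrow> (\<lambda>\<sigma>. norm (quad_remainder \<sigma> f)) \<in> O[at_top](\<lambda>\<sigma>. \<sigma> powr (- \<alpha>) * lam \<sigma>)"
proof -
  note a = \<open>\<alpha> > 1\<close>
  have f: "integrable lborel f" "f \<in> bcontfun"
    using assms(2) by (auto simp: class_A_def L1_def)
  define \<phi> where "\<phi> = fourier (even_part f)"
  have \<phi>: "\<phi> v = (fourier f v + fourier f (- v)) / 2" for v
    unfolding \<phi>_def by (rule fourier_even_part(1)[OF f(1)])
  define G where "G v = complex_of_real (\<bar>v\<bar> powr \<alpha>) * \<phi> v" for v
  \<comment> \<open>The factor \<open>\<bar>v\<bar> powr \<alpha>\<close> is even, so multiplication
    by it commutes with taking even parts, and both regularity properties pass to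
    \<open>G\<close>.\<close>
  have Geq: "G = even_part (\<lambda>v. complex_of_real (\<bar>v\<bar> powr \<alpha>) * fourier f v)"
    by (auto simp: G_def \<phi> even_part_def algebra_simps)
  have GL2: "G \<in> L2" and Gb: "G \<in> bcontfun"
    unfolding Geq using assms(3) by (auto intro: even_part_L2 even_part_bcontfun)
  have Geven: "norm (G (- v)) = norm (G v)" for v by (simp add: G_def \<phi> add.commute)
  obtain C where C: "C \<ge> 0" "\<And>v. norm (G v) \<le> C" using bcontfun_bound[OF Gb] by blast
  \<comment> \<open>\<open>C\<close> bounds the even part, \<open>D\<close> the full transform: the
    Poisson formula is applied to f itself.\<close>
  obtain D where D: "\<And>v. norm (complex_of_real (\<bar>v\<bar> powr \<alpha>) * fourier f v) \<le> D"
    using bcontfun_bound assms(3) by blast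
  obtain M where M: "M \<ge> 0" "\<And>v. norm (\<phi> v) \<le> M"
    using bcontfun_bound[OF fourier_bcontfun[OF fourier_even_part(2)[OF f(1)]]] unfolding \<phi>_def by blast
  have \<phi>int: "integrable lborel \<phi>"
  proof (rule integrable_powr_decay[where a=\<alpha>])
    show "\<phi> \<in> borel_measurable borel"
      unfolding \<phi>_def by (rule borel_measurable_fourier[OF fourier_even_part(2)[OF f(1)]])
    show "norm (\<phi> v) \<le> M + C" for v using M(2)[of v] C(1) by simp
    show "\<bar>v\<bar> powr \<alpha> * norm (\<phi> v) \<le> M + C" for v using C(2)[of v] M(1) by (simp add: G_def norm_mult)
  qed (rule a)
  have "fourier_Cb (strong_Riesz_derivative \<alpha> (even_part f)) = G"
    unfolding G_def[abs_def] \<phi>_def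
    by (rule fourier_Cb_strong_Riesz_derivative)
      (use a f fourier_even_part(2) even_part_bcontfun \<phi>int GL2 Gb in \<open>auto simp: G_def[abs_def] \<phi>_def\<close>)
  then have dist: "dist_infty_Bernstein1 (strong_Riesz_derivative \<alpha> (even_part f)) \<sigma>
      = (SUP v\<in>{v. \<sigma> \<le> \<bar>v\<bar>}. norm (G v))" if "\<sigma> > 0" for \<sigma>
    unfolding dist_infty_Bernstein1_def using Bernstein1_dist_eq[OF Gb that] by simp
  define S where "S \<sigma> = (SUP v\<in>{v. \<sigma> \<le> \<bar>v\<bar>}. norm (G v))" for \<sigma>
  have G_le_S: "norm (G v) \<le> S \<sigma>" if "\<sigma> \<le> \<bar>v\<bar>" for v \<sigma>
    unfolding S_def using that C(2) by (intro cSUP_upper bdd_aboveI2) auto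
  have S_le: "S \<sigma> \<le> B" if "\<And>v. \<sigma> \<le> v \<Longrightarrow> norm (G v) \<le> B" "\<sigma> > 0" for \<sigma> B
    unfolding S_def
  proof (rule cSUP_least)
    show "{v. \<sigma> \<le> \<bar>v\<bar>} \<noteq> {}" using that(2) by (auto intro: exI[of _ \<sigma>])
    fix v assume "v \<in> {v. \<sigma> \<le> \<bar>v\<bar>}"
    then show "norm (G v) \<le> B"
      using that(1)[of v] that(1)[of "- v"] Geven[of v] by (cases "v \<ge> 0") auto
  qed
  have \<phi>_powr: "norm (\<phi> x) = x powr - \<alpha> * norm (G x)" if "x > 0" for x
    using that by (simp add: G_def norm_mult powr_minus)
  define T where "T = (\<lambda>x. \<Sum>k. \<phi> (real (Suc k) * x))"
  \<comment> \<open>The terms at k and -k combine to 2 * \<phi>, which accounts for the factor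
    2.\<close>
  have R: "quad_remainder \<sigma> f = - complex_of_real (2 * sqrt (2 * pi)) * T \<sigma>" if s: "\<sigma> > 0" for \<sigma>
  proof -
    have "summable (\<lambda>k. \<phi> (real (Suc k) * \<sigma>))"
    proof (rule summable_comparison_test')
      show "summable (\<lambda>k. C * \<sigma> powr - \<alpha> * real (Suc k) powr - \<alpha>)" by (intro summable_mult summable_powr_nat a)
      show "norm (\<phi> (real (Suc k) * \<sigma>)) \<le> C * \<sigma> powr - \<alpha> * real (Suc k) powr - \<alpha>" for k
      proof -
        have "norm (\<phi> (real (Suc k) * \<sigma>)) = (real (Suc k) * \<sigma>) powr - \<alpha> * norm (G (real (Suc k) * \<sigma>))"
          using s by (intro \<phi>_powr) simp
        also have "\<dots> \<le> (real (Suc k) * \<sigma>) powr - \<alpha> * C" by (intro mult_left_mono C(2)) simp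
        also have "(real (Suc k) * \<sigma>) powr - \<alpha> = real (Suc k) powr - \<alpha> * \<sigma> powr - \<alpha>" by (rule powr_mult)
        finally show ?thesis by (simp only: mult_ac)
      qed
    qed
    then have "(\<Sum>k. 2 * \<phi> (real (Suc k) * \<sigma>)) = 2 * T \<sigma>" unfolding T_def by (rule suminf_mult)
    moreover have "2 * \<phi> x = fourier f x + fourier f (- x)" for x by (simp add: \<phi>)
    moreover have "quad_remainder \<sigma> f =
     - complex_of_real (sqrt (2 * pi)) * (\<Sum>k. fourier f (real (Suc k) * \<sigma>) + fourier f (- (real (Suc k) * \<sigma>)))"
      by (rule quad_remainder_eq[OF assms(2) a _ s, of D]) (use D in \<open>simp add: norm_mult\<close>)
    ultimately show ?thesis by simp
  qed
  define c where "c = 2 * sqrt (2 * pi)"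
  have c: "c > 0" by (simp add: c_def)
  have normR: "norm (quad_remainder \<sigma> f) = c * norm (T \<sigma>)" if "\<sigma> > 0" for \<sigma>
    unfolding R[OF that] c_def[symmetric] using c by (simp add: norm_mult)
  \<comment> \<open>The value of the Riemann zeta function at \<alpha>, the price of every termwise
    estimate in either direction.\<close>
  define Z where "Z = (\<Sum>k. real (Suc k) powr - \<alpha>)"
  have Z: "Z \<ge> 0" unfolding Z_def by (intro suminf_nonneg summable_powr_nat a) simp
  have T_le: "norm (T \<sigma>) \<le> \<sigma> powr - \<alpha> * S \<sigma> * Z" if s: "\<sigma> > 0" for \<sigma>
    unfolding T_def Z_def
  proof (rule suminf_powr_bound[OF a])
    fix k
    have "\<sigma> \<le> real (Suc k) * \<sigma>" using s by simp
    then have "norm (G (real (Suc k) * \<sigma>)) \<le> S \<sigma>" using s by (intro G_le_S) simp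
    then have "(real (Suc k) * \<sigma>) powr - \<alpha> * norm (G (real (Suc k) * \<sigma>)) \<le> (real (Suc k) * \<sigma>) powr - \<alpha> * S \<sigma>"
      by (intro mult_left_mono) auto
    moreover have "(real (Suc k) * \<sigma>) powr - \<alpha> = real (Suc k) powr - \<alpha> * \<sigma> powr - \<alpha>" by (rule powr_mult)
    ultimately show "norm (\<phi> (real (Suc k) * \<sigma>)) \<le> \<sigma> powr - \<alpha> * S \<sigma> * real (Suc k) powr - \<alpha>"
      using \<phi>_powr[of "real (Suc k) * \<sigma>"] s by (simp only: mult_ac) simp
  qed
  show ?thesis
  proof
    assume "(\<lambda>\<sigma>. dist_infty_Bernstein1 (strong_Riesz_derivative \<alpha> (even_part f)) \<sigma>) \<in> O[at_top](lam)"
    then obtain K where K: "\<forall>\<^sub>F \<sigma> in at_top. norm (dist_infty_Bernstein1 (strong_Riesz_derivative \<alpha> (even_part f)) \<sigma>) \<le> K * norm (lam \<sigma>)"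
      by (elim landau_o.bigE)
    have "\<forall>\<^sub>F \<sigma> in at_top. norm (norm (quad_remainder \<sigma> f)) \<le> (c * Z * K) * norm (\<sigma> powr (- \<alpha>) * lam \<sigma>)"
      using K eventually_gt_at_top[of 0]
    proof eventually_elim
      case (elim \<sigma>)
      have "S \<sigma> \<le> K * \<bar>lam \<sigma>\<bar>" using elim dist[of \<sigma>] by (simp add: S_def)
      then have "\<sigma> powr - \<alpha> * S \<sigma> * Z \<le> \<sigma> powr - \<alpha> * (K * \<bar>lam \<sigma>\<bar>) * Z"
        using Z by (intro mult_right_mono mult_left_mono) auto
      from order_trans[OF T_le[OF elim(2)] this]
      have "c * norm (T \<sigma>) \<le> c * (\<sigma> powr - \<alpha> * (K * \<bar>lam \<sigma>\<bar>) * Z)"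
        using c by (intro mult_left_mono) auto
      then show ?case using normR[of \<sigma>] elim c by (simp add: abs_mult mult_ac)
    qed
    then show "(\<lambda>\<sigma>. norm (quad_remainder \<sigma> f)) \<in> O[at_top](\<lambda>\<sigma>. \<sigma> powr (- \<alpha>) * lam \<sigma>)"
      by (rule bigoI)
  next
    assume "(\<lambda>\<sigma>. norm (quad_remainder \<sigma> f)) \<in> O[at_top](\<lambda>\<sigma>. \<sigma> powr (- \<alpha>) * lam \<sigma>)"
    then obtain K where K: "K > 0" "\<forall>\<^sub>F \<sigma> in at_top. norm (norm (quad_remainder \<sigma> f)) \<le> K * norm (\<sigma> powr (- \<alpha>) * lam \<sigma>)"
      by (elim landau_o.bigE)
    then obtain s0 where s0: "\<And>\<sigma>. \<sigma> \<ge> s0 \<Longrightarrow> norm (norm (quad_remainder \<sigma> f)) \<le> K * norm (\<sigma> powr (- \<alpha>) * lam \<sigma>)"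
      unfolding eventually_at_top_linorder by blast
    \<comment> \<open>From \<open>s0\<close> on the remainder bound holds, from \<open>t0\<close> on
      \<open>lam\<close> is nonnegative and nonincreasing. All multiples of any v \<ge> \<sigma>
      stay in this range.\<close>
    have main: "S \<sigma> \<le> (K / c * Z) * lam \<sigma>" if s: "\<sigma> \<ge> max s0 t0" for \<sigma>
    proof (rule S_le)
      show "\<sigma> > 0" using s assms(4) by simp
      fix v assume v: "\<sigma> \<le> v"
      have v0: "v > 0" "v \<ge> s0" "v \<ge> t0" using s v assms(4) by auto
      have lamv: "0 \<le> lam v" "lam v \<le> lam \<sigma>"
        using v0 s v assms(5) monotone_onD[OF assms(6), of \<sigma> v] by auto
      \<comment> \<open>Replacing \<open>lam\<close> at the multiple by \<open>lam v\<close> leaves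
        n^(-\<alpha>) as the only dependence on n.\<close>
      have Tn: "norm (T (real (Suc n) * v)) \<le> (K / c * (v powr - \<alpha> * lam v)) * real (Suc n) powr - \<alpha>" for n
      proof -
        let ?x = "real (Suc n) * v"
        have x: "v \<le> ?x" using v0 by simp
        then have x0: "?x > 0" "?x \<ge> s0" "?x \<ge> t0" using v0 by linarith+
        have lx: "0 \<le> lam ?x" "lam ?x \<le> lam v"
          using x0 v0 x assms(5) monotone_onD[OF assms(6), of v ?x] by auto
        have "c * norm (T ?x) \<le> K * (?x powr - \<alpha> * lam ?x)"
          using s0[OF x0(2)] normR[OF x0(1)] lx(1) by (simp add: abs_mult)
        also have "\<dots> \<le> K * (?x powr - \<alpha> * lam v)"
          using K(1) lx(2) by (intro mult_left_mono) auto
        also have "?x powr - \<alpha> = real (Suc n) powr - \<alpha> * v powr - \<alpha>" by (rule powr_mult)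
        finally show ?thesis using c by (simp add: field_simps)
      qed
      \<comment> \<open>The crude bound by \<open>C\<close> serves only the absolute convergence
        behind the inversion; the rate comes from the preceding bound on \<open>T\<close>.\<close>
      have "(\<lambda>n. complex_of_real (moebius_mu (Suc n)) * T (real (Suc n) * v)) sums \<phi> v"
        unfolding T_def
      proof (rule moebius_inversion_powr[OF a v0(1), of _ C])
        fix x assume "v \<le> x"
        then have x: "x > 0" using v0 by simp
        show "norm (\<phi> x) \<le> C * x powr - \<alpha>"
          unfolding \<phi>_powr[OF x] using C(2)[of x] by (simp add: mult.commute[of _ "x powr - \<alpha>"] mult_left_mono)
      qed
      then have "norm (\<phi> v) = norm (\<Sum>n. complex_of_real (moebius_mu (Suc n)) * T (real (Suc n) * v))"
        by (simp add: sums_iff)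
      also have "\<dots> \<le> (K / c * (v powr - \<alpha> * lam v)) * Z"
        unfolding Z_def
      proof (rule suminf_powr_bound[OF a])
        fix n
        have "norm (complex_of_real (moebius_mu (Suc n)) * T (real (Suc n) * v)) \<le> 1 * norm (T (real (Suc n) * v))"
          unfolding norm_mult norm_of_real by (intro mult_right_mono norm_moebius_le) auto
        then show "norm (complex_of_real (moebius_mu (Suc n)) * T (real (Suc n) * v))
          \<le> (K / c * (v powr - \<alpha> * lam v)) * real (Suc n) powr - \<alpha>"
          using Tn[of n] by linarith
      qed
      finally have "v powr - \<alpha> * norm (G v) \<le> v powr - \<alpha> * ((K / c * Z) * lam v)"
        unfolding \<phi>_powr[OF v0(1)] by (simp add: mult_ac)
      then have "norm (G v) \<le> (K / c * Z) * lam v"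
        using v0(1) by (subst (asm) mult_le_cancel_left_pos) auto
      also have "\<dots> \<le> (K / c * Z) * lam \<sigma>"
        using lamv K(1) c Z by (intro mult_left_mono) auto
      finally show "norm (G v) \<le> (K / c * Z) * lam \<sigma>" .
    qed
    have "\<forall>\<^sub>F \<sigma> in at_top. norm (dist_infty_Bernstein1 (strong_Riesz_derivative \<alpha> (even_part f)) \<sigma>) \<le> (K / c * Z) * norm (lam \<sigma>)"
      using eventually_ge_at_top[of "max s0 t0"]
    proof eventually_elim
      case (elim \<sigma>)
      then have s: "\<sigma> > 0" "lam \<sigma> \<ge> 0" using assms(4,5) by auto
      have "0 \<le> S \<sigma>" using G_le_S[of \<sigma> \<sigma>] norm_ge_zero[of "G \<sigma>"] s(1) by linarith
      then show ?case using main[OF elim] s dist[OF s(1)] by (simp add: S_def)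
    qed
    then show "(\<lambda>\<sigma>. dist_infty_Bernstein1 (strong_Riesz_derivative \<alpha> (even_part f)) \<sigma>) \<in> O[at_top](lam)"
      by (rule bigoI)
  qed
qed

end
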